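(* Let $1<p_-\le p_+<\infty$, $1<q_-\le q_+<\infty$, $p,q\in\mathcal{P}_{0,\infty}(0,\infty)$, $0\le\lambda<1$, and put $\beta(t)=\frac{1}{p(t)}-\frac{1}{q(t)}$ for $t>0$. Suppose that $$\sup_{r>0}\,[r]_1^{\frac{1}{q(0)}}\,r^{-\frac{\lambda}{q_*(r)}}<\infty,$$ that $\lim_{t\to0}t^{\beta(t)}$ exists and is finite, that the functions $t^{\beta(t)-a}$ and $t^{\frac{\lambda}{q_*(t)}-\beta(t)-a}$ are almost decreasing on $(0,\infty)$ for some $a\in\mathbb{R}$, and that $\beta(t)<\frac{\lambda}{q_*(t)}+\frac{1}{q'(0)}$ for $t>0$. Let $a(\cdot)$ be a function on $\mathbb{R}^n$ with $\int_{\mathbb{R}^n}a(y)\,dy=1$ which has a radial decreasing integrable majorant, and for $\varepsilon>0$ let $$A_\varepsilon f(x)=\frac1{\varepsilon^n}\int_{\mathbb{R}^n}a\left(\frac{x-y}{\varepsilon}\right)f(y)\,dy.$$ Then the sublinear operator $f\mapsto\sup_{\varepsilon>0}|A_\varepsilon f(x)|$ is bounded on the local variable Morrey-Lorentz space $\mathcal{M}^{loc}_{p(\cdot),q(\cdot),\lambda}(\mathbb{R}^n)$, i.e. there is $C>0$ such that $\big\|\sup_{\varepsilon>0}|A_\varepsilon f|\big\|_{\mathcal{M}^{loc}_{p(\cdot),q(\cdot),\lambda}}\le C\|f\|_{\mathcal{M}^{loc}_{p(\cdot),q(\cdot),\lambda}}$ for all $f\in\mathcal{M}^{loc}_{p(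\cdot),q(\cdot),\lambda}(\mathbb{R}^n)$.
   Context: For a measurable function $p$ on $(0,\infty)$, $p_-=\operatorname{ess\,inf}_{0<t<\infty}p(t)$, $p_+=\operatorname{ess\,sup}_{0<t<\infty}p(t)$, and $p'(t)=\frac{p(t)}{p(t)-1}$. The set $\mathcal{P}_{0,\infty}(0,\infty)$ consists of the bounded measurable functions $p$ on $(0,\infty)$ for which there are numbers $p(0),p(\infty)$ and constants $A_0,A_\infty>0$ with $|p(t)-p(0)|\le\frac{A_0}{|\ln t|}$ for $0<t\le\frac12$ and $|p(t)-p(\infty)|\le\frac{A_\infty}{\ln t}$ for $t\ge2$; $\frac1{q'(0)}=1-\frac1{q(0)}$. Put $[r]_1=\min\{1,r\}$, and $q_*(r)=q(0)$ for $0<r<1$, $q_*(r)=q(\infty)$ for $r\ge1$. A nonnegative function $\varphi$ on $(0,\infty)$ is almost decreasing (almost increasing) if there is $C\ge1$ with $\varphi(t)\le C\varphi(s)$ whenever $t\ge s$ (whenever $t\le s$). For $r\in(0,\infty]$, $\|\varphi\|_{L_{q(\cdot)}(0,r)}=\inf\{\eta>0:\int_0^r|\varphi(s)/\eta|^{q(s)}ds\le1\}$. For measurable $f$ on $\mathbb{R}^n$, $f^*(t)=\inf\{\mu>0:|\{y\in\mathbb{R}^n:|f(y)|>\mu\}|\le t\}$, $t>0$, is its non-increasing rearrangement. The local variable Morrey-Lorentz space $\mathcal{M}^{loc}_{p(\cdot),q(\cdot),\lambda}(\mathbb{R}^n)$ is the space of all measurable $f$ on $\mathbb{R}^n$ with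 finite quasinorm $$\|f\|_{\mathcal{M}^{loc}_{p(\cdot),q(\cdot),\lambda}}=\sup_{r>0}r^{-\frac{\lambda}{q_*(r)}}\big\|t^{\frac1{p(t)}-\frac1{q(t)}}f^*(t)\big\|_{L_{q(\cdot)}(0,r)}.$$ A radial decreasing integrable majorant of $a(\cdot)$ is an integrable function on $\mathbb{R}^n$ of the form $x\mapsto\psi(|x|)$ with $\psi$ non-increasing and $|a(x)|\le\psi(|x|)$. *)

theory Defs
  imports "HOL-Probability.Essential_Supremum"
begin

definition ess_upper :: "(real \<Rightarrow> real) \<Rightarrow> ereal" where
  "ess_upper p = esssup (lebesgue_on {0<..}) (\<lambda>t. ereal (p t))"

definition ess_lower :: "(real \<Rightarrow> real) \<Rightarrow> ereal" where
  "ess_lower p = - esssup (lebesgue_on {0<..}) (\<lambda>t. - ereal (p t))"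

definition log_decay_zero :: "(real \<Rightarrow> real) \<Rightarrow> real \<Rightarrow> bool" where
  "log_decay_zero p l \<longleftrightarrow> (\<exists>A>0. \<forall>t. 0 < t \<and> t \<le> 1/2 \<longrightarrow> \<bar>p t - l\<bar> \<le> A / \<bar>ln t\<bar>)"

definition log_decay_infty :: "(real \<Rightarrow> real) \<Rightarrow> real \<Rightarrow> bool" where
  "log_decay_infty p l \<longleftrightarrow> (\<exists>A>0. \<forall>t\<ge>2. \<bar>p t - l\<bar> \<le> A / ln t)"

text \<open>Exponents are functions on the open half-line, represented by total functions whose
  values on \<open>{..0}\<close> play no role.\<close>

definition exponents :: "(real \<Rightarrow> real) set" where
  "exponents = {p. p \<in> borel_measurable (lebesgue_on {0<..}) \<and> bounded (p ` {0<..}) \<and>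
     (\<exists>l. log_decay_zero p l) \<and> (\<exists>l. log_decay_infty p l)}"

text \<open>The numbers $p(0)$ and $p(\infty)$ attached to a member of \<^term>\<open>exponents\<close>. The first
  is not the function value \<open>p 0\<close>. Both are uniquely determined: see \<open>at_zero_eq\<close> and
  \<open>at_infty_eq\<close> below.\<close>

definition at_zero :: "(real \<Rightarrow> real) \<Rightarrow> real" where
  "at_zero p = (THE l. log_decay_zero p l)"

definition at_infty :: "(real \<Rightarrow> real) \<Rightarrow> real" where
  "at_infty p = (THE l. log_decay_infty p l)"

lemma log_decay_zero_tendsto:
  assumes "log_decay_zero p l"
  shows "(p \<longlongrightarrow> l) (at_right 0)"
proof -
  obtain A where A: "A > 0" "\<And>t. 0 < t \<Longrightarrow> t \<le> 1/2 \<Longrightarrow> \<bar>p t - l\<bar> \<le> A / \<bar>ln t\<bar>"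
    using assms by (auto simp: log_decay_zero_def)
  have "filterlim (\<lambda>t::real. \<bar>ln t\<bar>) at_top (at_right 0)"
    by (rule filterlim_compose[OF filterlim_abs_real]
             filterlim_at_bot_imp_at_infinity[THEN filterlim_at_infinity_imp_norm_at_top, simplified real_norm_def]
             ln_at_0)+
  then have "((\<lambda>t. A / \<bar>ln t\<bar>) \<longlongrightarrow> 0) (at_right 0)"
    by (intro tendsto_divide_0[OF tendsto_const]) (rule filterlim_at_top_imp_at_infinity)
  moreover have "eventually (\<lambda>t. norm (p t - l) \<le> A / \<bar>ln t\<bar>) (at_right 0)"
    using A(2) by (intro eventually_at_rightI[of 0 "1/2"]) auto
  ultimately have "((\<lambda>t. p t - l) \<longlongrightarrow> 0) (at_right 0)"
    by (rule Lim_null_comparison[rotated])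
  then show ?thesis by (simp add: LIM_zero_iff)
qed

lemma log_decay_infty_tendsto:
  assumes "log_decay_infty p l"
  shows "(p \<longlongrightarrow> l) at_top"
proof -
  obtain A where A: "A > 0" "\<And>t. t \<ge> 2 \<Longrightarrow> \<bar>p t - l\<bar> \<le> A / ln t"
    using assms by (auto simp: log_decay_infty_def)
  have "((\<lambda>t::real. A / ln t) \<longlongrightarrow> 0) at_top"
    by (intro tendsto_divide_0[OF tendsto_const] filterlim_at_top_imp_at_infinity ln_at_top)
  moreover have "eventually (\<lambda>t. norm (p t - l) \<le> A / ln t) at_top"
    using A(2) by (intro eventually_at_top_linorderI[of 2]) auto
  ultimately have "((\<lambda>t. p t - l) \<longlongrightarrow> 0) at_top"
    by (rule Lim_null_comparison[rotated])
  then show ?thesis by (simp add: LIM_zero_iff)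
qed

lemma at_zero_eq: "log_decay_zero p l \<Longrightarrow> at_zero p = l"
  unfolding at_zero_def
  by (rule the_equality)
     (auto intro: tendsto_unique[OF _ log_decay_zero_tendsto log_decay_zero_tendsto])

lemma at_infty_eq: "log_decay_infty p l \<Longrightarrow> at_infty p = l"
  unfolding at_infty_def
  by (rule the_equality)
     (auto intro: tendsto_unique[OF _ log_decay_infty_tendsto log_decay_infty_tendsto])

definition q_star :: "(real \<Rightarrow> real) \<Rightarrow> real \<Rightarrow> real" where
  "q_star q r = (if r < 1 then at_zero q else at_infty q)"

definition beta :: "(real \<Rightarrow> real) \<Rightarrow> (real \<Rightarrow> real) \<Rightarrow> real \<Rightarrow> real" where
  "beta p q t = 1 / p t - 1 / q t"

definition almost_decreasing :: "(real \<Rightarrow> real) \<Rightarrow> bool" where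
  "almost_decreasing \<phi> \<longleftrightarrow> (\<forall>t>0. 0 \<le> \<phi> t) \<and>
     (\<exists>C\<ge>1. \<forall>s t. 0 < s \<and> s \<le> t \<longrightarrow> \<phi> t \<le> C * \<phi> s)"

text \<open>Real powers of extended nonnegative numbers, used with a positive exponent.\<close>

definition ennreal_powr :: "ennreal \<Rightarrow> real \<Rightarrow> ennreal" where
  "ennreal_powr x a = (if x = \<infinity> then \<infinity> else ennreal (enn2real x powr a))"

text \<open>Luxemburg norm of the variable exponent Lebesgue space over \<open>S\<close>; the value is \<open>\<infinity>\<close>
  if there is no admissible \<open>\<eta>\<close>.\<close>

definition lux_norm :: "(real \<Rightarrow> real) \<Rightarrow> real set \<Rightarrow> (real \<Rightarrow> ennreal) \<Rightarrow> ennreal" where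
  "lux_norm q S \<phi> =
     (INF \<eta>\<in>{\<eta>::real. 0 < \<eta> \<and>
        (\<integral>\<^sup>+s\<in>S. ennreal_powr (\<phi> s / ennreal \<eta>) (q s) \<partial>lebesgue) \<le> 1}. ennreal \<eta>)"

text \<open>Functions on the Euclidean space are extended-real valued here because a supremum of
  averages may be infinite on a null set.\<close>

definition rearrangement :: "('a::euclidean_space \<Rightarrow> ereal) \<Rightarrow> real \<Rightarrow> ennreal" where
  "rearrangement f t =
     (INF \<mu>\<in>{\<mu>::real. 0 < \<mu> \<and>
        emeasure lebesgue {y. ereal \<mu> < \<bar>f y\<bar>} \<le> ennreal t}. ennreal \<mu>)"

definition morrey_lorentz_norm ::
  "(real \<Rightarrow> real) \<Rightarrow> (real \<Rightarrow> real) \<Rightarrow> real \<Rightarrow> ('a::euclidean_space \<Rightarrow> ereal) \<Rightarrow> ennreal" where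
  "morrey_lorentz_norm p q lam f =
     (SUP r\<in>{0<..}. ennreal (r powr (- (lam / q_star q r))) *
        lux_norm q {0<..<r} (\<lambda>t. ennreal (t powr beta p q t) * rearrangement f t))"

definition morrey_lorentz ::
  "(real \<Rightarrow> real) \<Rightarrow> (real \<Rightarrow> real) \<Rightarrow> real \<Rightarrow> ('a::euclidean_space \<Rightarrow> ereal) set" where
  "morrey_lorentz p q lam =
     {f. f \<in> borel_measurable lebesgue \<and> morrey_lorentz_norm p q lam f < \<infinity>}"

text \<open>The origin is left out so that majorants unbounded near the origin are admitted.\<close>

definition has_radial_decreasing_integrable_majorant :: "('a::euclidean_space \<Rightarrow> real) \<Rightarrow> bool" where
  "has_radial_decreasing_integrable_majorant a \<longleftrightarrow>
     (\<exists>\<psi>. antimono_on {0<..} \<psi> \<and> integrable lebesgue (\<lambda>x::'a. \<psi> (norm x)) \<and>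
        (\<forall>x. x \<noteq> 0 \<longrightarrow> \<bar>a x\<bar> \<le> \<psi> (norm x)))"

definition approx_avg ::
  "('a::euclidean_space \<Rightarrow> real) \<Rightarrow> real \<Rightarrow> ('a \<Rightarrow> real) \<Rightarrow> 'a \<Rightarrow> real" where
  "approx_avg a \<epsilon> f x =
     1 / \<epsilon> ^ DIM('a) * (\<integral>y. a ((x - y) /\<^sub>R \<epsilon>) * f y \<partial>lebesgue)"

definition approx_max ::
  "('a::euclidean_space \<Rightarrow> real) \<Rightarrow> ('a \<Rightarrow> real) \<Rightarrow> 'a \<Rightarrow> ereal" where
  "approx_max a f x = (SUP \<epsilon>\<in>{0<..}. ereal \<bar>approx_avg a \<epsilon> f x\<bar>)"

end

theory Submission
  imports Defs
begin

text \<open>The maximal function $\sup_\varepsilon|A_\varepsilon f|$ is estimated through its rearrangement, and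
the norm of the rearrangement through a Hardy inequality for non-increasing functions.

A kernel with a radial non-increasing majorant $\psi$ is a superposition of normalised balls. So
$|A_\varepsilon f(x)|$ is at most $\|\psi\|_1$ times a bound for the averages of $|f|$ over the balls
centred at $x$ (\<open>radial_kernel_le_ball_averages\<close>). Cut $|f|$ at the height $\mu=f^*(t)$ into a part
bounded by $\mu$ and an excess. The integral of the excess is at most $\int_0^t f^*$
(\<open>excess_integral_le_rearrangement\<close>), so by the Vitali covering lemma its ball averages are at most
a multiple of $\frac1t\int_0^tf^*$ outside a set of measure $t$ (\<open>weak_type_ball_averages\<close>). Together
$$\bigl(\sup_\varepsilon|A_\varepsilon f|\bigr)^*(t)\le C\,Hf^*(t),\qquad Hg(t)=\frac1t\int_0^tg(s)\,ds,$$
which is \<open>rearrangement_approx_max_le_hardy\<close>.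

It remains to bound $H$ on non-increasing functions with respect to the weight $t^{\beta(t)}$ and the
exponent $q(t)$. The values of $Hg$ on $(0,r)$ depend on $g$ on $(0,r)$ only, and $g\,1_{(0,r)}$ is
again non-increasing. One modular inequality on $(0,\infty)$ therefore gives all local inequalities with
the same constant; the factors $r^{-\lambda/q_*(r)}$ are common to both sides, and the supremum over $r$
yields the bound in the Morrey-Lorentz norm.

The modular inequality is \<open>hardy_inequality_variable_exponent\<close>. The decay conditions say
$|q(t)-q(0)|\,|\ln t|\le A$ near $0$ and $|q(t)-q(\infty)|\,|\ln t|\le A$ near $\infty$. So $m^{q(t)}$
may be replaced by $m^{q(0)}$ or $m^{q(\infty)}$ at bounded cost whenever $|\ln m|=O(1+|\ln t|)$, and
$t^{\beta(t)}$ by $t^{\beta(0)}$ or $t^{\beta(\infty)}$. A non-increasing function of bounded modular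
has a power of $t$ as an upper bound. A lower bound is forced by passing to
$\max(g(t),\min(1,1/t))$; the added function has finite modular since $\beta(0)>-1/q(0)$ and
$\beta(\infty)<1-1/q(\infty)$. With the exponents constant on each side of $t=1$ the inequality
is a classical power weight Hardy inequality, which needs $\beta(0)<1-1/q(0)$ and
$\beta(\infty)<1-1/q(\infty)$. These hold because $\beta=1/p-1/q$ and $p_->1$ force $p(0),p(\infty)>1$.

Membership of the maximal function in the space also requires its measurability, although the
supremum runs over uncountably many $\varepsilon$. For almost every $x$ the averages are continuous in
$\varepsilon$ (\<open>AE_kernel_integral_continuous\<close>), so rational $\varepsilon$ suffice.\<close>

section \<open>Real powers of extended nonnegative numbers\<close>

lemma ennreal_powr_ennreal: "0 \<le> x \<Longrightarrow> ennreal_powr (ennreal x) a = ennreal (x powr a)"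
  by (simp add: ennreal_powr_def)

lemma ennreal_powr_top [simp]: "ennreal_powr top a = top"
  by (simp add: ennreal_powr_def infinity_ennreal_def)

lemma ennreal_powr_0 [simp]: "ennreal_powr 0 a = 0"
  by (simp add: ennreal_powr_def)

lemma ennreal_powr_mono:
  assumes "x \<le> y" "0 \<le> a"
  shows "ennreal_powr x a \<le> ennreal_powr y a"
  using assms by (cases x; cases y) (auto simp: ennreal_powr_ennreal powr_mono2 top_unique)

lemma ennreal_powr_mult:
  assumes "0 < a"
  shows "ennreal_powr (x * y) a = ennreal_powr x a * ennreal_powr y a"
proof (cases x)
  case x: (real u)
  show ?thesis
  proof (cases y)
    case (real v)
    then show ?thesis using x
      by (simp add: ennreal_powr_ennreal powr_mult flip: ennreal_mult)
  next
    case top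
    then show ?thesis using x assms
      by (cases "u = 0") (auto simp: ennreal_powr_ennreal ennreal_mult_top)
  qed
next
  case x: top
  show ?thesis
  proof (cases y)
    case (real v)
    then show ?thesis using x assms
      by (cases "v = 0") (auto simp: ennreal_powr_ennreal ennreal_top_mult)
  qed (use x in simp)
qed

lemma ennreal_powr_powr: "ennreal_powr (ennreal_powr x a) b = ennreal_powr x (a * b)"
  by (cases x) (auto simp: ennreal_powr_ennreal powr_powr)

lemma ennreal_powr_one [simp]: "ennreal_powr x 1 = x"
  by (cases x) (auto simp: ennreal_powr_ennreal)

lemma ennreal_powr_max:
  "0 \<le> a \<Longrightarrow> ennreal_powr (max x y) a \<le> ennreal_powr x a + ennreal_powr y a"
  by (auto simp: max_def add_increasing add_increasing2)

lemma ennreal_powr_add_le: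
  assumes "0 < a"
  shows "ennreal_powr (x + y) a \<le> ennreal_powr 2 a * (ennreal_powr x a + ennreal_powr y a)"
proof -
  have "x + y \<le> 2 * max x y"
    by (simp add: mult_2 add_mono)
  then have "ennreal_powr (x + y) a \<le> ennreal_powr (2 * max x y) a"
    using assms by (intro ennreal_powr_mono) auto
  also have "\<dots> = ennreal_powr 2 a * ennreal_powr (max x y) a"
    using assms by (simp add: ennreal_powr_mult)
  also have "\<dots> \<le> ennreal_powr 2 a * (ennreal_powr x a + ennreal_powr y a)"
    using assms by (intro mult_left_mono ennreal_powr_max) auto
  finally show ?thesis .
qed

lemma ennreal_le_suminf: "f j \<le> (\<Sum>i. f i :: ennreal)"
  using sum_le_suminf[of f "{j}"] by simp

lemma measurable_ennreal_powr [measurable (raw)]: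
  assumes [measurable]: "h \<in> borel_measurable M" "q \<in> borel_measurable M"
  shows "(\<lambda>x. ennreal_powr (h x) (q x)) \<in> borel_measurable M"
  unfolding ennreal_powr_def by measurable

text \<open>A supremum is crudely replaced by a sum. In the power weight Hardy inequality this takes the place of
a convexity inequality: the geometric decay there leaves room for the loss.\<close>

lemma ennreal_powr_SUP_le:
  assumes "0 < a"
  shows "ennreal_powr (SUP j. x j) a \<le> (\<Sum>j::nat. ennreal_powr (x j) a)"
proof -
  define S where "S = (\<Sum>j::nat. ennreal_powr (x j) a)"
  have "x j \<le> ennreal_powr S (1 / a)" for j
  proof -
    have "ennreal_powr (x j) a \<le> S"
      unfolding S_def by (rule ennreal_le_suminf)
    then have "ennreal_powr (ennreal_powr (x j) a) (1 / a) \<le> ennreal_powr S (1 / a)"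
      using assms by (intro ennreal_powr_mono) auto
    then show ?thesis using assms by (simp add: ennreal_powr_powr)
  qed
  then have "(SUP j. x j) \<le> ennreal_powr S (1 / a)"
    by (intro SUP_least)
  then have "ennreal_powr (SUP j. x j) a \<le> ennreal_powr (ennreal_powr S (1 / a)) a"
    using assms by (intro ennreal_powr_mono) auto
  then show ?thesis using assms by (simp add: ennreal_powr_powr S_def)
qed

section \<open>Hardy averages of non-increasing functions\<close>

definition hardy :: "(real \<Rightarrow> ennreal) \<Rightarrow> real \<Rightarrow> ennreal" where
  "hardy g t = (\<integral>\<^sup>+s\<in>{0<..<t}. g s \<partial>lborel) / ennreal t"

lemma hardy_mono:
  assumes "\<And>s. 0 < s \<Longrightarrow> s < t \<Longrightarrow> g s \<le> h s"
  shows "hardy g t \<le> hardy h t"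
  unfolding hardy_def
  by (intro divide_right_mono_ennreal nn_integral_mono) (use assms in \<open>auto split: split_indicator\<close>)

text \<open>After scaling to the unit interval, monotonicity of the average in \<open>t\<close> and its comparison with
\<open>g t\<close> can be read off from the integrand.\<close>

lemma hardy_eq_integral_dilated:
  assumes [measurable]: "g \<in> borel_measurable borel" and "0 < t"
  shows "hardy g t = (\<integral>\<^sup>+u\<in>{0<..<1}. g (t * u) \<partial>lborel)"
proof -
  have "(\<integral>\<^sup>+s\<in>{0<..<t}. g s \<partial>lborel) = ennreal t * (\<integral>\<^sup>+u. g (t * u) * indicator {0<..<t} (t * u) \<partial>lborel)"
    using nn_integral_real_affine[of "\<lambda>s. g s * indicator {0<..<t} s" t 0] \<open>0 < t\<close> by simp
  also have "(\<integral>\<^sup>+u. g (t * u) * indicator {0<..<t} (t * u) \<partial>lborel) = (\<integral>\<^sup>+u\<in>{0<..<1}. g (t * u) \<partial>lborel)"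
    using \<open>0 < t\<close> by (intro nn_integral_cong) (auto split: split_indicator simp: zero_less_mult_iff)
  finally show ?thesis
    unfolding hardy_def
    using mult_divide_eq_ennreal[of "ennreal t" "\<integral>\<^sup>+u\<in>{0<..<1}. g (t * u) \<partial>lborel"] \<open>0 < t\<close>
    by (simp add: mult.commute[of "ennreal t"])
qed

lemma antimono_on_hardy:
  assumes [measurable]: "g \<in> borel_measurable borel" and g: "antimono_on {0<..} g"
  shows "antimono_on {0<..} (hardy g)"
proof (rule monotone_onI)
  fix s t :: real assume st: "s \<in> {0<..}" "t \<in> {0<..}" "s \<le> t"
  have "(\<integral>\<^sup>+u\<in>{0<..<1}. g (t * u) \<partial>lborel) \<le> (\<integral>\<^sup>+u\<in>{0<..<1}. g (s * u) \<partial>lborel)"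
    using st by (intro nn_integral_mono)
      (auto split: split_indicator intro!: monotone_onD[OF g])
  then show "hardy g t \<le> hardy g s"
    using st by (simp add: hardy_eq_integral_dilated)
qed

lemma le_hardy:
  assumes [measurable]: "g \<in> borel_measurable borel" and g: "antimono_on {0<..} g" and "0 < t"
  shows "g t \<le> hardy g t"
proof -
  have "g t = (\<integral>\<^sup>+u\<in>{0<..<1::real}. g t \<partial>lborel)"
    by (subst nn_integral_cmult_indicator) auto
  also have "\<dots> \<le> (\<integral>\<^sup>+u\<in>{0<..<1}. g (t * u) \<partial>lborel)"
    using \<open>0 < t\<close> by (intro nn_integral_mono)
      (auto split: split_indicator intro!: monotone_onD[OF g])
  finally show ?thesis
    using \<open>0 < t\<close> by (simp add: hardy_eq_integral_dilated)
qed

lemma measurable_hardy [measurable]: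
  assumes [measurable]: "g \<in> borel_measurable borel"
  shows "hardy g \<in> borel_measurable borel"
proof -
  have "hardy g = (\<lambda>t. (\<integral>\<^sup>+s. g s * (if 0 < s \<and> s < t then 1 else 0) \<partial>lborel) / ennreal t)"
    by (auto simp: hardy_def fun_eq_iff indicator_def of_bool_def intro!: arg_cong2[where f = "(/)"] nn_integral_cong)
  also have "\<dots> \<in> borel_measurable borel"
    by measurable
  finally show ?thesis .
qed

text \<open>Split \<open>(0, t)\<close> at the points \<open>t / 2 ^ j\<close> and bound \<open>g\<close> on each piece by its value at the left end.\<close>

lemma hardy_le_dyadic_sum:
  assumes [measurable]: "g \<in> borel_measurable borel" and g: "antimono_on {0<..} g" and t: "0 < t"
  shows "hardy g t \<le> (\<Sum>j. ennreal ((1/2) ^ Suc j) * g (t * (1/2) ^ Suc j))"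
proof -
  \<comment> \<open>The dyadic pieces of \<open>(0, 1)\<close>; piece \<open>j\<close> has length equal to its left end.\<close>
  define J where "J j = {(1/2) ^ Suc j..<(1/2) ^ j :: real}" for j :: nat
  have "hardy g t = (\<integral>\<^sup>+u\<in>{0<..<1}. g (t * u) \<partial>lborel)"
    using t by (simp add: hardy_eq_integral_dilated)
  also have "\<dots> \<le> (\<integral>\<^sup>+u. (\<Sum>j. g (t * (1/2) ^ Suc j) * indicator (J j) u) \<partial>lborel)"
  proof (intro nn_integral_mono)
    fix u :: real
    show "g (t * u) * indicator {0<..<1} u \<le> (\<Sum>j. g (t * (1/2) ^ Suc j) * indicator (J j) u)"
    proof (cases "u \<in> {0<..<1}")
      case True
      define j where "j = (LEAST j. (1/2) ^ Suc j \<le> u)"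
      have "\<exists>j. (1/2) ^ j < u"
        using True by (intro real_arch_pow_inv) auto
      then obtain k where "(1/2) ^ k < u" ..
      moreover have "(1/2) ^ Suc k \<le> ((1/2) ^ k :: real)" by simp
      ultimately have ex: "(1/2) ^ Suc k \<le> u" by linarith
      have j1: "(1/2) ^ Suc j \<le> u"
        unfolding j_def using ex by (rule LeastI)
      have j2: "u < (1/2) ^ j"
      proof (cases j)
        case 0 then show ?thesis using True by simp
      next
        case (Suc i)
        then have "\<not> (1/2) ^ Suc i \<le> u"
          unfolding j_def by (intro not_less_Least) (simp add: j_def[symmetric])
        then show ?thesis using Suc by simp
      qed
      have "g (t * u) * indicator {0<..<1} u = g (t * u)"
        using True by simp
      also have "\<dots> \<le> g (t * (1/2) ^ Suc j) * indicator (J j) u"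
        using j1 j2 t True by (auto simp: J_def intro!: monotone_onD[OF g])
      also have "\<dots> \<le> (\<Sum>j. g (t * (1/2) ^ Suc j) * indicator (J j) u)"
        by (rule ennreal_le_suminf)
      finally show ?thesis .
    qed simp
  qed
  also have "\<dots> = (\<Sum>j. \<integral>\<^sup>+u. g (t * (1/2) ^ Suc j) * indicator (J j) u \<partial>lborel)"
    by (intro nn_integral_suminf) (simp add: J_def)
  also have "\<dots> = (\<Sum>j. ennreal ((1/2) ^ Suc j) * g (t * (1/2) ^ Suc j))"
  proof (intro suminf_cong)
    fix j :: nat
    have "emeasure lborel (J j) = ennreal ((1/2) ^ Suc j)"
      by (simp add: J_def)
    then show "(\<integral>\<^sup>+u. g (t * (1/2) ^ Suc j) * indicator (J j) u \<partial>lborel) =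
        ennreal ((1/2) ^ Suc j) * g (t * (1/2) ^ Suc j)"
      by (subst nn_integral_cmult_indicator) (auto simp: J_def mult.commute)
  qed
  finally show ?thesis .
qed

lemma summable_half_powr:
  assumes "0 < e"
  shows "summable (\<lambda>j. ((1/2) ^ Suc j) powr e :: real)"
proof -
  have "((1/2) ^ n) powr e = ((1/2 :: real) powr e) ^ n" for n
    by (induction n) (simp_all only: power_Suc powr_mult power_0 powr_one_eq_one)
  moreover have "(1/2 :: real) powr e < 1"
    using assms powr_less_mono2[of e "1/2" 1] by simp
  then have "summable (\<lambda>j. ((1/2 :: real) powr e) ^ Suc j)"
    by (subst summable_Suc_iff) (rule summable_geometric, simp)
  ultimately show ?thesis by (simp only:)
qed

text \<open>Write the dyadic sum as $\sum_j2^{-j\delta}\cdot2^{-j(1-\delta)}g(2^{-j}t)$. It is at most a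
constant times the supremum of the second factors, and the $q$-th power of that supremum is at most the sum of
their $q$-th powers. Scaling shows that the $j$-th term contributes
$2^{-j(q(1-\delta-\beta)-1)}$ times the right-hand side. The exponent is positive for small $\delta$
exactly when $\beta+1/q<1$.\<close>

lemma hardy_inequality_powr_weight:
  assumes q: "0 < q" and \<beta>: "\<beta> + 1 / q < 1"
  shows "\<exists>C\<ge>0. \<forall>g. g \<in> borel_measurable borel \<longrightarrow> antimono_on {0<..} g \<longrightarrow>
    (\<integral>\<^sup>+t\<in>{0<..}. ennreal_powr (ennreal (t powr \<beta>) * hardy g t) q \<partial>lborel)
      \<le> ennreal C * (\<integral>\<^sup>+t\<in>{0<..}. ennreal_powr (ennreal (t powr \<beta>) * g t) q \<partial>lborel)"
proof -
  \<comment> \<open>Half of the available room, so that both geometric series below converge.\<close>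
  define \<delta> where "\<delta> = (1 - \<beta> - 1 / q) / 2"
  have \<delta>: "0 < \<delta>" using \<beta> by (simp add: \<delta>_def)
  define b where "b j = ((1/2) ^ Suc j :: real)" for j
  have b: "0 < b j" for j by (simp add: b_def)
  have sm: "summable (\<lambda>j. b j powr e)" if "0 < e" for e
    unfolding b_def using that by (rule summable_half_powr)
  define c where "c = (\<Sum>j. b j powr \<delta>)"
  define d where "d = (\<Sum>j. b j powr (q * \<delta>))"
  have c0: "0 \<le> c" unfolding c_def by (rule suminf_nonneg) (use \<delta> sm in auto)
  have d0: "0 \<le> d" unfolding d_def by (rule suminf_nonneg) (use \<delta> q sm in auto)
  have c: "(\<Sum>j. ennreal (b j powr \<delta>)) = ennreal c"
    unfolding c_def by (rule suminf_ennreal2) (use \<delta> sm in auto)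
  have d: "(\<Sum>j. ennreal (b j powr (q * \<delta>))) = ennreal d"
    unfolding d_def by (rule suminf_ennreal2) (use \<delta> q sm in auto)
  have ex: "q * (1 - \<delta> - \<beta>) - 1 = q * \<delta>"
    using q by (simp add: \<delta>_def field_simps)
  show ?thesis
  proof (intro exI[of _ "c powr q * d"] conjI allI impI)
    fix g :: "real \<Rightarrow> ennreal"
    assume [measurable]: "g \<in> borel_measurable borel" and g: "antimono_on {0<..} g"
    define F where "F s = ennreal_powr (ennreal (s powr \<beta>) * g s) q * indicator {0<..} s" for s
    have [measurable]: "F \<in> borel_measurable borel" unfolding F_def by measurable
    have pw: "ennreal_powr (ennreal (t powr \<beta>) * hardy g t) q \<le>
        (\<Sum>j. ennreal (c powr q * b j powr (q * (1 - \<delta> - \<beta>))) * F (b j * t))" if t: "0 < t" for t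
    proof -
      define x where "x j = ennreal (b j powr (1 - \<delta>)) * g (t * b j)" for j
      have "hardy g t \<le> (\<Sum>j. ennreal (b j) * g (t * b j))"
        unfolding b_def by (rule hardy_le_dyadic_sum[OF _ g t]) measurable
      also have "\<dots> = (\<Sum>j. ennreal (b j powr \<delta>) * x j)"
      proof (intro suminf_cong)
        fix j
        have "b j = b j powr \<delta> * b j powr (1 - \<delta>)"
          using b[of j] by (simp flip: powr_add)
        then show "ennreal (b j) * g (t * b j) = ennreal (b j powr \<delta>) * x j"
          by (simp add: x_def mult.assoc[symmetric] flip: ennreal_mult)
      qed
      also have "\<dots> \<le> (\<Sum>j. ennreal (b j powr \<delta>) * (SUP j. x j))"
        by (intro suminf_le mult_left_mono SUP_upper) auto
      also have "\<dots> = ennreal c * (SUP j. x j)"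
        by (simp add: c)
      finally have "ennreal_powr (ennreal (t powr \<beta>) * hardy g t) q \<le>
          ennreal_powr (ennreal (t powr \<beta>) * (ennreal c * (SUP j. x j))) q"
        using q by (intro ennreal_powr_mono mult_left_mono) auto
      also have "\<dots> = ennreal_powr (ennreal (t powr \<beta>)) q * ennreal (c powr q) * ennreal_powr (SUP j. x j) q"
        using q c0 by (simp add: ennreal_powr_mult ennreal_powr_ennreal[OF c0] mult.assoc)
      also have "\<dots> \<le> ennreal_powr (ennreal (t powr \<beta>)) q * ennreal (c powr q) * (\<Sum>j. ennreal_powr (x j) q)"
        using q by (intro mult_left_mono ennreal_powr_SUP_le) auto
      also have "\<dots> = (\<Sum>j. ennreal_powr (ennreal (t powr \<beta>)) q * ennreal (c powr q) * ennreal_powr (x j) q)"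
        by simp
      also have "\<dots> = (\<Sum>j. ennreal (c powr q * b j powr (q * (1 - \<delta> - \<beta>))) * F (b j * t))"
      proof (intro suminf_cong)
        fix j
        have e1: "t powr \<beta> * b j powr (1 - \<delta>) = b j powr (1 - \<delta> - \<beta>) * (b j * t) powr \<beta>"
          using t b[of j] by (simp add: powr_mult powr_diff)
        have "ennreal (t powr \<beta>) * x j =
            ennreal (b j powr (1 - \<delta> - \<beta>)) * (ennreal ((b j * t) powr \<beta>) * g (b j * t))"
          unfolding x_def by (simp add: mult.assoc[symmetric] e1 mult.commute[of t "b j"] flip: ennreal_mult)
        then have "ennreal_powr (ennreal (t powr \<beta>)) q * ennreal_powr (x j) q =
            ennreal_powr (ennreal (b j powr (1 - \<delta> - \<beta>))) q *
            ennreal_powr (ennreal ((b j * t) powr \<beta>) * g (b j * t)) q"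
          by (simp only: ennreal_powr_mult[OF q, symmetric])
        also have "ennreal_powr (ennreal (b j powr (1 - \<delta> - \<beta>))) q = ennreal (b j powr (q * (1 - \<delta> - \<beta>)))"
          by (simp add: ennreal_powr_ennreal powr_powr mult.commute)
        finally have "ennreal_powr (ennreal (t powr \<beta>)) q * ennreal_powr (x j) q =
            ennreal (b j powr (q * (1 - \<delta> - \<beta>))) * ennreal_powr (ennreal ((b j * t) powr \<beta>) * g (b j * t)) q" .
        then have "ennreal (c powr q) * (ennreal_powr (ennreal (t powr \<beta>)) q * ennreal_powr (x j) q) =
            ennreal (c powr q) * (ennreal (b j powr (q * (1 - \<delta> - \<beta>))) * F (b j * t))"
          using t b[of j] by (simp add: F_def)
        then show "ennreal_powr (ennreal (t powr \<beta>)) q * ennreal (c powr q) * ennreal_powr (x j) q =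
            ennreal (c powr q * b j powr (q * (1 - \<delta> - \<beta>))) * F (b j * t)"
          by (simp add: ennreal_mult mult_ac)
      qed
      finally show ?thesis .
    qed
    have "(\<integral>\<^sup>+t\<in>{0<..}. ennreal_powr (ennreal (t powr \<beta>) * hardy g t) q \<partial>lborel) \<le>
        (\<integral>\<^sup>+t. (\<Sum>j. ennreal (c powr q * b j powr (q * (1 - \<delta> - \<beta>))) * F (b j * t)) \<partial>lborel)"
      by (intro nn_integral_mono) (auto split: split_indicator intro: pw)
    also have "\<dots> = (\<Sum>j. ennreal (c powr q * b j powr (q * (1 - \<delta> - \<beta>))) * (\<integral>\<^sup>+t. F (b j * t) \<partial>lborel))"
      by (subst nn_integral_suminf) (auto simp: nn_integral_cmult)
    also have "\<dots> = (\<Sum>j. ennreal (c powr q) * (ennreal (b j powr (q * \<delta>)) * (\<integral>\<^sup>+s. F s \<partial>lborel)))"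
    proof (intro suminf_cong)
      fix j
      have "(\<integral>\<^sup>+s. F s \<partial>lborel) = ennreal (b j) * (\<integral>\<^sup>+t. F (b j * t) \<partial>lborel)"
        using nn_integral_real_affine[of F "b j" 0] b[of j] by simp
      then have "ennreal (b j powr (q * \<delta>)) * (\<integral>\<^sup>+s. F s \<partial>lborel) =
          ennreal (b j powr (q * \<delta>) * b j) * (\<integral>\<^sup>+t. F (b j * t) \<partial>lborel)"
        using b[of j] by (simp add: ennreal_mult mult.assoc)
      also have "b j powr (q * \<delta>) * b j = b j powr (q * (1 - \<delta> - \<beta>))"
        unfolding ex[symmetric] using b[of j] by (simp add: powr_diff)
      finally show "ennreal (c powr q * b j powr (q * (1 - \<delta> - \<beta>))) * (\<integral>\<^sup>+t. F (b j * t) \<partial>lborel) =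
          ennreal (c powr q) * (ennreal (b j powr (q * \<delta>)) * (\<integral>\<^sup>+s. F s \<partial>lborel))"
        by (simp add: ennreal_mult mult.assoc)
    qed
    also have "\<dots> = ennreal (c powr q * d) * (\<integral>\<^sup>+s. F s \<partial>lborel)"
      using d0 by (simp add: d ennreal_mult mult.assoc)
    finally show "(\<integral>\<^sup>+t\<in>{0<..}. ennreal_powr (ennreal (t powr \<beta>) * hardy g t) q \<partial>lborel)
      \<le> ennreal (c powr q * d) * (\<integral>\<^sup>+t\<in>{0<..}. ennreal_powr (ennreal (t powr \<beta>) * g t) q \<partial>lborel)"
      by (simp add: F_def)
  qed (use d0 in auto)
qed

section \<open>The Hardy inequality for variable exponents\<close>

abbreviation modular :: "(real \<Rightarrow> real) \<Rightarrow> (real \<Rightarrow> ennreal) \<Rightarrow> ennreal" where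
  "modular r m \<equiv> (\<integral>\<^sup>+t\<in>{0<..}. ennreal_powr (m t) (r t) \<partial>lborel)"

definition split_at_one :: "real \<Rightarrow> real \<Rightarrow> real \<Rightarrow> real" where
  "split_at_one u v t = (if t < 1 then u else v)"

lemma measurable_split_at_one [measurable]: "split_at_one u v \<in> borel_measurable borel"
  unfolding split_at_one_def by measurable

text \<open>The lower barrier used to keep logarithms of functions comparable with \<open>ln t\<close>. The rate \<open>1/t\<close> is the
decay of the Hardy average of an integrable function, and its weighted modular is still finite at
infinity.\<close>

definition tail_floor :: "real \<Rightarrow> real" where
  "tail_floor t = min 1 (1 / t)"

lemma measurable_tail_floor [measurable]: "tail_floor \<in> borel_measurable borel"
  unfolding tail_floor_def by measurable

lemma antimono_on_tail_floor: "antimono_on {0<..} (\<lambda>t. ennreal (tail_floor t))"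
  by (rule monotone_onI)
    (auto simp: tail_floor_def intro!: ennreal_leI min.coboundedI2 divide_left_mono)

text \<open>If \<open>g t\<close> exceeded \<open>8 K / t\<^sup>2\<close>, then by monotonicity so would \<open>g\<close> on \<open>(t/2, t)\<close>. There the weight
is at least \<open>t/2\<close>, so the integrand would exceed \<open>4 K / t\<close> on an interval of length \<open>t/2\<close>. The
quadratic rate is not sharp; any fixed power of \<open>t\<close> serves in \<open>modular_change_exponent\<close>.\<close>

lemma antimono_bound_near_zero:
  assumes g: "antimono_on {0<..} g" and b: "b \<le> 1" and K: "1 \<le> K" and t: "0 < t" "t \<le> 1"
    and r: "AE s in lborel. 0 < s \<longrightarrow> 1 \<le> r s"
    and le: "(\<integral>\<^sup>+s\<in>{0<..<1}. ennreal_powr (ennreal (s powr b) * g s) (r s) \<partial>lborel) \<le> ennreal K"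
  shows "g t \<le> ennreal (8 * K / t\<^sup>2)"
proof (rule ccontr)
  assume "\<not> ?thesis"
  then have gt: "ennreal (8 * K / t\<^sup>2) \<le> g t" by simp
  define x where "x = 4 * K / t"
  have x1: "1 \<le> x" using t K by (simp add: x_def field_simps)
  have "ennreal (2 * K) = ennreal x * emeasure lborel {t/2<..<t}"
    using t K by (simp add: x_def flip: ennreal_mult)
  also have "\<dots> = (\<integral>\<^sup>+s. ennreal x * indicator {t/2<..<t} s \<partial>lborel)"
    by (rule nn_integral_cmult_indicator[symmetric]) simp
  also have "\<dots> \<le> (\<integral>\<^sup>+s\<in>{0<..<1}. ennreal_powr (ennreal (s powr b) * g s) (r s) \<partial>lborel)"
  proof (rule nn_integral_mono_AE, use r in eventually_elim)
    fix s :: real assume rs: "0 < s \<longrightarrow> 1 \<le> r s"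
    show "ennreal x * indicator {t/2<..<t} s \<le>
        ennreal_powr (ennreal (s powr b) * g s) (r s) * indicator {0<..<1} s"
    proof (cases "s \<in> {t/2<..<t}")
      case True
      then have s: "0 < s" "s < 1" "t / 2 \<le> s" "s \<le> t" using t by auto
      have "t / 2 \<le> s powr 1" using s by simp
      also have "\<dots> \<le> s powr b" using s b by (intro powr_mono') auto
      finally have "ennreal (t / 2) \<le> ennreal (s powr b)" by (rule ennreal_leI)
      moreover have "ennreal (8 * K / t\<^sup>2) \<le> g s"
        using gt monotone_onD[OF g, of s t] s t by auto
      ultimately have "ennreal (t / 2) * ennreal (8 * K / t\<^sup>2) \<le> ennreal (s powr b) * g s"
        by (intro mult_mono) auto
      also have "ennreal (t / 2) * ennreal (8 * K / t\<^sup>2) = ennreal x"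
        using t K by (simp add: x_def power2_eq_square flip: ennreal_mult)
      finally have "ennreal_powr (ennreal x) (r s) \<le> ennreal_powr (ennreal (s powr b) * g s) (r s)"
        using rs s by (intro ennreal_powr_mono) auto
      moreover have "ennreal x \<le> ennreal_powr (ennreal x) (r s)"
        using x1 rs s powr_mono[of 1 "r s" x] by (simp add: ennreal_powr_ennreal ennreal_leI)
      ultimately show ?thesis using True s by (simp add: order_trans)
    qed simp
  qed
  also note le
  finally show False using K by simp
qed

lemma antimono_bound:
  assumes g: "antimono_on {0<..} g" and b: "b0 \<le> 1" and K: "1 \<le> K"
    and r: "AE s in lborel. 0 < s \<longrightarrow> 1 \<le> r s"
    and le: "modular r (\<lambda>t. ennreal (t powr split_at_one b0 b1 t) * g t) \<le> ennreal K" and t: "0 < t"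
  shows "g t \<le> ennreal (8 * K * max 1 (1 / t\<^sup>2))"
proof -
  have "(\<integral>\<^sup>+s\<in>{0<..<1}. ennreal_powr (ennreal (s powr b0) * g s) (r s) \<partial>lborel) \<le>
      modular r (\<lambda>t. ennreal (t powr split_at_one b0 b1 t) * g t)"
    by (intro nn_integral_mono) (auto simp: split_at_one_def split: split_indicator)
  also note le
  finally have le': "(\<integral>\<^sup>+s\<in>{0<..<1}. ennreal_powr (ennreal (s powr b0) * g s) (r s) \<partial>lborel) \<le> ennreal K" .
  \<comment> \<open>Beyond 1 monotonicity reduces to the value at 1.\<close>
  define \<tau> where "\<tau> = min t 1"
  have "g t \<le> g \<tau>" using t by (auto simp: \<tau>_def intro!: monotone_onD[OF g])
  also have "g \<tau> \<le> ennreal (8 * K / \<tau>\<^sup>2)"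
    using t by (intro antimono_bound_near_zero[OF g b K _ _ r le']) (auto simp: \<tau>_def)
  also have "\<dots> \<le> ennreal (8 * K * max 1 (1 / t\<^sup>2))"
  proof (rule ennreal_leI)
    show "8 * K / \<tau>\<^sup>2 \<le> 8 * K * max 1 (1 / t\<^sup>2)"
    proof (cases "t \<le> 1")
      case True
      then have "8 * K / \<tau>\<^sup>2 = 8 * K * (1 / t\<^sup>2)" by (simp add: \<tau>_def)
      also have "\<dots> \<le> 8 * K * max 1 (1 / t\<^sup>2)" using K by (intro mult_left_mono) auto
      finally show ?thesis .
    next
      case False
      then show ?thesis using K by (simp add: \<tau>_def)
    qed
  qed
  finally show ?thesis .
qed

text \<open>For \<open>m\<close> above the barrier and of bounded modular, \<open>m t\<close> lies between two powers of \<open>t\<close> up to constants.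
So the logarithm of the weighted function \<open>z\<close> is at most \<open>L * (1 + \<bar>ln t\<bar>)\<close>, and changing its
exponent from \<open>r1 t\<close> to \<open>r2 t\<close> costs at most the factor \<open>exp (A * L)\<close>. The constant depends on \<open>m\<close>
only through the bound \<open>K\<close>, which is what makes repeated use possible.\<close>

lemma modular_change_exponent:
  assumes A: "0 \<le> A" and b: "\<bar>b0\<bar> \<le> 1" "\<bar>b1\<bar> \<le> 1" and K: "1 \<le> K"
    and r1 [measurable]: "r1 \<in> borel_measurable borel"
    and r: "AE t in lborel. 0 < t \<longrightarrow> 1 \<le> r1 t \<and> 1 \<le> r2 t \<and> \<bar>r1 t - r2 t\<bar> * (1 + \<bar>ln t\<bar>) \<le> A"
  shows "\<exists>K'\<ge>1. \<forall>m. m \<in> borel_measurable borel \<longrightarrow> antimono_on {0<..} m \<longrightarrow>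
    (\<forall>t>0. ennreal (tail_floor t) \<le> m t) \<longrightarrow>
    modular r1 (\<lambda>t. ennreal (t powr split_at_one b0 b1 t) * m t) \<le> ennreal K \<longrightarrow>
    modular r2 (\<lambda>t. ennreal (t powr split_at_one b0 b1 t) * m t) \<le> ennreal K'"
proof -
  define L where "L = 3 + ln (8 * K)"
  have L: "3 \<le> L" using K by (simp add: L_def)
  show ?thesis
  proof (intro exI[of _ "exp (A * L) * K"] conjI allI impI)
    have "1 \<le> exp (A * L)" using A L by simp
    then show "1 \<le> exp (A * L) * K" using K mult_mono[of 1 "exp (A * L)" 1 K] by simp
  next
    fix m assume [measurable]: "m \<in> borel_measurable borel" and m: "antimono_on {0<..} m"
      and floor: "\<forall>t>0. ennreal (tail_floor t) \<le> m t"
      and le: "modular r1 (\<lambda>t. ennreal (t powr split_at_one b0 b1 t) * m t) \<le> ennreal K"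
    have r1': "AE s in lborel. 0 < s \<longrightarrow> 1 \<le> r1 s" using r by eventually_elim auto
    have ub: "m t \<le> ennreal (8 * K * max 1 (1 / t\<^sup>2))" if "0 < t" for t
      by (rule antimono_bound[OF m _ K r1' le that]) (use b in auto)
    have "modular r2 (\<lambda>t. ennreal (t powr split_at_one b0 b1 t) * m t) \<le>
        (\<integral>\<^sup>+t. ennreal (exp (A * L)) *
          (ennreal_powr (ennreal (t powr split_at_one b0 b1 t) * m t) (r1 t) * indicator {0<..} t) \<partial>lborel)"
    proof (rule nn_integral_mono_AE, use r in eventually_elim)
      fix t :: real
      assume rt: "0 < t \<longrightarrow> 1 \<le> r1 t \<and> 1 \<le> r2 t \<and> \<bar>r1 t - r2 t\<bar> * (1 + \<bar>ln t\<bar>) \<le> A"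
      show "ennreal_powr (ennreal (t powr split_at_one b0 b1 t) * m t) (r2 t) * indicator {0<..} t \<le>
        ennreal (exp (A * L)) *
          (ennreal_powr (ennreal (t powr split_at_one b0 b1 t) * m t) (r1 t) * indicator {0<..} t)"
      proof (cases "0 < t")
        case t: True
        have "m t < top" using ub[OF t] by (auto simp: less_top[symmetric] top_unique)
        then obtain y where y0: "0 \<le> y" and y: "m t = ennreal y" by (cases "m t") auto
        have max1: "1 \<le> max 1 (1 / t\<^sup>2)" by simp
        have yle: "y \<le> 8 * K * max 1 (1 / t\<^sup>2)"
          using ub[OF t] K unfolding y by (subst (asm) ennreal_le_iff) auto
        have fl: "tail_floor t \<le> y" using floor t y0 by (auto simp: y)
        have fl0: "0 < tail_floor t" using t by (simp add: tail_floor_def)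
        have yp: "0 < y" using fl fl0 by linarith
        have "ln y \<le> ln (8 * K * max 1 (1 / t\<^sup>2))" using yp yle by simp
        also have "\<dots> = ln (8 * K) + ln (max 1 (1 / t\<^sup>2))" using K max1 by (subst ln_mult_pos) auto
        also have "ln (max 1 (1 / t\<^sup>2)) \<le> 2 * \<bar>ln t\<bar>"
          using t by (auto simp: max_def ln_div ln_realpow)
        finally have ln1: "ln y \<le> ln (8 * K) + 2 * \<bar>ln t\<bar>" by simp
        have "- \<bar>ln t\<bar> \<le> ln (tail_floor t)"
          using t by (auto simp: tail_floor_def min_def ln_div)
        also have "\<dots> \<le> ln y" using fl fl0 by simp
        finally have ln2: "- \<bar>ln t\<bar> \<le> ln y" .
        have K8: "0 \<le> ln (8 * K)" using K by simp
        have lny: "\<bar>ln y\<bar> \<le> ln (8 * K) + 2 * \<bar>ln t\<bar>" using ln1 ln2 K8 by linarith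
        define B where "B = split_at_one b0 b1 t"
        have B: "\<bar>B\<bar> \<le> 1" using b by (simp add: B_def split_at_one_def)
        define z where "z = t powr B * y"
        have z: "0 < z" using t yp by (simp add: z_def)
        have "ln z = B * ln t + ln y" using t yp by (simp add: z_def ln_mult_pos ln_powr)
        then have "\<bar>ln z\<bar> \<le> \<bar>B\<bar> * \<bar>ln t\<bar> + \<bar>ln y\<bar>" by (metis abs_mult abs_triangle_ineq)
        also have "\<bar>B\<bar> * \<bar>ln t\<bar> \<le> 1 * \<bar>ln t\<bar>" using B by (intro mult_right_mono) auto
        also note lny
        also have "1 * \<bar>ln t\<bar> + (ln (8 * K) + 2 * \<bar>ln t\<bar>) \<le> L * (1 + \<bar>ln t\<bar>)"
          using K8 by (simp add: L_def algebra_simps)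
        finally have lnz: "\<bar>ln z\<bar> \<le> L * (1 + \<bar>ln t\<bar>)" by simp
        have "(r2 t - r1 t) * ln z \<le> \<bar>r1 t - r2 t\<bar> * \<bar>ln z\<bar>"
          by (metis abs_ge_self abs_minus_commute abs_mult)
        also have "\<dots> \<le> \<bar>r1 t - r2 t\<bar> * (L * (1 + \<bar>ln t\<bar>))"
          using lnz by (intro mult_left_mono) auto
        also have "\<dots> = L * (\<bar>r1 t - r2 t\<bar> * (1 + \<bar>ln t\<bar>))" by simp
        also have "\<dots> \<le> L * A" using L rt t by (intro mult_left_mono) auto
        finally have "exp (r2 t * ln z) \<le> exp (A * L + r1 t * ln z)"
          by (simp add: algebra_simps)
        then have "z powr r2 t \<le> exp (A * L) * z powr r1 t"
          using z by (simp add: powr_def exp_add)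
        then have "ennreal (z powr r2 t) \<le> ennreal (exp (A * L)) * ennreal (z powr r1 t)"
          by (simp add: ennreal_leI flip: ennreal_mult)
        moreover have "ennreal (t powr split_at_one b0 b1 t) * m t = ennreal z"
          using yp by (simp add: z_def y B_def ennreal_mult)
        ultimately show ?thesis using t z by (simp add: ennreal_powr_ennreal)
      qed simp
    qed
    also have "\<dots> = ennreal (exp (A * L)) * modular r1 (\<lambda>t. ennreal (t powr split_at_one b0 b1 t) * m t)"
      by (rule nn_integral_cmult) measurable
    also have "\<dots> \<le> ennreal (exp (A * L)) * ennreal K"
      using le by (intro mult_left_mono) auto
    also have "\<dots> = ennreal (exp (A * L) * K)" using K by (simp add: ennreal_mult)
    finally show "modular r2 (\<lambda>t. ennreal (t powr split_at_one b0 b1 t) * m t) \<le> ennreal (exp (A * L) * K)" .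
  qed
qed

lemma nn_integral_powr_unit_interval:
  assumes "-1 < a"
  shows "(\<integral>\<^sup>+t\<in>{0<..<1}. ennreal (t powr a) \<partial>lborel) \<le> ennreal (1 / (a + 1))"
proof -
  have "(\<integral>\<^sup>+t\<in>{0<..<1}. ennreal (t powr a) \<partial>lborel) \<le> (\<integral>\<^sup>+t\<in>{0..1}. ennreal (t powr a) \<partial>lborel)"
    by (intro nn_integral_mono) (auto split: split_indicator)
  also have "\<dots> = ennreal (1 / (a + 1))"
    using nn_integral_has_integral_lebesgue'[OF _ has_integral_powr_from_0[of a 1]] assms by simp
  finally show ?thesis .
qed

lemma nn_integral_powr_from_one:
  assumes "a < -1"
  shows "(\<integral>\<^sup>+t\<in>{1..}. ennreal (t powr a) \<partial>lborel) = ennreal (- 1 / (a + 1))"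
  using nn_integral_has_integral_lebesgue'[OF _ has_integral_powr_to_inf[of a 1]] assms by simp

lemma modular_split_at_one:
  assumes [measurable]: "m \<in> borel_measurable borel"
  shows "modular (split_at_one q0 q1) m =
    (\<integral>\<^sup>+t\<in>{0<..<1}. ennreal_powr (m t) q0 \<partial>lborel) + (\<integral>\<^sup>+t\<in>{1..}. ennreal_powr (m t) q1 \<partial>lborel)"
proof -
  have "modular (split_at_one q0 q1) m = (\<integral>\<^sup>+t. ennreal_powr (m t) q0 * indicator {0<..<1} t +
      ennreal_powr (m t) q1 * indicator {1..} t \<partial>lborel)"
    by (intro nn_integral_cong) (auto simp: split_at_one_def split: split_indicator)
  also have "\<dots> = (\<integral>\<^sup>+t\<in>{0<..<1}. ennreal_powr (m t) q0 \<partial>lborel) + (\<integral>\<^sup>+t\<in>{1..}. ennreal_powr (m t) q1 \<partial>lborel)"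
    by (rule nn_integral_add) auto
  finally show ?thesis .
qed

text \<open>The barrier is 1 near 0 and \<open>1/t\<close> near infinity, so the two hypotheses on \<open>b0\<close> and \<open>b1\<close> are the
integrability conditions for the resulting powers of \<open>t\<close>.\<close>

lemma modular_tail_floor_finite:
  assumes q: "0 < q0" "0 < q1" and b: "- 1 / q0 < b0" "b1 + 1 / q1 < 1"
  shows "\<exists>K\<ge>1. modular (split_at_one q0 q1)
      (\<lambda>t. ennreal (t powr split_at_one b0 b1 t) * ennreal (tail_floor t)) \<le> ennreal K"
proof -
  have e0: "- 1 < b0 * q0" using b(1) q(1) by (simp add: field_simps)
  have e1: "(b1 - 1) * q1 < - 1" using b(2) q(2) by (simp add: field_simps)
  have "(\<integral>\<^sup>+t\<in>{0<..<1}. ennreal_powr (ennreal (t powr split_at_one b0 b1 t) * ennreal (tail_floor t)) q0 \<partial>lborel)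
      = (\<integral>\<^sup>+t\<in>{0<..<1}. ennreal (t powr (b0 * q0)) \<partial>lborel)"
    by (intro nn_integral_cong)
      (auto simp: split_at_one_def tail_floor_def ennreal_powr_ennreal powr_powr split: split_indicator)
  also have "\<dots> \<le> ennreal (1 / (b0 * q0 + 1))"
    by (rule nn_integral_powr_unit_interval[OF e0])
  finally have 1: "(\<integral>\<^sup>+t\<in>{0<..<1}. ennreal_powr (ennreal (t powr split_at_one b0 b1 t) * ennreal (tail_floor t)) q0 \<partial>lborel)
      \<le> ennreal (1 / (b0 * q0 + 1))" .
  have "(\<integral>\<^sup>+t\<in>{1..}. ennreal_powr (ennreal (t powr split_at_one b0 b1 t) * ennreal (tail_floor t)) q1 \<partial>lborel)
      = (\<integral>\<^sup>+t\<in>{1..}. ennreal (t powr ((b1 - 1) * q1)) \<partial>lborel)"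
  proof (intro nn_integral_cong)
    fix t :: real
    show "ennreal_powr (ennreal (t powr split_at_one b0 b1 t) * ennreal (tail_floor t)) q1 * indicator {1..} t =
        ennreal (t powr ((b1 - 1) * q1)) * indicator {1..} t"
    proof (cases "1 \<le> t")
      case True
      then have "ennreal (t powr split_at_one b0 b1 t) * ennreal (tail_floor t) = ennreal (t powr (b1 - 1))"
        by (simp add: split_at_one_def tail_floor_def powr_diff min_def flip: ennreal_mult)
      then show ?thesis by (simp add: ennreal_powr_ennreal powr_powr)
    qed simp
  qed
  also have "\<dots> = ennreal (- 1 / ((b1 - 1) * q1 + 1))"
    by (rule nn_integral_powr_from_one[OF e1])
  finally have 2: "(\<integral>\<^sup>+t\<in>{1..}. ennreal_powr (ennreal (t powr split_at_one b0 b1 t) * ennreal (tail_floor t)) q1 \<partial>lborel)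
      = ennreal (- 1 / ((b1 - 1) * q1 + 1))" .
  have pos: "0 \<le> 1 / (b0 * q0 + 1)" "0 \<le> - 1 / ((b1 - 1) * q1 + 1)"
    using e0 e1 by (auto simp: divide_simps)
  show ?thesis
    by (intro exI[of _ "max 1 (1 / (b0 * q0 + 1) + (- 1 / ((b1 - 1) * q1 + 1)))"] conjI)
      (use 1 pos in \<open>auto simp: modular_split_at_one 2 ennreal_plus[symmetric] simp del: ennreal_plus
        intro: order_trans[OF add_right_mono] ennreal_leI\<close>)
qed

lemma split_at_one_same [simp]: "split_at_one u u = (\<lambda>_. u)"
  by (simp add: split_at_one_def fun_eq_iff)

text \<open>For \<open>t < 1\<close> only the restriction of \<open>g\<close> to \<open>(0, 1)\<close> matters, and the power weight inequality with the
exponents at 0 applies. For \<open>t \<ge> 1\<close> the mass of \<open>g\<close> on \<open>(0, 1)\<close>, which the first case bounds, enters as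
a multiple of \<open>1/t\<close>. The rest of \<open>g\<close> is below \<open>min g (8 K)\<close>, a function bounded near 0, to which the
inequality with the exponents at infinity applies.\<close>

lemma hardy_inequality_split_exponents:
  assumes q: "1 \<le> q0" "1 \<le> q1" and b0: "b0 + 1 / q0 < 1"
    and b1: "- 1 / q1 < b1" "b1 + 1 / q1 < 1" and K: "1 \<le> K"
  shows "\<exists>K'\<ge>1. \<forall>g. g \<in> borel_measurable borel \<longrightarrow> antimono_on {0<..} g \<longrightarrow>
    modular (split_at_one q0 q1) (\<lambda>t. ennreal (t powr split_at_one b0 b1 t) * g t) \<le> ennreal K \<longrightarrow>
    modular (split_at_one q0 q1) (\<lambda>t. ennreal (t powr split_at_one b0 b1 t) * hardy g t) \<le> ennreal K'"
proof -
  have b0': "b0 \<le> 1" using b0 q by (smt (verit) divide_nonneg_nonneg)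
  obtain C0 where C0: "0 \<le> C0" and H0: "\<And>g. g \<in> borel_measurable borel \<Longrightarrow> antimono_on {0<..} g \<Longrightarrow>
    modular (\<lambda>_. q0) (\<lambda>t. ennreal (t powr b0) * hardy g t)
      \<le> ennreal C0 * modular (\<lambda>_. q0) (\<lambda>t. ennreal (t powr b0) * g t)"
    using hardy_inequality_powr_weight[of q0 b0] q b0 by auto
  obtain C1 where C1: "0 \<le> C1" and H1: "\<And>g. g \<in> borel_measurable borel \<Longrightarrow> antimono_on {0<..} g \<Longrightarrow>
    modular (\<lambda>_. q1) (\<lambda>t. ennreal (t powr b1) * hardy g t)
      \<le> ennreal C1 * modular (\<lambda>_. q1) (\<lambda>t. ennreal (t powr b1) * g t)"
    using hardy_inequality_powr_weight[of q1 b1] q b1 by auto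
  have e1: "- 1 < b1 * q1" using b1(1) q(2) by (simp add: field_simps)
  have e2: "(b1 - 1) * q1 < - 1" using b1(2) q(2) by (simp add: field_simps)
  define K0 where "K0 = max 1 (C0 * K)"
  define N where "N = (8 * K) powr q1 * (1 / (b1 * q1 + 1)) + K"
  have N: "0 \<le> N" using e1 K by (simp add: N_def)
  define D where "D = 2 powr q1 * ((8 * K0) powr q1 * (- 1 / ((b1 - 1) * q1 + 1)) + C1 * N)"
  have D1: "0 \<le> (8 * K0) powr q1 * (- 1 / ((b1 - 1) * q1 + 1))" "0 \<le> C1 * N"
    using e2 C1 N by (auto simp: divide_simps intro!: mult_nonneg_nonneg)
  have D: "0 \<le> D" using D1 by (simp add: D_def)
  show ?thesis
  proof (intro exI[of _ "K0 + D"] conjI allI impI)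
    show "1 \<le> K0 + D" using D by (simp add: K0_def)
  next
    fix g assume [measurable]: "g \<in> borel_measurable borel" and g: "antimono_on {0<..} g"
      and "modular (split_at_one q0 q1) (\<lambda>t. ennreal (t powr split_at_one b0 b1 t) * g t) \<le> ennreal K"
    then have le: "(\<integral>\<^sup>+t\<in>{0<..<1}. ennreal_powr (ennreal (t powr split_at_one b0 b1 t) * g t) q0 \<partial>lborel) +
        (\<integral>\<^sup>+t\<in>{1..}. ennreal_powr (ennreal (t powr split_at_one b0 b1 t) * g t) q1 \<partial>lborel) \<le> ennreal K"
      by (simp add: modular_split_at_one)
    have "(\<integral>\<^sup>+t\<in>{0<..<1}. ennreal_powr (ennreal (t powr b0) * g t) q0 \<partial>lborel) =
        (\<integral>\<^sup>+t\<in>{0<..<1}. ennreal_powr (ennreal (t powr split_at_one b0 b1 t) * g t) q0 \<partial>lborel)"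
      by (intro nn_integral_cong) (auto simp: split_at_one_def split: split_indicator)
    also have "\<dots> \<le> ennreal K" using le by (rule order_trans[rotated]) simp
    finally have le0: "(\<integral>\<^sup>+t\<in>{0<..<1}. ennreal_powr (ennreal (t powr b0) * g t) q0 \<partial>lborel) \<le> ennreal K" .
    have "(\<integral>\<^sup>+t\<in>{1..}. ennreal_powr (ennreal (t powr b1) * g t) q1 \<partial>lborel) =
        (\<integral>\<^sup>+t\<in>{1..}. ennreal_powr (ennreal (t powr split_at_one b0 b1 t) * g t) q1 \<partial>lborel)"
      by (intro nn_integral_cong) (auto simp: split_at_one_def split: split_indicator)
    also have "\<dots> \<le> ennreal K" using le by (rule order_trans[rotated]) simp
    finally have le1: "(\<integral>\<^sup>+t\<in>{1..}. ennreal_powr (ennreal (t powr b1) * g t) q1 \<partial>lborel) \<le> ennreal K" .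

    define g0 where "g0 t = g t * indicator {0<..<1} t" for t
    have [measurable]: "g0 \<in> borel_measurable borel" unfolding g0_def by measurable
    have g0: "antimono_on {0<..} g0"
      by (rule monotone_onI) (auto simp: g0_def split: split_indicator intro!: monotone_onD[OF g])
    have "modular (\<lambda>_. q0) (\<lambda>t. ennreal (t powr b0) * g0 t) =
        (\<integral>\<^sup>+t\<in>{0<..<1}. ennreal_powr (ennreal (t powr b0) * g t) q0 \<partial>lborel)"
      by (intro nn_integral_cong) (auto simp: g0_def split: split_indicator)
    then have "modular (\<lambda>_. q0) (\<lambda>t. ennreal (t powr b0) * g0 t) \<le> ennreal K" using le0 by simp
    then have "ennreal C0 * modular (\<lambda>_. q0) (\<lambda>t. ennreal (t powr b0) * g0 t) \<le> ennreal C0 * ennreal K"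
      by (intro mult_left_mono) auto
    also have "\<dots> \<le> ennreal K0" using C0 K by (auto simp: K0_def intro!: ennreal_leI simp flip: ennreal_mult)
    finally have h0: "modular (\<lambda>_. q0) (\<lambda>t. ennreal (t powr b0) * hardy g0 t) \<le> ennreal K0"
      by (rule order_trans[OF H0, rotated 2]) (use g0 in auto)
    have h0': "(\<integral>\<^sup>+t\<in>{0<..<1}. ennreal_powr (ennreal (t powr b0) * hardy g0 t) q0 \<partial>lborel) \<le> ennreal K0"
      using h0 by (rule order_trans[rotated]) (auto intro!: nn_integral_mono split: split_indicator)
    have "hardy g0 1 \<le> ennreal (8 * K0 / 1\<^sup>2)"
      by (rule antimono_bound_near_zero[OF antimono_on_hardy[OF _ g0] b0' _ _ _ _ h0'])
        (use q in \<open>auto simp: K0_def\<close>)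
    then have I0: "(\<integral>\<^sup>+s\<in>{0<..<1}. g s \<partial>lborel) \<le> ennreal (8 * K0)"
      by (simp add: hardy_def g0_def mult.assoc divide_ennreal_def flip: indicator_inter_arith)
    have g1: "g 1 \<le> ennreal (8 * K)"
      using antimono_bound_near_zero[OF g b0' K _ _ _ le0, of 1] q by simp

    have part0: "(\<integral>\<^sup>+t\<in>{0<..<1}. ennreal_powr (ennreal (t powr split_at_one b0 b1 t) * hardy g t) q0 \<partial>lborel) \<le> ennreal K0"
    proof -
      have "hardy g t \<le> hardy g0 t" if "t < 1" for t
        using that by (intro hardy_mono) (auto simp: g0_def)
      then have "(\<integral>\<^sup>+t\<in>{0<..<1}. ennreal_powr (ennreal (t powr split_at_one b0 b1 t) * hardy g t) q0 \<partial>lborel) \<le>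
          (\<integral>\<^sup>+t\<in>{0<..<1}. ennreal_powr (ennreal (t powr b0) * hardy g0 t) q0 \<partial>lborel)"
        using q by (intro nn_integral_mono)
          (auto simp: split_at_one_def split: split_indicator intro!: ennreal_powr_mono mult_left_mono)
      with h0' show ?thesis by simp
    qed

    define h where "h t = min (g t) (ennreal (8 * K))" for t
    have [measurable]: "h \<in> borel_measurable borel" unfolding h_def by measurable
    have h: "antimono_on {0<..} h"
      by (rule monotone_onI) (auto simp: h_def intro!: min.coboundedI1 monotone_onD[OF g])
    have "modular (\<lambda>_. q1) (\<lambda>t. ennreal (t powr b1) * h t) =
        (\<integral>\<^sup>+t\<in>{0<..<1}. ennreal_powr (ennreal (t powr b1) * h t) q1 \<partial>lborel) +
        (\<integral>\<^sup>+t\<in>{1..}. ennreal_powr (ennreal (t powr b1) * h t) q1 \<partial>lborel)"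
      using modular_split_at_one[of "\<lambda>t. ennreal (t powr b1) * h t" q1 q1] by simp
    also have "\<dots> \<le> (\<integral>\<^sup>+t. ennreal ((8 * K) powr q1) * (ennreal (t powr (b1 * q1)) * indicator {0<..<1} t) \<partial>lborel) +
        (\<integral>\<^sup>+t\<in>{1..}. ennreal_powr (ennreal (t powr b1) * g t) q1 \<partial>lborel)"
    proof (intro add_mono nn_integral_mono)
      fix t :: real
      have "ennreal_powr (ennreal (t powr b1) * h t) q1 \<le> ennreal_powr (ennreal (t powr b1) * ennreal (8 * K)) q1"
        using q by (intro ennreal_powr_mono mult_left_mono) (auto simp: h_def)
      also have "\<dots> = ennreal ((8 * K) powr q1) * ennreal (t powr (b1 * q1))"
        using q K by (simp add: ennreal_powr_mult ennreal_powr_ennreal powr_powr mult.commute)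
      finally show "ennreal_powr (ennreal (t powr b1) * h t) q1 * indicator {0<..<1} t \<le>
          ennreal ((8 * K) powr q1) * (ennreal (t powr (b1 * q1)) * indicator {0<..<1} t)"
        by (simp split: split_indicator)
      show "ennreal_powr (ennreal (t powr b1) * h t) q1 * indicator {1..} t \<le>
          ennreal_powr (ennreal (t powr b1) * g t) q1 * indicator {1..} t"
        using q by (intro mult_right_mono ennreal_powr_mono mult_left_mono) (auto simp: h_def)
    qed
    also have "\<dots> \<le> ennreal ((8 * K) powr q1) * ennreal (1 / (b1 * q1 + 1)) + ennreal K"
      using le1 nn_integral_powr_unit_interval[OF e1]
      by (subst nn_integral_cmult) (auto intro!: add_mono mult_left_mono)
    also have "\<dots> = ennreal N"
      using e1 K unfolding N_def by (subst ennreal_mult[symmetric]) (auto simp: ennreal_plus)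
    finally have "ennreal C1 * modular (\<lambda>_. q1) (\<lambda>t. ennreal (t powr b1) * h t) \<le> ennreal C1 * ennreal N"
      by (intro mult_left_mono) auto
    then have h1: "modular (\<lambda>_. q1) (\<lambda>t. ennreal (t powr b1) * hardy h t) \<le> ennreal (C1 * N)"
      using H1[OF _ h] C1 N by (auto simp: ennreal_mult intro: order_trans)

    have hardy_split: "hardy g t \<le> ennreal (8 * K0 / t) + hardy h t" if t: "1 \<le> t" for t
    proof -
      have "(\<integral>\<^sup>+s\<in>{0<..<t}. g s \<partial>lborel) \<le>
          (\<integral>\<^sup>+s. g s * indicator {0<..<1} s + h s * indicator {0<..<t} s \<partial>lborel)"
      proof (intro nn_integral_mono)
        fix s :: real
        have "g s \<le> h s" if "1 \<le> s"
          using that monotone_onD[OF g, of 1 s] g1 by (auto simp: h_def)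
        then show "g s * indicator {0<..<t} s \<le> g s * indicator {0<..<1} s + h s * indicator {0<..<t} s"
          by (auto split: split_indicator)
      qed
      also have "\<dots> = (\<integral>\<^sup>+s\<in>{0<..<1}. g s \<partial>lborel) + (\<integral>\<^sup>+s\<in>{0<..<t}. h s \<partial>lborel)"
        by (rule nn_integral_add) auto
      also have "\<dots> \<le> ennreal (8 * K0) + (\<integral>\<^sup>+s\<in>{0<..<t}. h s \<partial>lborel)"
        using I0 by (rule add_right_mono)
      finally have "hardy g t \<le> (ennreal (8 * K0) + (\<integral>\<^sup>+s\<in>{0<..<t}. h s \<partial>lborel)) / ennreal t"
        unfolding hardy_def by (rule divide_right_mono_ennreal)
      also have "\<dots> = ennreal (8 * K0 / t) + hardy h t"
        using t by (simp add: hardy_def add_divide_distrib_ennreal divide_ennreal K0_def)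
      finally show ?thesis .
    qed
    have part1: "(\<integral>\<^sup>+t\<in>{1..}. ennreal_powr (ennreal (t powr split_at_one b0 b1 t) * hardy g t) q1 \<partial>lborel) \<le> ennreal D"
    proof -
      have "(\<integral>\<^sup>+t\<in>{1..}. ennreal_powr (ennreal (t powr split_at_one b0 b1 t) * hardy g t) q1 \<partial>lborel) \<le>
          (\<integral>\<^sup>+t. ennreal (2 powr q1) * (ennreal ((8 * K0) powr q1) * (ennreal (t powr ((b1 - 1) * q1)) * indicator {1..} t) +
             ennreal_powr (ennreal (t powr b1) * hardy h t) q1 * indicator {0<..} t) \<partial>lborel)"
      proof (intro nn_integral_mono)
        fix t :: real
        show "ennreal_powr (ennreal (t powr split_at_one b0 b1 t) * hardy g t) q1 * indicator {1..} t \<le>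
          ennreal (2 powr q1) * (ennreal ((8 * K0) powr q1) * (ennreal (t powr ((b1 - 1) * q1)) * indicator {1..} t) +
             ennreal_powr (ennreal (t powr b1) * hardy h t) q1 * indicator {0<..} t)"
        proof (cases "1 \<le> t")
          case t: True
          have "ennreal (t powr b1) * hardy g t \<le> ennreal (t powr b1) * (ennreal (8 * K0 / t) + hardy h t)"
            using t by (intro mult_left_mono hardy_split) auto
          also have "\<dots> = ennreal (8 * K0 * t powr (b1 - 1)) + ennreal (t powr b1) * hardy h t"
            using t by (simp add: distrib_left powr_diff K0_def mult_ac flip: ennreal_mult)
          finally have "ennreal_powr (ennreal (t powr b1) * hardy g t) q1 \<le>
              ennreal_powr (ennreal (8 * K0 * t powr (b1 - 1)) + ennreal (t powr b1) * hardy h t) q1"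
            using q by (intro ennreal_powr_mono) auto
          also have "\<dots> \<le> ennreal_powr 2 q1 * (ennreal_powr (ennreal (8 * K0 * t powr (b1 - 1))) q1 +
              ennreal_powr (ennreal (t powr b1) * hardy h t) q1)"
            using q by (intro ennreal_powr_add_le) auto
          also have "ennreal_powr 2 q1 = ennreal (2 powr q1)"
            using ennreal_powr_ennreal[of 2 q1] by simp
          also have "ennreal_powr (ennreal (8 * K0 * t powr (b1 - 1))) q1 =
              ennreal ((8 * K0) powr q1) * ennreal (t powr ((b1 - 1) * q1))"
            using K0_def by (simp add: ennreal_powr_ennreal powr_mult powr_powr flip: ennreal_mult)
          finally show ?thesis using t by (simp add: split_at_one_def)
        qed simp
      qed
      also have "\<dots> = ennreal (2 powr q1) * (ennreal ((8 * K0) powr q1) * (\<integral>\<^sup>+t\<in>{1..}. ennreal (t powr ((b1 - 1) * q1)) \<partial>lborel) +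
             modular (\<lambda>_. q1) (\<lambda>t. ennreal (t powr b1) * hardy h t))"
        by (subst nn_integral_cmult, measurable, subst nn_integral_add, measurable, subst nn_integral_cmult) auto
      also have "\<dots> \<le> ennreal (2 powr q1) * (ennreal ((8 * K0) powr q1) * ennreal (- 1 / ((b1 - 1) * q1 + 1)) + ennreal (C1 * N))"
        using h1 by (intro mult_left_mono add_mono) (auto simp: nn_integral_powr_from_one[OF e2])
      also have "\<dots> = ennreal D"
        unfolding D_def using D1 e2
        by (subst ennreal_mult, simp, simp, subst ennreal_plus, simp, simp, subst ennreal_mult) (auto simp: divide_simps)
      finally show ?thesis .
    qed
    show "modular (split_at_one q0 q1) (\<lambda>t. ennreal (t powr split_at_one b0 b1 t) * hardy g t) \<le> ennreal (K0 + D)"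
      using part0 part1 D by (subst modular_split_at_one) (auto simp: K0_def ennreal_plus intro!: add_mono)
  qed
qed

text \<open>Variable powers of \<open>t\<close> with \<open>\<bar>w1 t - w2 t\<bar> * \<bar>ln t\<bar> \<le> A\<close> differ by a factor of at most \<open>exp A\<close>.\<close>

lemma modular_change_weight:
  assumes A: "0 \<le> A" and r [measurable]: "r \<in> borel_measurable borel" and w2 [measurable]: "w2 \<in> borel_measurable borel"
    and m [measurable]: "m \<in> borel_measurable borel"
    and ae: "AE t in lborel. 0 < t \<longrightarrow> 0 < r t \<and> r t \<le> M \<and> \<bar>w1 t - w2 t\<bar> * \<bar>ln t\<bar> \<le> A"
  shows "modular r (\<lambda>t. ennreal (t powr w1 t) * m t) \<le>
      ennreal (exp (A * M)) * modular r (\<lambda>t. ennreal (t powr w2 t) * m t)"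
proof -
  have "modular r (\<lambda>t. ennreal (t powr w1 t) * m t) \<le>
     (\<integral>\<^sup>+t. ennreal (exp (A * M)) * (ennreal_powr (ennreal (t powr w2 t) * m t) (r t) * indicator {0<..} t) \<partial>lborel)"
  proof (rule nn_integral_mono_AE, use ae in eventually_elim)
    fix t :: real
    assume *: "0 < t \<longrightarrow> 0 < r t \<and> r t \<le> M \<and> \<bar>w1 t - w2 t\<bar> * \<bar>ln t\<bar> \<le> A"
    show "ennreal_powr (ennreal (t powr w1 t) * m t) (r t) * indicator {0<..} t \<le>
      ennreal (exp (A * M)) * (ennreal_powr (ennreal (t powr w2 t) * m t) (r t) * indicator {0<..} t)"
    proof (cases "0 < t")
      case t: True
      with * have r: "0 < r t" "r t \<le> M" and w: "\<bar>w1 t - w2 t\<bar> * \<bar>ln t\<bar> \<le> A" by auto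
      have "(w1 t - w2 t) * ln t \<le> A" using w by (metis abs_ge_self abs_mult order_trans)
      then have "exp (w1 t * ln t) \<le> exp (A + w2 t * ln t)" by (simp add: algebra_simps)
      then have "t powr w1 t \<le> exp A * t powr w2 t" using t by (simp add: powr_def exp_add)
      then have "ennreal (t powr w1 t) \<le> ennreal (exp A) * ennreal (t powr w2 t)"
        by (simp add: ennreal_leI flip: ennreal_mult)
      then have "ennreal (t powr w1 t) * m t \<le> ennreal (exp A) * (ennreal (t powr w2 t) * m t)"
        by (simp add: mult.assoc[symmetric] mult_right_mono)
      then have "ennreal_powr (ennreal (t powr w1 t) * m t) (r t) \<le>
          ennreal_powr (ennreal (exp A) * (ennreal (t powr w2 t) * m t)) (r t)"
        using r by (intro ennreal_powr_mono) auto
      also have "\<dots> = ennreal (exp (A * r t)) * ennreal_powr (ennreal (t powr w2 t) * m t) (r t)"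
        using r(1) by (simp only: ennreal_powr_mult[OF r(1), of "ennreal (exp A)"])
          (simp add: ennreal_powr_ennreal powr_def mult.commute)
      also have "\<dots> \<le> ennreal (exp (A * M)) * ennreal_powr (ennreal (t powr w2 t) * m t) (r t)"
        using A r by (intro mult_right_mono ennreal_leI) (auto intro!: mult_left_mono)
      finally show ?thesis using t by simp
    qed simp
  qed
  also have "\<dots> = ennreal (exp (A * M)) * modular r (\<lambda>t. ennreal (t powr w2 t) * m t)"
    by (rule nn_integral_cmult) measurable
  finally show ?thesis .
qed

text \<open>The constants \<open>K1\<close> to \<open>K6\<close> follow a function around a loop: raise it to the barrier, pass from the
exponent \<open>q\<close> to the split exponent, average, and pass back. The average of a function above the barrier
is non-increasing and again above the barrier, so the passage back is possible.\<close>

theorem hardy_inequality_variable_exponent: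
  assumes [measurable]: "q \<in> borel_measurable borel" "w \<in> borel_measurable borel"
    and A: "0 \<le> A" and q01: "1 \<le> q0" "1 \<le> q1"
    and b0: "- 1 / q0 < b0" "b0 + 1 / q0 < 1" and b1: "- 1 / q1 < b1" "b1 + 1 / q1 < 1"
    and q: "AE t in lborel. 0 < t \<longrightarrow> 1 \<le> q t \<and> \<bar>q t - split_at_one q0 q1 t\<bar> * (1 + \<bar>ln t\<bar>) \<le> A"
    and w: "AE t in lborel. 0 < t \<longrightarrow> \<bar>w t - split_at_one b0 b1 t\<bar> * \<bar>ln t\<bar> \<le> A"
  shows "\<exists>K\<ge>1. \<forall>g. g \<in> borel_measurable borel \<longrightarrow> antimono_on {0<..} g \<longrightarrow>
    modular q (\<lambda>t. ennreal (t powr w t) * g t) \<le> 1 \<longrightarrow>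
    modular q (\<lambda>t. ennreal (t powr w t) * hardy g t) \<le> ennreal K"
proof -
  let ?Q = "split_at_one q0 q1" and ?V = "\<lambda>t. ennreal (t powr split_at_one b0 b1 t)"
  have b: "\<bar>b0\<bar> \<le> 1" "\<bar>b1\<bar> \<le> 1"
  proof -
    have "1 / q0 \<le> 1" "1 / q1 \<le> 1" "0 \<le> 1 / q0" "0 \<le> 1 / q1" using q01 by auto
    moreover have "- (1 / q0) < b0" "- (1 / q1) < b1" using b0 b1 by simp_all
    ultimately show "\<bar>b0\<bar> \<le> 1" "\<bar>b1\<bar> \<le> 1" using b0(2) b1(2) by linarith+
  qed
  have Q1: "1 \<le> ?Q t" for t using q01 by (simp add: split_at_one_def)
  define M where "M = max q0 q1 + A"
  have M: "AE t in lborel. 0 < t \<longrightarrow> 0 < q t \<and> q t \<le> M"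
  proof (use q in eventually_elim, intro impI)
    fix t :: real
    assume *: "0 < t \<longrightarrow> 1 \<le> q t \<and> \<bar>q t - ?Q t\<bar> * (1 + \<bar>ln t\<bar>) \<le> A" and t: "0 < t"
    have "\<bar>q t - ?Q t\<bar> * 1 \<le> \<bar>q t - ?Q t\<bar> * (1 + \<bar>ln t\<bar>)" by (intro mult_left_mono) auto
    also have "\<dots> \<le> A" using * t by blast
    finally have "\<bar>q t - ?Q t\<bar> \<le> A" by simp
    moreover have "?Q t \<le> max q0 q1" by (auto simp: split_at_one_def)
    ultimately show "0 < q t \<and> q t \<le> M" using * t unfolding M_def by auto
  qed
  have wV: "AE t in lborel. 0 < t \<longrightarrow> 0 < q t \<and> q t \<le> M \<and> \<bar>w t - split_at_one b0 b1 t\<bar> * \<bar>ln t\<bar> \<le> A"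
    using M w by eventually_elim auto
  have Vw: "AE t in lborel. 0 < t \<longrightarrow> 0 < q t \<and> q t \<le> M \<and> \<bar>split_at_one b0 b1 t - w t\<bar> * \<bar>ln t\<bar> \<le> A"
    using M w by eventually_elim (auto simp: abs_minus_commute)
  have qQ: "AE t in lborel. 0 < t \<longrightarrow> 1 \<le> q t \<and> 1 \<le> ?Q t \<and> \<bar>q t - ?Q t\<bar> * (1 + \<bar>ln t\<bar>) \<le> A"
    using q by eventually_elim (auto simp: Q1)
  have Qq: "AE t in lborel. 0 < t \<longrightarrow> 1 \<le> ?Q t \<and> 1 \<le> q t \<and> \<bar>?Q t - q t\<bar> * (1 + \<bar>ln t\<bar>) \<le> A"
    using q by eventually_elim (auto simp: Q1 abs_minus_commute)
  note Qq' = modular_change_exponent[OF A b _ _ Qq] and qQ' = modular_change_exponent[OF A b _ _ qQ]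
  obtain K1 where K1: "1 \<le> K1" "modular ?Q (\<lambda>t. ?V t * ennreal (tail_floor t)) \<le> ennreal K1"
    using modular_tail_floor_finite[of q0 q1 b0 b1] q01 b0 b1 by auto
  obtain K2 where K2: "1 \<le> K2" "modular q (\<lambda>t. ?V t * ennreal (tail_floor t)) \<le> ennreal K2"
    using Qq'[OF K1(1)] K1(2) antimono_on_tail_floor by fastforce
  define K3 where "K3 = exp (A * M) + K2"
  have K3: "1 \<le> K3" using K2 by (simp add: K3_def add_increasing)
  obtain K4 where K4: "1 \<le> K4" "\<And>m. m \<in> borel_measurable borel \<Longrightarrow> antimono_on {0<..} m \<Longrightarrow>
    (\<forall>t>0. ennreal (tail_floor t) \<le> m t) \<Longrightarrow> modular q (\<lambda>t. ?V t * m t) \<le> ennreal K3 \<Longrightarrow>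
    modular ?Q (\<lambda>t. ?V t * m t) \<le> ennreal K4"
    using qQ'[OF K3] by auto
  obtain K5 where K5: "1 \<le> K5" "\<And>g. g \<in> borel_measurable borel \<Longrightarrow> antimono_on {0<..} g \<Longrightarrow>
    modular ?Q (\<lambda>t. ?V t * g t) \<le> ennreal K4 \<Longrightarrow> modular ?Q (\<lambda>t. ?V t * hardy g t) \<le> ennreal K5"
    using hardy_inequality_split_exponents[OF q01 b0(2) b1 K4(1)] by auto
  obtain K6 where K6: "1 \<le> K6" "\<And>m. m \<in> borel_measurable borel \<Longrightarrow> antimono_on {0<..} m \<Longrightarrow>
    (\<forall>t>0. ennreal (tail_floor t) \<le> m t) \<Longrightarrow> modular ?Q (\<lambda>t. ?V t * m t) \<le> ennreal K5 \<Longrightarrow>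
    modular q (\<lambda>t. ?V t * m t) \<le> ennreal K6"
    using Qq'[OF K5(1)] by auto
  show ?thesis
  proof (intro exI[of _ "max 1 (exp (A * M) * K6)"] conjI allI impI)
    fix g assume [measurable]: "g \<in> borel_measurable borel" and g: "antimono_on {0<..} g"
      and le: "modular q (\<lambda>t. ennreal (t powr w t) * g t) \<le> 1"
    define m where "m t = max (g t) (ennreal (tail_floor t))" for t
    have [measurable]: "m \<in> borel_measurable borel" unfolding m_def by measurable
    have m: "antimono_on {0<..} m"
      unfolding m_def by (intro monotone_onI max.mono monotone_onD[OF g] monotone_onD[OF antimono_on_tail_floor])
    have m_floor: "\<forall>t>0. ennreal (tail_floor t) \<le> m t" by (simp add: m_def)
    have "modular q (\<lambda>t. ?V t * g t) \<le> ennreal (exp (A * M)) * modular q (\<lambda>t. ennreal (t powr w t) * g t)"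
      by (rule modular_change_weight[OF A _ _ _ Vw]) auto
    also have "\<dots> \<le> ennreal (exp (A * M)) * 1" using le by (rule mult_left_mono) simp
    finally have gV: "modular q (\<lambda>t. ?V t * g t) \<le> ennreal (exp (A * M))" by simp
    have "modular q (\<lambda>t. ?V t * m t) \<le>
      (\<integral>\<^sup>+t. ennreal_powr (?V t * g t) (q t) * indicator {0<..} t +
          ennreal_powr (?V t * ennreal (tail_floor t)) (q t) * indicator {0<..} t \<partial>lborel)"
    proof (rule nn_integral_mono_AE, use M in eventually_elim)
      fix t :: real assume "0 < t \<longrightarrow> 0 < q t \<and> q t \<le> M"
      moreover have "?V t * m t = max (?V t * g t) (?V t * ennreal (tail_floor t))"
        by (rule linorder_le_cases[of "g t" "ennreal (tail_floor t)"])
          (simp_all add: m_def max_absorb1 max_absorb2 mult_left_mono)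
      ultimately show "ennreal_powr (?V t * m t) (q t) * indicator {0<..} t \<le>
          ennreal_powr (?V t * g t) (q t) * indicator {0<..} t +
          ennreal_powr (?V t * ennreal (tail_floor t)) (q t) * indicator {0<..} t"
        using ennreal_powr_max[of "q t" "?V t * g t" "?V t * ennreal (tail_floor t)"]
        by (auto split: split_indicator)
    qed
    also have "\<dots> = modular q (\<lambda>t. ?V t * g t) + modular q (\<lambda>t. ?V t * ennreal (tail_floor t))"
      by (rule nn_integral_add) auto
    also have "\<dots> \<le> ennreal K3"
      using gV K2 by (auto simp: K3_def intro!: add_mono)
    finally have "modular ?Q (\<lambda>t. ?V t * m t) \<le> ennreal K4"
      by (intro K4 m m_floor) auto
    then have "modular ?Q (\<lambda>t. ?V t * hardy m t) \<le> ennreal K5"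
      by (intro K5 m) auto
    moreover have "\<forall>t>0. ennreal (tail_floor t) \<le> hardy m t"
      using m_floor le_hardy[OF _ m] by (auto intro: order_trans)
    ultimately have mV: "modular q (\<lambda>t. ?V t * hardy m t) \<le> ennreal K6"
      by (intro K6 antimono_on_hardy m) auto
    have gm: "modular q (\<lambda>t. ?V t * hardy g t) \<le> modular q (\<lambda>t. ?V t * hardy m t)"
    proof (rule nn_integral_mono_AE, use M in eventually_elim)
      fix t :: real assume "0 < t \<longrightarrow> 0 < q t \<and> q t \<le> M"
      moreover have "hardy g t \<le> hardy m t" by (rule hardy_mono) (simp add: m_def)
      ultimately show "ennreal_powr (?V t * hardy g t) (q t) * indicator {0<..} t \<le>
          ennreal_powr (?V t * hardy m t) (q t) * indicator {0<..} t"
        by (auto split: split_indicator intro!: ennreal_powr_mono mult_left_mono)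
    qed
    have "modular q (\<lambda>t. ennreal (t powr w t) * hardy g t) \<le> ennreal (exp (A * M)) * modular q (\<lambda>t. ?V t * hardy g t)"
      by (rule modular_change_weight[OF A _ _ _ wV]) auto
    also have "\<dots> \<le> ennreal (exp (A * M)) * ennreal K6"
      using order_trans[OF gm mV] by (rule mult_left_mono) simp
    also have "ennreal (exp (A * M)) * ennreal K6 \<le> ennreal (max 1 (exp (A * M) * K6))"
      using K6(1) by (auto intro!: ennreal_leI simp flip: ennreal_mult)
    finally show "modular q (\<lambda>t. ennreal (t powr w t) * hardy g t) \<le> ennreal (max 1 (exp (A * M) * K6))" .
  qed simp
qed

section \<open>Ball averages and radial kernels\<close>

lemma borel_measurable_antimono_on_halfline:
  fixes g :: "real \<Rightarrow> 'b::{second_countable_topology, linorder_topology}"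
  assumes "antimono_on {0<..} g"
  shows "g \<in> borel_measurable (restrict_space borel {0<..})"
proof (rule borel_measurableI_greater)
  fix y
  have "is_interval {t \<in> {0<..}. y < g t}"
    unfolding is_interval_1
  proof (intro ballI allI impI)
    fix a b t assume "a \<in> {t \<in> {0<..}. y < g t}" "b \<in> {t \<in> {0<..}. y < g t}" "a \<le> t \<and> t \<le> b"
    then show "t \<in> {t \<in> {0<..}. y < g t}"
      using assms by (auto simp: monotone_on_def intro: order.strict_trans2)
  qed
  then have "{t \<in> {0<..}. y < g t} \<in> sets borel"
    by (rule real_interval_borel_measurable)
  then show "{x \<in> space (restrict_space borel {0<..}). y < g x} \<in> sets (restrict_space borel {0<..})"
    by (auto simp: sets_restrict_space space_restrict_space image_iff intro!: bexI[of _ "{t \<in> {0<..}. y < g t}"])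
qed

lemma nn_integral_lborel_reflected_dilation:
  fixes h :: "'a::euclidean_space \<Rightarrow> ennreal"
  assumes [measurable]: "h \<in> borel_measurable borel" and "0 < e"
  shows "(\<integral>\<^sup>+y. h ((x - y) /\<^sub>R e) \<partial>lborel) = ennreal (e ^ DIM('a)) * (\<integral>\<^sup>+z. h z \<partial>lborel)"
proof -
  have "(\<integral>\<^sup>+y. h ((x - y) /\<^sub>R e) \<partial>lborel) =
        (\<integral>\<^sup>+y. h ((x - y) /\<^sub>R e) \<partial>density (distr lborel borel (\<lambda>z. x + (- e) *\<^sub>R z)) (\<lambda>_. \<bar>- e\<bar> ^ DIM('a)))"
    using \<open>0 < e\<close> by (subst lborel_affine[of "- e" x]) auto
  also have "\<dots> = (\<integral>\<^sup>+z. ennreal (e ^ DIM('a)) * h z \<partial>lborel)"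
    using \<open>0 < e\<close> by (simp add: nn_integral_density nn_integral_distr)
  also have "\<dots> = ennreal (e ^ DIM('a)) * (\<integral>\<^sup>+z. h z \<partial>lborel)"
    by (rule nn_integral_cmult) simp
  finally show ?thesis .
qed

lemma emeasure_UN_le_count_space:
  assumes [measurable]: "\<And>i. i \<in> I \<Longrightarrow> X i \<in> sets M" and I: "countable I"
  shows "emeasure M (\<Union>i\<in>I. X i) \<le> (\<integral>\<^sup>+i. emeasure M (X i) \<partial>count_space I)"
proof -
  note sets.countable_UN'[unfolded subset_eq, measurable]
  have "emeasure M (\<Union>i\<in>I. X i) = (\<integral>\<^sup>+x. indicator (\<Union>i\<in>I. X i) x \<partial>M)"
    using I by simp
  also have "\<dots> \<le> (\<integral>\<^sup>+x. \<integral>\<^sup>+i. indicator (X i) x \<partial>count_space I \<partial>M)"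
  proof (intro nn_integral_mono)
    fix x show "indicator (\<Union>(X ` I)) x \<le> ((\<integral>\<^sup>+i. indicator (X i) x \<partial>count_space I) :: ennreal)"
    proof (cases "x \<in> (\<Union>i\<in>I. X i)")
      case True
      then obtain i where "i \<in> I" "x \<in> X i" by auto
      then show ?thesis
        using nn_integral_ge_point[of i I "\<lambda>i. indicator (X i) x"] by (auto simp: indicator_def)
    qed simp
  qed
  also have "\<dots> = (\<integral>\<^sup>+i. \<integral>\<^sup>+x. indicator (X i) x \<partial>M \<partial>count_space I)"
    using I by (intro nn_integral_count_space_nn_integral) auto
  also have "\<dots> = (\<integral>\<^sup>+i. emeasure M (X i) \<partial>count_space I)"
    by (intro nn_integral_cong) simp
  finally show ?thesis .
qed

text \<open>The weak type (1,1) bound for the centred maximal function. Balls on which the average of \<open>g\<close> exceeds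
\<open>s\<close> have bounded radius since \<open>g\<close> is integrable, so the Vitali lemma selects disjoint ones whose fivefold
enlargements cover all bad centres. The conclusion names a Borel set \<open>E\<close> rather than the set of bad centres,
so that no measurability of a maximal function is needed.\<close>

lemma weak_type_ball_averages:
  fixes g :: "'a::euclidean_space \<Rightarrow> ennreal"
  assumes g[measurable]: "g \<in> borel_measurable borel"
    and G: "(\<integral>\<^sup>+y. g y \<partial>lborel) \<le> ennreal G" "0 \<le> G" and s: "0 < s"
  obtains E where "E \<in> sets borel" "emeasure lborel E \<le> ennreal (5 ^ DIM('a) * G / s)"
    "\<And>x r. x \<notin> E \<Longrightarrow> 0 < r \<Longrightarrow> (\<integral>\<^sup>+y\<in>cball x r. g y \<partial>lborel) \<le> ennreal s * emeasure lborel (cball x r)"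
proof -
  define n where "n = DIM('a)"
  define v where "v = unit_ball_vol n"
  have v: "v > 0" by (simp add: v_def)
  have n: "n > 0" by (simp add: n_def)
  have ecb: "emeasure lborel (cball x r :: 'a set) = ennreal (v * r ^ n)" if "0 < r" for x r
    using that by (simp add: emeasure_cball v_def n_def)
  define S where "S = {x. \<exists>r>0. ennreal s * emeasure lborel (cball x r) < (\<integral>\<^sup>+y\<in>cball x r. g y \<partial>lborel)}"
  then have "\<forall>x\<in>S. \<exists>r>0. ennreal s * emeasure lborel (cball x r) < (\<integral>\<^sup>+y\<in>cball x r. g y \<partial>lborel)"
    by blast
  from bchoice[OF this] obtain \<rho> where \<rho>: "\<And>x. x \<in> S \<Longrightarrow> 0 < \<rho> x"
    "\<And>x. x \<in> S \<Longrightarrow> ennreal s * emeasure lborel (cball x (\<rho> x)) < (\<integral>\<^sup>+y\<in>cball x (\<rho> x). g y \<partial>lborel)"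
    by blast
  \<comment> \<open>A radius above 1 is at most its \<open>n\<close>-th power, which the mass of \<open>g\<close> bounds.\<close>
  define B where "B = max 1 (G / (s * v))"
  have \<rho>B: "\<rho> x \<le> B" if x: "x \<in> S" for x
  proof (cases "\<rho> x \<le> 1")
    case False
    have "ennreal (s * (v * \<rho> x ^ n)) = ennreal s * emeasure lborel (cball x (\<rho> x))"
      using \<rho>(1)[OF x] s v by (simp add: ecb ennreal_mult)
    also have "\<dots> \<le> (\<integral>\<^sup>+y\<in>cball x (\<rho> x). g y \<partial>lborel)"
      using \<rho>(2)[OF x] by simp
    also have "\<dots> \<le> (\<integral>\<^sup>+y. g y \<partial>lborel)"
      by (intro nn_integral_mono) (auto split: split_indicator)
    also note G(1)
    finally have "s * (v * \<rho> x ^ n) \<le> G"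
      using G(2) by (simp add: ennreal_le_iff)
    then have "\<rho> x ^ n \<le> G / (s * v)"
      using s v by (simp add: field_simps)
    moreover have "\<rho> x \<le> \<rho> x ^ n"
      using False n by (intro self_le_power) auto
    ultimately show ?thesis by (simp add: B_def)
  qed (auto simp: B_def)
  have "S \<subseteq> (\<Union>x\<in>S. cball x (\<rho> x))"
    using \<rho>(1) by (fastforce simp: less_imp_le)
  then obtain C where C: "countable C" "C \<subseteq> S"
     "pairwise (\<lambda>i j. disjnt (cball i (\<rho> i)) (cball j (\<rho> j))) C"
     "S \<subseteq> (\<Union>i\<in>C. cball i (5 * \<rho> i))"
    by (rule Vitali_covering_lemma_cballs[where B = B]) (use \<rho>(1) \<rho>B in auto)
  define E where "E = (\<Union>i\<in>C. cball i (5 * \<rho> i))"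
  show thesis
  proof (rule that[of E])
    show "E \<in> sets borel"
      unfolding E_def using C(1) by (intro sets.countable_UN') auto
    have "emeasure lborel E \<le> (\<integral>\<^sup>+i. emeasure lborel (cball i (5 * \<rho> i)) \<partial>count_space C)"
      unfolding E_def by (rule emeasure_UN_le_count_space) (use C in auto)
    also have "\<dots> \<le> (\<integral>\<^sup>+i. ennreal (5 ^ n / s) * emeasure (density lborel g) (cball i (\<rho> i)) \<partial>count_space C)"
    proof (intro nn_integral_mono)
      fix i assume "i \<in> space (count_space C)"
      then have i: "i \<in> S" using C(2) by auto
      have "emeasure lborel (cball i (5 * \<rho> i)) = ennreal (5 ^ n / s) * (ennreal s * emeasure lborel (cball i (\<rho> i)))"
        using \<rho>(1)[OF i] s v by (simp add: ecb power_mult_distrib flip: ennreal_mult)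
      also have "\<dots> \<le> ennreal (5 ^ n / s) * (\<integral>\<^sup>+y\<in>cball i (\<rho> i). g y \<partial>lborel)"
        using \<rho>(2)[OF i] by (intro mult_left_mono) auto
      finally show "emeasure lborel (cball i (5 * \<rho> i)) \<le>
          ennreal (5 ^ n / s) * emeasure (density lborel g) (cball i (\<rho> i))"
        by (simp add: emeasure_density)
    qed
    also have "\<dots> = ennreal (5 ^ n / s) * (\<integral>\<^sup>+i. emeasure (density lborel g) (cball i (\<rho> i)) \<partial>count_space C)"
      by (rule nn_integral_cmult) simp
    also have "(\<integral>\<^sup>+i. emeasure (density lborel g) (cball i (\<rho> i)) \<partial>count_space C) =
        emeasure (density lborel g) (\<Union>i\<in>C. cball i (\<rho> i))"
      using C by (intro emeasure_UN_countable[symmetric])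
        (auto simp: disjoint_family_on_def pairwise_def disjnt_def)
    also have "\<dots> \<le> emeasure (density lborel g) UNIV"
      by (rule emeasure_mono) auto
    also have "\<dots> = (\<integral>\<^sup>+y. g y \<partial>lborel)"
      by (simp add: emeasure_density)
    also note G(1)
    finally show "emeasure lborel E \<le> ennreal (5 ^ DIM('a) * G / s)"
      using s G by (simp add: mult_left_mono n_def flip: ennreal_mult)
    show "(\<integral>\<^sup>+y\<in>cball x r. g y \<partial>lborel) \<le> ennreal s * emeasure lborel (cball x r)"
      if "x \<notin> E" "0 < r" for x r
    proof -
      have "x \<notin> S" using C(4) that(1) by (auto simp: E_def)
      then have "\<not> ennreal s * emeasure lborel (cball x r) < (\<integral>\<^sup>+y\<in>cball x r. g y \<partial>lborel)"
        using that(2) unfolding S_def by blast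
      then show ?thesis by (simp only: not_less)
    qed
  qed
qed

text \<open>Layer cake: \<open>\<psi> (norm (x - y))\<close> is the integral over \<open>u > 0\<close> of the indicators of its superlevel sets.
Up to null sets these are balls centred at \<open>x\<close>, or the whole space, and on each of them the claim is the hypothesis.\<close>

lemma radial_kernel_le_ball_averages:
  fixes g :: "'a::euclidean_space \<Rightarrow> ennreal"
  assumes \<psi>: "antimono_on {0<..} \<psi>" and g[measurable]: "g \<in> borel_measurable borel" and s: "0 < s"
    and avg: "\<And>r. 0 < r \<Longrightarrow> (\<integral>\<^sup>+y\<in>cball x r. g y \<partial>lborel) \<le> ennreal s * emeasure lborel (cball x r)"
  shows "(\<integral>\<^sup>+y. ennreal (\<psi> (norm (x - y))) * g y \<partial>lborel)
         \<le> ennreal s * (\<integral>\<^sup>+y. ennreal (\<psi> (norm (x - y))) \<partial>lborel)"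
proof -
  have *: "(\<lambda>t. if t \<in> {0<..} then \<psi> t else 0) \<in> borel_measurable borel"
    using borel_measurable_antimono_on_halfline[OF \<psi>]
    by (subst measurable_If_restrict_space_iff) (auto simp: greaterThan_def)
  define \<phi> where "\<phi> t = (if t \<in> {0<..} then \<psi> t else 0)" for t
  have [measurable]: "\<phi> \<in> borel_measurable borel"
    using * by (simp add: \<phi>_def[abs_def])
  have "AE y in lborel. y \<noteq> x" by (rule AE_lborel_singleton)
  then have AE\<phi>: "AE y in lborel. \<psi> (norm (x - y)) = \<phi> (norm (x - y))"
    by eventually_elim (auto simp: \<phi>_def)
  have layer: "(\<integral>\<^sup>+y. ennreal (\<psi> (norm (x - y))) * h y \<partial>lborel) =
     (\<integral>\<^sup>+u. (\<integral>\<^sup>+y. h y * indicator {y. 0 < u \<and> u < \<phi> (norm (x - y))} y \<partial>lborel) \<partial>lborel)"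
    if [measurable]: "h \<in> borel_measurable borel" for h
  proof -
    have "(\<integral>\<^sup>+y. ennreal (\<psi> (norm (x - y))) * h y \<partial>lborel) =
          (\<integral>\<^sup>+y. h y * emeasure lborel {0<..<\<phi> (norm (x - y))} \<partial>lborel)"
      using AE\<phi>
    proof (intro nn_integral_cong_AE, eventually_elim)
      fix y assume "\<psi> (norm (x - y)) = \<phi> (norm (x - y))"
      then show "ennreal (\<psi> (norm (x - y))) * h y = h y * emeasure lborel {0<..<\<phi> (norm (x - y))}"
        by (cases "0 \<le> \<phi> (norm (x - y))") (simp_all add: mult.commute ennreal_neg)
    qed
    also have "\<dots> = (\<integral>\<^sup>+y. (\<integral>\<^sup>+u. h y * indicator {y. 0 < u \<and> u < \<phi> (norm (x - y))} y \<partial>lborel) \<partial>lborel)"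
    proof (intro nn_integral_cong)
      fix y
      have "(\<integral>\<^sup>+u. h y * indicator {y. 0 < u \<and> u < \<phi> (norm (x - y))} y \<partial>lborel) =
            (\<integral>\<^sup>+u. h y * indicator {0<..<\<phi> (norm (x - y))} u \<partial>lborel)"
        by (intro nn_integral_cong) (auto split: split_indicator)
      then show "h y * emeasure lborel {0<..<\<phi> (norm (x - y))} =
          (\<integral>\<^sup>+u. h y * indicator {y. 0 < u \<and> u < \<phi> (norm (x - y))} y \<partial>lborel)"
        by (simp add: nn_integral_cmult)
    qed
    also have "\<dots> = (\<integral>\<^sup>+u. (\<integral>\<^sup>+y. h y * indicator {y. 0 < u \<and> u < \<phi> (norm (x - y))} y \<partial>lborel) \<partial>lborel)"
      by (rule lborel_pair.Fubini') (simp add: indicator_def of_bool_def)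
    finally show ?thesis .
  qed
  have "(\<integral>\<^sup>+y. g y * indicator {y. 0 < u \<and> u < \<phi> (norm (x - y))} y \<partial>lborel)
      \<le> ennreal s * (\<integral>\<^sup>+y. 1 * indicator {y. 0 < u \<and> u < \<phi> (norm (x - y))} y \<partial>lborel)" for u
  proof (cases "0 < u")
    case u: True
    define I where "I = {t. u < \<phi> t}"
    have I_pos: "I \<subseteq> {0<..}" using u by (auto simp: I_def \<phi>_def split: if_splits)
    have I_down: "t \<in> I" if "0 < t" "t \<le> t'" "t' \<in> I" for t t'
      using that \<psi> u by (auto simp: I_def \<phi>_def monotone_on_def split: if_splits intro: order.strict_trans2)
    have Bm[measurable]: "{y. norm (x - y) \<in> I} \<in> sets borel"
      unfolding I_def by measurable
    have Bu: "{y. 0 < u \<and> u < \<phi> (norm (x - y))} = {y. norm (x - y) \<in> I}"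
      using u by (auto simp: I_def)
    have "(\<integral>\<^sup>+y\<in>{y. norm (x - y) \<in> I}. g y \<partial>lborel) \<le> ennreal s * emeasure lborel {y. norm (x - y) \<in> I}"
    proof (cases "I = {}")
      case False
      show ?thesis
      proof (cases "bdd_above I")
        case bdd: True
        define R where "R = Sup I"
        have R: "t \<le> R" if "t \<in> I" for t unfolding R_def using that bdd by (rule cSup_upper)
        have "R > 0" using False R I_pos by fastforce
        have sub: "{y. norm (x - y) \<in> I} \<subseteq> cball x R"
          using R by (auto simp: dist_norm)
        have sup: "ball x R - {x} \<subseteq> {y. norm (x - y) \<in> I}"
        proof
          fix y assume y: "y \<in> ball x R - {x}"
          then have "norm (x - y) < Sup I" by (auto simp: dist_norm R_def)
          then obtain t where "t \<in> I" "norm (x - y) < t"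
            using False bdd by (auto simp: less_cSup_iff)
          then show "y \<in> {y. norm (x - y) \<in> I}" using y by (auto intro!: I_down[of _ t])
        qed
        have "(\<integral>\<^sup>+y\<in>{y. norm (x - y) \<in> I}. g y \<partial>lborel) \<le> (\<integral>\<^sup>+y\<in>cball x R. g y \<partial>lborel)"
          using sub by (intro nn_integral_mono) (auto split: split_indicator)
        also have "\<dots> \<le> ennreal s * emeasure lborel (cball x R)"
          using \<open>R > 0\<close> by (rule avg)
        also have "emeasure lborel (cball x R) = emeasure lborel (ball x R)"
          using \<open>R > 0\<close> by (simp add: emeasure_cball emeasure_ball)
        also have "\<dots> = emeasure lborel (ball x R - {x})"
          by (subst emeasure_Diff_null_set) auto
        also have "ennreal s * \<dots> \<le> ennreal s * emeasure lborel {y. norm (x - y) \<in> I}"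
          using sup by (intro mult_left_mono emeasure_mono) auto
        finally show ?thesis .
      next
        case False
        have sup: "UNIV - {x} \<subseteq> {y. norm (x - y) \<in> I}"
        proof
          fix y assume y: "y \<in> UNIV - {x}"
          obtain t where "t \<in> I" "norm (x - y) < t"
            using False by (auto simp: bdd_above_def not_le)
          then show "y \<in> {y. norm (x - y) \<in> I}" using y by (auto intro!: I_down[of _ t])
        qed
        have "\<infinity> = emeasure lborel (UNIV - {x})"
          by (subst emeasure_Diff_null_set) auto
        also have "\<dots> \<le> emeasure lborel {y. norm (x - y) \<in> I}"
          using sup by (intro emeasure_mono) auto
        finally have "ennreal s * emeasure lborel {y. norm (x - y) \<in> I} = \<infinity>"
          using s by (simp add: top_unique ennreal_mult_top)
        then show ?thesis by simp
      qed
    qed simp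
    then show ?thesis by (simp add: Bu)
  qed simp
  then have "(\<integral>\<^sup>+y. ennreal (\<psi> (norm (x - y))) * g y \<partial>lborel) \<le>
      (\<integral>\<^sup>+u. ennreal s * (\<integral>\<^sup>+y. 1 * indicator {y. 0 < u \<and> u < \<phi> (norm (x - y))} y \<partial>lborel) \<partial>lborel)"
    by (subst layer) (auto intro: nn_integral_mono)
  also have "\<dots> = ennreal s * (\<integral>\<^sup>+y. ennreal (\<psi> (norm (x - y))) * 1 \<partial>lborel)"
    by (subst layer) (auto intro!: nn_integral_cmult simp: indicator_def of_bool_def)
  finally show ?thesis by simp
qed

section \<open>The rearrangement of the maximal function\<close>

lemma antimono_rearrangement: "antimono (rearrangement f)"
  unfolding rearrangement_def
  by (intro antimonoI INF_superset_mono) (auto intro: order_trans ennreal_leI)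

lemma measurable_rearrangement [measurable]: "rearrangement f \<in> borel_measurable borel"
proof (rule borel_measurableI_greater)
  fix y
  have "is_interval {t. y < rearrangement f t}"
    unfolding is_interval_1 using antimonoD[OF antimono_rearrangement[of f]]
    by (auto intro: order.strict_trans2)
  then show "{t \<in> space borel. y < rearrangement f t} \<in> sets borel"
    by (simp add: real_interval_borel_measurable)
qed

lemma rearrangement_borel:
  fixes f :: "'a::euclidean_space \<Rightarrow> real"
  assumes [measurable]: "f \<in> borel_measurable borel"
  shows "rearrangement (\<lambda>x. ereal (f x)) t =
    (INF \<mu>\<in>{\<mu>::real. 0 < \<mu> \<and> emeasure lborel {y. \<mu> < \<bar>f y\<bar>} \<le> ennreal t}. ennreal \<mu>)"
  unfolding rearrangement_def by simp

text \<open>Let $d(u)=|\{|f|>u\}|$. The left-hand side is $\int_\mu^\infty d(u)\,du$. For $u>\mu$ one has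
$d(u)\le t$, and $f^*\ge u$ on $(0,d(u))$; integrating the indicator of $\{(s,u):s<t,\ \mu<u\le f^*(s)\}$
first in $s$ and then in $u$, and in the opposite order, gives the inequality.\<close>

lemma excess_integral_le_rearrangement:
  fixes f :: "'a::euclidean_space \<Rightarrow> real"
  assumes [measurable]: "f \<in> borel_measurable borel" and \<mu>: "0 < \<mu>"
    and le: "emeasure lborel {y. \<mu> < \<bar>f y\<bar>} \<le> ennreal t"
  shows "(\<integral>\<^sup>+y. ennreal (\<bar>f y\<bar> - \<mu>) \<partial>lborel) \<le> (\<integral>\<^sup>+s\<in>{0<..<t}. rearrangement (\<lambda>x. ereal (f x)) s \<partial>lborel)"
proof -
  define d where "d u = emeasure lborel {y. u < \<bar>f y\<bar>}" for u
  define fs where "fs = rearrangement (\<lambda>x. ereal (f x))"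
  have [measurable]: "fs \<in> borel_measurable borel" by (simp add: fs_def)
  have d_anti: "d v \<le> d u" if "u \<le> v" for u v
    unfolding d_def using that by (intro emeasure_mono) auto
  have "(\<integral>\<^sup>+y. ennreal (\<bar>f y\<bar> - \<mu>) \<partial>lborel) = (\<integral>\<^sup>+y. \<integral>\<^sup>+u. (if \<mu> < u \<and> u < \<bar>f y\<bar> then 1 else 0) \<partial>lborel \<partial>lborel)"
  proof (intro nn_integral_cong)
    fix y
    have "(\<integral>\<^sup>+u. (if \<mu> < u \<and> u < \<bar>f y\<bar> then 1 else 0) \<partial>lborel) = (\<integral>\<^sup>+u. indicator {\<mu><..<\<bar>f y\<bar>} u \<partial>lborel)"
      by (intro nn_integral_cong) (auto split: split_indicator)
    also have "\<dots> = ennreal (\<bar>f y\<bar> - \<mu>)"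
      by (cases "\<mu> \<le> \<bar>f y\<bar>") (auto simp: ennreal_neg)
    finally show "ennreal (\<bar>f y\<bar> - \<mu>) = (\<integral>\<^sup>+u. (if \<mu> < u \<and> u < \<bar>f y\<bar> then 1 else 0) \<partial>lborel)" by simp
  qed
  also have "\<dots> = (\<integral>\<^sup>+u. \<integral>\<^sup>+y. (if \<mu> < u \<and> u < \<bar>f y\<bar> then 1 else 0) \<partial>lborel \<partial>lborel)"
    by (rule lborel_pair.Fubini') measurable
  also have "\<dots> \<le> (\<integral>\<^sup>+u. \<integral>\<^sup>+s. (if \<mu> < u \<and> 0 < s \<and> s < t \<and> ennreal u \<le> fs s then 1 else 0) \<partial>lborel \<partial>lborel)"
  proof (intro nn_integral_mono)
    fix u :: real
    show "(\<integral>\<^sup>+y. (if \<mu> < u \<and> u < \<bar>f y\<bar> then 1 else 0) \<partial>lborel) \<le>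
        (\<integral>\<^sup>+s. (if \<mu> < u \<and> 0 < s \<and> s < t \<and> ennreal u \<le> fs s then 1 else 0) \<partial>lborel)"
    proof (cases "\<mu> < u")
      case u: True
      have "(\<integral>\<^sup>+y. (if \<mu> < u \<and> u < \<bar>f y\<bar> then 1 else 0) \<partial>lborel) = (\<integral>\<^sup>+y. indicator {y. u < \<bar>f y\<bar>} y \<partial>lborel)"
        using u by (intro nn_integral_cong) (auto split: split_indicator)
      also have "\<dots> = d u" by (simp add: d_def)
      finally have lhs: "(\<integral>\<^sup>+y. (if \<mu> < u \<and> u < \<bar>f y\<bar> then 1 else 0) \<partial>lborel) = d u" .
      have "d u \<le> ennreal t" using d_anti[of \<mu> u] u le by (auto simp: d_def)
      then obtain c where c: "0 \<le> c" "d u = ennreal c"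
        by (cases "d u") (auto simp: top_unique)
      have sub: "s < t \<and> ennreal u \<le> fs s" if s: "0 < s" "s < c" for s
      proof
        show "s < t" using s \<open>d u \<le> ennreal t\<close> c by (auto simp: ennreal_le_iff2)
        show "ennreal u \<le> fs s"
          unfolding fs_def rearrangement_borel[OF assms(1)]
        proof (rule INF_greatest)
          fix \<nu> assume "\<nu> \<in> {\<mu>. 0 < \<mu> \<and> emeasure lborel {y. \<mu> < \<bar>f y\<bar>} \<le> ennreal s}"
          then have \<nu>: "0 < \<nu>" "d \<nu> \<le> ennreal s" by (auto simp: d_def)
          have "u \<le> \<nu>"
          proof (rule ccontr)
            assume "\<not> u \<le> \<nu>"
            then have "ennreal c \<le> ennreal s" using d_anti[of \<nu> u] \<nu> c by simp
            then show False using s c by (simp add: ennreal_le_iff)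
          qed
          then show "ennreal u \<le> ennreal \<nu>" by (rule ennreal_leI)
        qed
      qed
      have "d u = (\<integral>\<^sup>+s. indicator {0<..<c} s \<partial>lborel)" using c by simp
      also have "\<dots> \<le> (\<integral>\<^sup>+s. (if \<mu> < u \<and> 0 < s \<and> s < t \<and> ennreal u \<le> fs s then 1 else 0) \<partial>lborel)"
        using sub u by (intro nn_integral_mono) (auto split: split_indicator)
      finally show ?thesis by (simp add: lhs)
    qed simp
  qed
  also have "\<dots> = (\<integral>\<^sup>+s. \<integral>\<^sup>+u. (if \<mu> < u \<and> 0 < s \<and> s < t \<and> ennreal u \<le> fs s then 1 else 0) \<partial>lborel \<partial>lborel)"
    by (rule lborel_pair.Fubini') measurable
  also have "\<dots> \<le> (\<integral>\<^sup>+s\<in>{0<..<t}. fs s \<partial>lborel)"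
  proof (intro nn_integral_mono)
    fix s :: real
    show "(\<integral>\<^sup>+u. (if \<mu> < u \<and> 0 < s \<and> s < t \<and> ennreal u \<le> fs s then 1 else 0) \<partial>lborel) \<le> fs s * indicator {0<..<t} s"
    proof (cases "s \<in> {0<..<t}")
      case s: True
      show ?thesis
      proof (cases "fs s")
        case (real c)
        have "(\<integral>\<^sup>+u. (if \<mu> < u \<and> 0 < s \<and> s < t \<and> ennreal u \<le> fs s then 1 else 0) \<partial>lborel) \<le> (\<integral>\<^sup>+u. indicator {0..c} u \<partial>lborel)"
          using real \<mu> by (intro nn_integral_mono) (auto split: split_indicator simp: ennreal_le_iff)
        then show ?thesis using real s by simp
      next
        case top
        then show ?thesis using s by simp
      qed
    qed (auto intro: nn_integral_mono)
  qed
  finally show ?thesis by (simp add: fs_def)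
qed

lemma AE_lborel_reflected_dilation:
  fixes x :: "'a::euclidean_space"
  assumes "AE z in lborel. Q z" and "0 < e"
  shows "AE y in lborel. Q ((x - y) /\<^sub>R e)"
proof -
  obtain N where N: "{z. \<not> Q z} \<subseteq> N" "N \<in> sets borel" "emeasure lborel N = 0"
    by (rule AE_E[OF assms(1)]) auto
  have [measurable]: "N \<in> sets borel" by (rule N)
  have "(\<integral>\<^sup>+y. indicator N ((x - y) /\<^sub>R e) \<partial>lborel) = 0"
    using nn_integral_lborel_reflected_dilation[of "indicator N" e x] N assms(2) by simp
  then have "AE y in lborel. indicator N ((x - y) /\<^sub>R e) = (0 :: ennreal)"
    by (subst (asm) nn_integral_0_iff_AE) auto
  then show ?thesis
    by eventually_elim (use N in \<open>auto simp: indicator_def split: if_splits\<close>)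
qed

text \<open>The dilated kernel has the majorant \<open>\<lambda>t. \<psi> (t / e)\<close>, which is again non-increasing and whose integral
is \<open>e ^ DIM('a)\<close> times that of \<open>\<psi>\<close>.\<close>

lemma dominated_kernel_le_ball_averages:
  fixes a :: "'a::euclidean_space \<Rightarrow> real"
  assumes \<psi>: "antimono_on {0<..} \<psi>" and [measurable]: "\<psi> \<in> borel_measurable borel"
    and a: "AE z in lborel. \<bar>a z\<bar> \<le> \<psi> (norm z)"
    and [measurable]: "g \<in> borel_measurable borel" and s: "0 < s"
    and avg: "\<And>r. 0 < r \<Longrightarrow> (\<integral>\<^sup>+y\<in>cball x r. g y \<partial>lborel) \<le> ennreal s * emeasure lborel (cball x r)"
    and e: "0 < e"
  shows "(\<integral>\<^sup>+y. ennreal \<bar>a ((x - y) /\<^sub>R e)\<bar> * g y \<partial>lborel)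
    \<le> ennreal (e ^ DIM('a) * s) * (\<integral>\<^sup>+z. ennreal (\<psi> (norm (z :: 'a))) \<partial>lborel)"
proof -
  have norm_eq: "norm ((x - y) /\<^sub>R e) = norm (x - y) / e" for y
    using e by (simp add: divide_inverse mult.commute)
  have \<psi>e: "antimono_on {0<..} (\<lambda>t. \<psi> (t / e))"
    using e by (intro monotone_onI monotone_onD[OF \<psi>]) (auto intro: divide_right_mono)
  have "(\<integral>\<^sup>+y. ennreal \<bar>a ((x - y) /\<^sub>R e)\<bar> * g y \<partial>lborel) \<le> (\<integral>\<^sup>+y. ennreal (\<psi> (norm (x - y) / e)) * g y \<partial>lborel)"
    by (rule nn_integral_mono_AE, use AE_lborel_reflected_dilation[OF a e, of x] in eventually_elim)
      (auto simp: norm_eq simp del: norm_scaleR intro!: mult_right_mono ennreal_leI)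
  also have "\<dots> \<le> ennreal s * (\<integral>\<^sup>+y. ennreal (\<psi> (norm (x - y) / e)) \<partial>lborel)"
    by (rule radial_kernel_le_ball_averages[OF \<psi>e _ s avg]) auto
  also have "(\<integral>\<^sup>+y. ennreal (\<psi> (norm (x - y) / e)) \<partial>lborel) = ennreal (e ^ DIM('a)) * (\<integral>\<^sup>+z. ennreal (\<psi> (norm (z :: 'a))) \<partial>lborel)"
    using nn_integral_lborel_reflected_dilation[of "\<lambda>z. ennreal (\<psi> (norm z))" e x] e by (simp add: norm_eq del: norm_scaleR)
  finally show ?thesis
    using e s by (simp add: ennreal_mult mult_ac)
qed

text \<open>Outside the exceptional set of the excess \<open>\<bar>f\<bar> - \<mu>\<close> the two parts of \<open>\<bar>f\<bar>\<close> contribute \<open>P * \<mu>\<close> and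
\<open>P * s\<close> after division by \<open>e ^ DIM('a)\<close>, for all \<open>e\<close> at once.\<close>

lemma dominated_kernel_estimate:
  fixes a f :: "'a::euclidean_space \<Rightarrow> real"
  assumes \<psi>: "antimono_on {0<..} \<psi>" and [measurable]: "\<psi> \<in> borel_measurable borel"
    and P: "(\<integral>\<^sup>+z. ennreal (\<psi> (norm (z :: 'a))) \<partial>lborel) = ennreal P" "0 \<le> P"
    and [measurable]: "a \<in> borel_measurable borel"
    and a: "AE z in lborel. \<bar>a z\<bar> \<le> \<psi> (norm z)"
    and f[measurable]: "f \<in> borel_measurable borel" and \<mu>: "0 < \<mu>" and s: "0 < s"
    and le: "emeasure lborel {y. \<mu> < \<bar>f y\<bar>} \<le> ennreal t"
    and J: "(\<integral>\<^sup>+s\<in>{0<..<t}. rearrangement (\<lambda>x. ereal (f x)) s \<partial>lborel) \<le> ennreal J" "0 \<le> J"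
  obtains E where "E \<in> sets borel" "emeasure lborel E \<le> ennreal (5 ^ DIM('a) * J / s)"
    "\<And>x e. x \<notin> E \<Longrightarrow> 0 < e \<Longrightarrow>
      (\<integral>\<^sup>+y. ennreal \<bar>a ((x - y) /\<^sub>R e) * f y\<bar> \<partial>lborel) \<le> ennreal (e ^ DIM('a) * (P * (\<mu> + s)))"
proof -
  have "(\<integral>\<^sup>+y. ennreal (\<bar>f y\<bar> - \<mu>) \<partial>lborel) \<le> ennreal J"
    using excess_integral_le_rearrangement[OF f \<mu> le] J(1) by (rule order_trans)
  then obtain E where E: "E \<in> sets borel" "emeasure lborel E \<le> ennreal (5 ^ DIM('a) * J / s)"
    "\<And>x r. x \<notin> E \<Longrightarrow> 0 < r \<Longrightarrow>
       (\<integral>\<^sup>+y\<in>cball x r. ennreal (\<bar>f y\<bar> - \<mu>) \<partial>lborel) \<le> ennreal s * emeasure lborel (cball x r)"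
    using weak_type_ball_averages[of "\<lambda>y. ennreal (\<bar>f y\<bar> - \<mu>)" J s] J(2) s by auto
  show thesis
  proof (rule that[OF E(1,2)])
    fix x :: 'a and e :: real assume x: "x \<notin> E" and e: "0 < e"
    have "(\<integral>\<^sup>+y. ennreal \<bar>a ((x - y) /\<^sub>R e) * f y\<bar> \<partial>lborel) \<le>
        (\<integral>\<^sup>+y. ennreal \<mu> * ennreal \<bar>a ((x - y) /\<^sub>R e)\<bar> +
           ennreal \<bar>a ((x - y) /\<^sub>R e)\<bar> * ennreal (\<bar>f y\<bar> - \<mu>) \<partial>lborel)"
    proof (intro nn_integral_mono)
      fix y
      have "ennreal \<bar>f y\<bar> \<le> ennreal \<mu> + ennreal (\<bar>f y\<bar> - \<mu>)"
      proof (cases "\<mu> \<le> \<bar>f y\<bar>")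
        case True
        then show ?thesis using \<mu> by (subst ennreal_plus[symmetric]) auto
      next
        case False
        then show ?thesis by (simp add: add_increasing2 ennreal_leI)
      qed
      then have "ennreal \<bar>a ((x - y) /\<^sub>R e)\<bar> * ennreal \<bar>f y\<bar> \<le>
          ennreal \<bar>a ((x - y) /\<^sub>R e)\<bar> * (ennreal \<mu> + ennreal (\<bar>f y\<bar> - \<mu>))"
        by (rule mult_left_mono) simp
      then show "ennreal \<bar>a ((x - y) /\<^sub>R e) * f y\<bar> \<le> ennreal \<mu> * ennreal \<bar>a ((x - y) /\<^sub>R e)\<bar> +
           ennreal \<bar>a ((x - y) /\<^sub>R e)\<bar> * ennreal (\<bar>f y\<bar> - \<mu>)"
        by (simp add: abs_mult ennreal_mult distrib_left mult.commute)
    qed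
    also have "\<dots> = ennreal \<mu> * (\<integral>\<^sup>+y. ennreal \<bar>a ((x - y) /\<^sub>R e)\<bar> \<partial>lborel) +
        (\<integral>\<^sup>+y. ennreal \<bar>a ((x - y) /\<^sub>R e)\<bar> * ennreal (\<bar>f y\<bar> - \<mu>) \<partial>lborel)"
      by (subst nn_integral_add) (auto simp: nn_integral_cmult)
    also have "(\<integral>\<^sup>+y. ennreal \<bar>a ((x - y) /\<^sub>R e)\<bar> \<partial>lborel) = ennreal (e ^ DIM('a)) * (\<integral>\<^sup>+z. ennreal \<bar>a z\<bar> \<partial>lborel)"
      using e by (intro nn_integral_lborel_reflected_dilation[of "\<lambda>z. ennreal \<bar>a z\<bar>"]) auto
    also have "ennreal \<mu> * (ennreal (e ^ DIM('a)) * (\<integral>\<^sup>+z. ennreal \<bar>a z\<bar> \<partial>lborel)) +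
        (\<integral>\<^sup>+y. ennreal \<bar>a ((x - y) /\<^sub>R e)\<bar> * ennreal (\<bar>f y\<bar> - \<mu>) \<partial>lborel) \<le>
        ennreal \<mu> * (ennreal (e ^ DIM('a)) * ennreal P) + ennreal (e ^ DIM('a) * s) * ennreal P"
    proof (intro add_mono mult_left_mono)
      show "(\<integral>\<^sup>+z. ennreal \<bar>a z\<bar> \<partial>lborel) \<le> ennreal P"
        unfolding P(1)[symmetric] by (rule nn_integral_mono_AE, use a in eventually_elim) (auto intro: ennreal_leI)
      show "(\<integral>\<^sup>+y. ennreal \<bar>a ((x - y) /\<^sub>R e)\<bar> * ennreal (\<bar>f y\<bar> - \<mu>) \<partial>lborel) \<le> ennreal (e ^ DIM('a) * s) * ennreal P"
        using dominated_kernel_le_ball_averages[OF \<psi> _ a _ s E(3)[OF x] e] by (simp add: P(1))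
    qed auto
    also have "ennreal \<mu> * (ennreal (e ^ DIM('a)) * ennreal P) + ennreal (e ^ DIM('a) * s) * ennreal P =
        ennreal (e ^ DIM('a) * (P * (\<mu> + s)))"
      using e \<mu> s P(2) by (simp add: algebra_simps flip: ennreal_mult ennreal_plus)
    finally show "(\<integral>\<^sup>+y. ennreal \<bar>a ((x - y) /\<^sub>R e) * f y\<bar> \<partial>lborel) \<le> ennreal (e ^ DIM('a) * (P * (\<mu> + s)))" .
  qed
qed

lemma abs_approx_avg_le:
  fixes a f :: "'a::euclidean_space \<Rightarrow> real"
  assumes "(\<integral>\<^sup>+y. ennreal \<bar>a ((x - y) /\<^sub>R e) * f y\<bar> \<partial>lborel) \<le> ennreal (e ^ DIM('a) * c)" "0 < e" "0 \<le> c"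
  shows "\<bar>approx_avg a e f x\<bar> \<le> c"
proof -
  have "ennreal \<bar>\<integral>y. a ((x - y) /\<^sub>R e) * f y \<partial>lebesgue\<bar> \<le> (\<integral>\<^sup>+y. ennreal \<bar>a ((x - y) /\<^sub>R e) * f y\<bar> \<partial>lebesgue)"
    using integral_norm_bound_ennreal[of lebesgue "\<lambda>y. a ((x - y) /\<^sub>R e) * f y"]
    by (cases "integrable lebesgue (\<lambda>y. a ((x - y) /\<^sub>R e) * f y)") (auto simp: not_integrable_integral_eq)
  also have "\<dots> \<le> ennreal (e ^ DIM('a) * c)"
    using assms(1) by (simp add: nn_integral_completion)
  finally have "\<bar>\<integral>y. a ((x - y) /\<^sub>R e) * f y \<partial>lebesgue\<bar> \<le> e ^ DIM('a) * c"
    using assms by (subst (asm) ennreal_le_iff) auto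
  then show ?thesis
    using assms(2) by (simp add: approx_avg_def abs_mult field_simps)
qed

text \<open>With \<open>\<mu>\<close> just above \<open>f\<^sup>* t\<close> and \<open>s\<close> just above \<open>5 ^ n\<close> times the Hardy average \<open>h\<close>, the exceptional set
has measure at most \<open>t\<close>. So \<open>P * (\<mu> + s)\<close> is an admissible level in the infimum that defines the
rearrangement of the maximal function.\<close>

theorem rearrangement_approx_max_le_hardy:
  fixes a f :: "'a::euclidean_space \<Rightarrow> real"
  assumes \<psi>: "antimono_on {0<..} \<psi>" and \<psi>m: "\<psi> \<in> borel_measurable borel"
    and P: "(\<integral>\<^sup>+z. ennreal (\<psi> (norm (z :: 'a))) \<partial>lborel) = ennreal P" "0 < P"
    and am: "a \<in> borel_measurable borel"
    and a: "AE z in lborel. \<bar>a z\<bar> \<le> \<psi> (norm z)"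
    and f[measurable]: "f \<in> borel_measurable borel" and t: "0 < t"
  shows "rearrangement (approx_max a f) t
    \<le> ennreal (P * (5 ^ DIM('a) + 1)) * hardy (rearrangement (\<lambda>x. ereal (f x))) t"
proof (cases "hardy (rearrangement (\<lambda>x. ereal (f x))) t")
  case (real h)
  define c where "c = (5 :: real) ^ DIM('a)"
  have c: "0 < c" by (simp add: c_def)
  have J: "(\<integral>\<^sup>+s\<in>{0<..<t}. rearrangement (\<lambda>x. ereal (f x)) s \<partial>lborel) = ennreal (t * h)"
  proof -
    have "(\<integral>\<^sup>+s\<in>{0<..<t}. rearrangement (\<lambda>x. ereal (f x)) s \<partial>lborel) / ennreal t = ennreal h"
      using real by (simp add: hardy_def)
    then have "(\<integral>\<^sup>+s\<in>{0<..<t}. rearrangement (\<lambda>x. ereal (f x)) s \<partial>lborel) / ennreal t * ennreal t = ennreal (t * h)"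
      using t real(1) by (simp add: mult.commute flip: ennreal_mult)
    then show ?thesis
      using t by (simp add: ennreal_divide_times mult_divide_eq_ennreal)
  qed
  have anti: "antimono_on {0<..} (rearrangement (\<lambda>x. ereal (f x)))"
    using antimono_rearrangement by (auto simp: monotone_on_def)
  have fh: "rearrangement (\<lambda>x. ereal (f x)) t \<le> ennreal h"
    using le_hardy[OF _ anti t] real by simp
  have "rearrangement (approx_max a f) t \<le> ennreal (P * (c + 1)) * ennreal h"
  proof (rule ennreal_le_epsilon)
    fix e :: real assume "0 < e"
    \<comment> \<open>The slack \<open>\<delta>\<close> enters twice, through \<open>\<mu>\<close> and through \<open>s\<close>, each time multiplied by \<open>P\<close>.\<close>
    define \<delta> where "\<delta> = e / (2 * P)"
    have \<delta>: "0 < \<delta>" using \<open>0 < e\<close> P by (simp add: \<delta>_def)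
    have "rearrangement (\<lambda>x. ereal (f x)) t < ennreal (h + \<delta>)"
      using fh by (rule order.strict_trans1) (use \<delta> real in \<open>auto simp: ennreal_less_iff\<close>)
    then obtain \<mu> where \<mu>: "0 < \<mu>" "emeasure lborel {y. \<mu> < \<bar>f y\<bar>} \<le> ennreal t" "\<mu> < h + \<delta>"
      unfolding rearrangement_borel[OF f] INF_less_iff by (auto simp: ennreal_less_iff)
    define s where "s = c * h + \<delta>"
    have s: "0 < s" using \<delta> real c by (simp add: s_def add_nonneg_pos)
    obtain E where E: "E \<in> sets borel" "emeasure lborel E \<le> ennreal (c * (t * h) / s)"
      "\<And>x e. x \<notin> E \<Longrightarrow> 0 < e \<Longrightarrow>
        (\<integral>\<^sup>+y. ennreal \<bar>a ((x - y) /\<^sub>R e) * f y\<bar> \<partial>lborel) \<le> ennreal (e ^ DIM('a) * (P * (\<mu> + s)))"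
      using dominated_kernel_estimate[OF \<psi> \<psi>m P(1) _ am a f \<mu>(1) s \<mu>(2), of "t * h"] J P(2) t real
      unfolding c_def by auto
    have "c * (t * h) / s \<le> t"
      using s t \<delta> by (simp add: s_def field_simps)
    then have Et: "emeasure lborel E \<le> ennreal t"
      using E(2) by (auto intro: order_trans ennreal_leI)
    have "approx_max a f x \<le> ereal (P * (\<mu> + s))" if "x \<notin> E" for x
      unfolding approx_max_def
      using E(3)[OF that] P \<mu> s by (intro SUP_least) (auto intro!: abs_approx_avg_le)
    moreover have "0 \<le> approx_max a f x" for x
      unfolding approx_max_def by (rule SUP_upper2[of 1]) auto
    ultimately have "{y. ereal (P * (\<mu> + s)) < \<bar>approx_max a f y\<bar>} \<subseteq> E"
      by (auto simp: not_le[symmetric])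
    then have "emeasure lebesgue {y. ereal (P * (\<mu> + s)) < \<bar>approx_max a f y\<bar>} \<le> emeasure lebesgue E"
      using E(1) by (intro emeasure_mono) auto
    also have "\<dots> \<le> ennreal t" using E(1) Et by simp
    finally have "rearrangement (approx_max a f) t \<le> ennreal (P * (\<mu> + s))"
      unfolding rearrangement_def using P \<mu> s by (intro INF_lower) auto
    also have "\<dots> \<le> ennreal (P * (c + 1) * h + e)"
    proof (rule ennreal_leI)
      have "P * (\<mu> + s) \<le> P * (h + \<delta> + s)" using \<mu> P by (intro mult_left_mono) auto
      also have "\<dots> = P * (c + 1) * h + e" using P by (simp add: s_def \<delta>_def field_simps)
      finally show "P * (\<mu> + s) \<le> P * (c + 1) * h + e" .
    qed
    also have "\<dots> = ennreal (P * (c + 1)) * ennreal h + ennreal e"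
      using P c real \<open>0 < e\<close> by (simp flip: ennreal_mult ennreal_plus)
    finally show "rearrangement (approx_max a f) t \<le> ennreal (P * (c + 1)) * ennreal h + ennreal e" .
  qed
  then show ?thesis using real by (simp add: c_def)
next
  case top
  have "0 < P * (5 ^ DIM('a) + 1)" using P by (intro mult_pos_pos) (auto intro: add_pos_pos)
  then have "ennreal (P * (5 ^ DIM('a) + 1)) \<noteq> 0"
    by (simp only: ennreal_eq_0_iff not_le)
  then show ?thesis unfolding top ennreal_mult_top by (simp only: if_False top_greatest)
qed

section \<open>Measurability of the maximal function\<close>

lemma integrable_indicator_cball: "integrable lborel (indicator (cball x r) :: 'a::euclidean_space \<Rightarrow> real)"
  by (rule integrable_real_indicator[OF _ emeasure_lborel_cball_finite]) simp

text \<open>Truncate \<open>a\<close> in height and in space, then replace it by continuous functions that converge to it almost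
everywhere, truncated in the same way. Both steps converge in $L^1$ by dominated convergence.\<close>

lemma L1_approx_continuous_compact_support:
  fixes a :: "'a::euclidean_space \<Rightarrow> real"
  assumes a: "integrable lborel a" and \<delta>: "0 < \<delta>"
  obtains c R M where "continuous_on UNIV c" "\<And>z. R < norm z \<Longrightarrow> c z = 0" "0 < R"
    "\<And>z. \<bar>c z\<bar> \<le> M" "integrable lborel c" "(\<integral>z. \<bar>a z - c z\<bar> \<partial>lborel) < \<delta>"
proof -
  have [measurable]: "a \<in> borel_measurable borel"
    using borel_measurable_integrable[OF a] by simp
  \<comment> \<open>\<open>cut m\<close> is a continuous cut-off in space and \<open>cl m\<close> clamps values to \<open>[-m, m]\<close>.\<close>
  define cut where "cut m z = max 0 (min 1 (real m + 1 - norm z))" for m and z :: 'a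
  define cl where "cl m v = max (- real m) (min (real m) v)" for m and v
  have cut: "0 \<le> cut m z" "cut m z \<le> 1" "real m + 1 < norm z \<Longrightarrow> cut m z = 0"
      "norm z \<le> real m \<Longrightarrow> cut m z = 1" for m z
    by (auto simp: cut_def)
  have cl: "\<bar>cl m v\<bar> \<le> real m" "\<bar>cl m v\<bar> \<le> \<bar>v\<bar>" "\<bar>v\<bar> \<le> real m \<Longrightarrow> cl m v = v" for m v
    by (auto simp: cl_def)
  have cut_cont: "continuous_on UNIV (cut m)" for m
    unfolding cut_def by (intro continuous_intros)
  have [measurable]: "cut m \<in> borel_measurable borel" for m
    using cut_cont by (rule borel_measurable_continuous_onI)
  have [measurable]: "cl m \<in> borel_measurable borel" for m
    unfolding cl_def by measurable
  have "(\<lambda>m. \<integral>\<^sup>+z. ennreal (norm (a z - cl m (a z) * cut m z)) \<partial>lborel) \<longlonglongrightarrow> 0"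
  proof (rule nn_integral_dominated_convergence_norm[where w = "\<lambda>z. \<bar>a z\<bar>"])
    show "AE z in lborel. norm (cl m (a z) * cut m z) \<le> \<bar>a z\<bar>" for m
    proof (rule AE_I2)
      fix z
      have "\<bar>cl m (a z)\<bar> * \<bar>cut m z\<bar> \<le> \<bar>a z\<bar> * 1"
        using cl cut by (intro mult_mono) auto
      then show "norm (cl m (a z) * cut m z) \<le> \<bar>a z\<bar>" by (simp add: abs_mult)
    qed
    show "(\<integral>\<^sup>+z. ennreal \<bar>a z\<bar> \<partial>lborel) < \<infinity>"
      using a by (simp add: integrable_iff_bounded)
    show "AE z in lborel. (\<lambda>m. cl m (a z) * cut m z) \<longlonglongrightarrow> a z"
    proof (rule AE_I2, rule tendsto_eventually)
      fix z
      obtain m0 :: nat where "max \<bar>a z\<bar> (norm z) \<le> real m0" using real_arch_simple by blast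
      then show "\<forall>\<^sub>F m in sequentially. cl m (a z) * cut m z = a z"
        using cl(3) cut(4) by (intro eventually_sequentiallyI[of m0]) (simp add: max_def split: if_splits)
    qed
  qed measurable
  then have "\<forall>\<^sub>F m in sequentially. (\<integral>\<^sup>+z. ennreal (norm (a z - cl m (a z) * cut m z)) \<partial>lborel) < ennreal (\<delta> / 2)"
    using \<delta> by (intro order_tendstoD(2)) auto
  then obtain m where m: "(\<integral>\<^sup>+z. ennreal (norm (a z - cl m (a z) * cut m z)) \<partial>lborel) < ennreal (\<delta> / 2)"
    by (auto simp: eventually_sequentially)
  have "a measurable_on UNIV"
    by (intro lebesgue_measurable_imp_measurable_on) (auto intro: measurable_completion)
  then obtain N g where N: "negligible N" and g: "\<And>n. continuous_on UNIV (g n)"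
    "\<And>z. z \<notin> N \<Longrightarrow> (\<lambda>n. g n z) \<longlonglongrightarrow> a z"
    unfolding measurable_on_def by auto
  have AE_N: "AE z in lborel. z \<notin> N"
  proof -
    have "AE z in lebesgue. z \<notin> N"
      using N by (simp add: negligible_iff_null_sets AE_not_in)
    then show ?thesis by (simp add: AE_completion_iff)
  qed
  define G where "G n z = cl m (g n z) * cut m z" for n z
  have cl_cont: "continuous_on UNIV (cl m)" unfolding cl_def by (intro continuous_intros)
  have G_cont: "continuous_on UNIV (G n)" for n
    unfolding G_def
    by (intro continuous_on_mult cut_cont continuous_on_compose2[OF cl_cont g(1)]) auto
  have [measurable]: "G n \<in> borel_measurable borel" for n
    using G_cont by (rule borel_measurable_continuous_onI)
  have G_bound: "\<bar>G n z\<bar> \<le> real m * indicator (cball 0 (real m + 1)) z" for n z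
  proof (cases "real m + 1 < norm z")
    case False
    have "\<bar>cl m (g n z)\<bar> * \<bar>cut m z\<bar> \<le> real m * 1"
      using cl cut by (intro mult_mono) auto
    then show ?thesis using False by (simp add: G_def abs_mult)
  qed (simp add: G_def cut(3))
  have [measurable]: "(\<lambda>z::'a. real m * indicator (cball 0 (real m + 1)) z) \<in> borel_measurable borel"
    by (intro borel_measurable_times borel_measurable_const borel_measurable_indicator) auto
  have dom: "(\<integral>\<^sup>+(z::'a). ennreal (real m * indicator (cball 0 (real m + 1)) z) \<partial>lborel) < \<infinity>"
    using emeasure_lborel_cball_finite[of "0 :: 'a" "real m + 1"]
    by (simp add: ennreal_mult ennreal_indicator nn_integral_cmult_indicator ennreal_mult_less_top)
  have "(\<lambda>n. \<integral>\<^sup>+z. ennreal (norm (cl m (a z) * cut m z - G n z)) \<partial>lborel) \<longlonglongrightarrow> 0"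
  proof (rule nn_integral_dominated_convergence_norm[where w = "\<lambda>z. real m * indicator (cball 0 (real m + 1)) z"])
    show "AE z in lborel. (\<lambda>n. G n z) \<longlonglongrightarrow> cl m (a z) * cut m z"
      using AE_N
    proof eventually_elim
      fix z assume "z \<notin> N"
      then have "(\<lambda>n. cl m (g n z)) \<longlonglongrightarrow> cl m (a z)"
        unfolding cl_def by (intro tendsto_intros g)
      then show "(\<lambda>n. G n z) \<longlonglongrightarrow> cl m (a z) * cut m z"
        unfolding G_def by (intro tendsto_intros)
    qed
    show "AE z in lborel. norm (G j z) \<le> real m * indicator (cball 0 (real m + 1)) z" for j
      using G_bound by simp
  qed (use dom in auto)
  then have "\<forall>\<^sub>F n in sequentially. (\<integral>\<^sup>+z. ennreal (norm (cl m (a z) * cut m z - G n z)) \<partial>lborel) < ennreal (\<delta> / 2)"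
    using \<delta> by (intro order_tendstoD(2)) auto
  then obtain n where n: "(\<integral>\<^sup>+z. ennreal (norm (cl m (a z) * cut m z - G n z)) \<partial>lborel) < ennreal (\<delta> / 2)"
    by (auto simp: eventually_sequentially)
  have Gint: "integrable lborel (G n)"
  proof (rule Bochner_Integration.integrable_bound[of _ "\<lambda>z. real m * indicator (cball 0 (real m + 1)) z"])
    show "integrable lborel (\<lambda>z::'a. real m * indicator (cball 0 (real m + 1)) z)"
      by (simp add: integrable_indicator_cball)
  qed (use G_bound in auto)
  have "ennreal (\<integral>z. \<bar>a z - G n z\<bar> \<partial>lborel) = (\<integral>\<^sup>+z. ennreal \<bar>a z - G n z\<bar> \<partial>lborel)"
    using a Gint by (intro nn_integral_eq_integral[symmetric]) auto
  also have "\<dots> \<le> (\<integral>\<^sup>+z. ennreal (norm (a z - cl m (a z) * cut m z)) + ennreal (norm (cl m (a z) * cut m z - G n z)) \<partial>lborel)"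
    by (intro nn_integral_mono) (auto simp flip: ennreal_plus intro!: ennreal_leI)
  also have "\<dots> = (\<integral>\<^sup>+z. ennreal (norm (a z - cl m (a z) * cut m z)) \<partial>lborel) +
      (\<integral>\<^sup>+z. ennreal (norm (cl m (a z) * cut m z - G n z)) \<partial>lborel)"
    by (rule nn_integral_add) measurable
  also have "\<dots> < ennreal (\<delta> / 2) + ennreal (\<delta> / 2)"
    using m n by (rule add_strict_mono)
  also have "\<dots> = ennreal \<delta>" using \<delta> by (simp flip: ennreal_plus)
  finally have fin: "(\<integral>z. \<bar>a z - G n z\<bar> \<partial>lborel) < \<delta>"
    using \<delta> by (subst (asm) ennreal_less_iff) auto
  show thesis
  proof (rule that[of "G n" "real m + 1" "real m"])
    show "\<bar>G n z\<bar> \<le> real m" for z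
      using G_bound[of n z] by (auto split: split_indicator_asm)
    show "G n z = 0" if "real m + 1 < norm z" for z
      using that cut(3) by (simp add: G_def)
  qed (use G_cont Gint fin in auto)
qed

lemma
  fixes a :: "'a::euclidean_space \<Rightarrow> real"
  assumes a: "integrable lborel a" and [measurable]: "b \<in> borel_measurable borel"
    and b: "\<And>y. \<bar>b y\<bar> \<le> B" and e: "0 < e"
  shows integrable_dilated_kernel_mult: "integrable lborel (\<lambda>y. a ((x - y) /\<^sub>R e) * b y)"
    and abs_integral_dilated_kernel_le:
      "\<bar>\<integral>y. a ((x - y) /\<^sub>R e) * b y \<partial>lborel\<bar> \<le> B * e ^ DIM('a) * (\<integral>z. \<bar>a z\<bar> \<partial>lborel)"
proof -
  have [measurable]: "a \<in> borel_measurable borel"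
    using borel_measurable_integrable[OF a] by simp
  have B: "0 \<le> B" using b[of 0] by linarith
  have I0: "0 \<le> (\<integral>z. \<bar>a z\<bar> \<partial>lborel)" by simp
  have "(\<integral>\<^sup>+y. ennreal \<bar>a ((x - y) /\<^sub>R e) * b y\<bar> \<partial>lborel) \<le> (\<integral>\<^sup>+y. ennreal B * ennreal \<bar>a ((x - y) /\<^sub>R e)\<bar> \<partial>lborel)"
    using B b by (intro nn_integral_mono)
      (auto simp: abs_mult mult.commute[of B] intro!: ennreal_leI mult_left_mono simp flip: ennreal_mult)
  also have "\<dots> = ennreal B * (ennreal (e ^ DIM('a)) * (\<integral>\<^sup>+z. ennreal \<bar>a z\<bar> \<partial>lborel))"
    using e nn_integral_lborel_reflected_dilation[of "\<lambda>z. ennreal \<bar>a z\<bar>" e x] by (simp add: nn_integral_cmult)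
  also have "(\<integral>\<^sup>+z. ennreal \<bar>a z\<bar> \<partial>lborel) = ennreal (\<integral>z. \<bar>a z\<bar> \<partial>lborel)"
    using a by (intro nn_integral_eq_integral) auto
  also have "ennreal B * (ennreal (e ^ DIM('a)) * ennreal (\<integral>z. \<bar>a z\<bar> \<partial>lborel)) =
      ennreal (B * e ^ DIM('a) * (\<integral>z. \<bar>a z\<bar> \<partial>lborel))"
    using B e I0 by (simp add: mult.assoc flip: ennreal_mult)
  finally have le: "(\<integral>\<^sup>+y. ennreal \<bar>a ((x - y) /\<^sub>R e) * b y\<bar> \<partial>lborel) \<le> ennreal (B * e ^ DIM('a) * (\<integral>z. \<bar>a z\<bar> \<partial>lborel))" .
  show int: "integrable lborel (\<lambda>y. a ((x - y) /\<^sub>R e) * b y)"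
    unfolding integrable_iff_bounded using le by (auto simp: top_unique less_top[symmetric])
  have "ennreal \<bar>\<integral>y. a ((x - y) /\<^sub>R e) * b y \<partial>lborel\<bar> \<le> ennreal (B * e ^ DIM('a) * (\<integral>z. \<bar>a z\<bar> \<partial>lborel))"
    using integral_norm_bound_ennreal[OF int] le by simp
  then show "\<bar>\<integral>y. a ((x - y) /\<^sub>R e) * b y \<partial>lborel\<bar> \<le> B * e ^ DIM('a) * (\<integral>z. \<bar>a z\<bar> \<partial>lborel)"
    using B e I0 by (subst (asm) ennreal_le_iff) auto
qed

text \<open>Against a bounded function the integral is continuous in the dilation parameter: for a continuous kernel
of compact support by dominated convergence, and in general by approximating the kernel in $L^1$,
uniformly over bounded sets of parameters.\<close>

lemma tendsto_dilated_kernel_integral_bounded: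
  fixes a :: "'a::euclidean_space \<Rightarrow> real"
  assumes a: "integrable lborel a" and [measurable]: "b \<in> borel_measurable borel"
    and b: "\<And>y. \<bar>b y\<bar> \<le> B" and X: "X \<longlonglongrightarrow> e" "\<And>i. 0 < X i" and e: "0 < e"
  shows "(\<lambda>i. \<integral>y. a ((x - y) /\<^sub>R X i) * b y \<partial>lborel) \<longlonglongrightarrow> (\<integral>y. a ((x - y) /\<^sub>R e) * b y \<partial>lborel)"
proof (rule LIMSEQ_I)
  fix r :: real assume r: "0 < r"
  have B: "0 \<le> B" using b[of 0] by linarith
  obtain L where L: "0 < L" "\<And>i. X i \<le> L"
  proof -
    have "Bseq X" using X(1) by (intro convergent_imp_Bseq) (auto simp: convergent_def)
    then obtain L where "0 < L" "\<And>i. norm (X i) \<le> L" by (auto elim: BseqE)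
    then show thesis using X(2) by (intro that[of L]) (auto simp: abs_le_iff)
  qed
  have eL: "e \<le> L" using X(1) L(2) by (intro LIMSEQ_le_const2) auto
  define \<delta> where "\<delta> = r / 3 / ((B + 1) * L ^ DIM('a))"
  have \<delta>: "0 < \<delta>" using r B L by (simp add: \<delta>_def)
  obtain c R M where c: "continuous_on UNIV c" "\<And>z. R < norm z \<Longrightarrow> c z = 0" "0 < R"
    "\<And>z. \<bar>c z\<bar> \<le> M" "integrable lborel c" "(\<integral>z. \<bar>a z - c z\<bar> \<partial>lborel) < \<delta>"
    using L1_approx_continuous_compact_support[OF a \<delta>] by metis
  have [measurable]: "a \<in> borel_measurable borel" "c \<in> borel_measurable borel"
    using borel_measurable_integrable[OF a] borel_measurable_integrable[OF c(5)] by simp_all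
  have M: "0 \<le> M" using c(4)[of 0] by linarith
  have close: "\<bar>(\<integral>y. a ((x - y) /\<^sub>R s) * b y \<partial>lborel) - (\<integral>y. c ((x - y) /\<^sub>R s) * b y \<partial>lborel)\<bar> \<le> r / 3"
    if s: "0 < s" "s \<le> L" for s
  proof -
    have "(\<integral>y. a ((x - y) /\<^sub>R s) * b y \<partial>lborel) - (\<integral>y. c ((x - y) /\<^sub>R s) * b y \<partial>lborel) =
        (\<integral>y. a ((x - y) /\<^sub>R s) * b y - c ((x - y) /\<^sub>R s) * b y \<partial>lborel)"
      by (intro Bochner_Integration.integral_diff[symmetric] integrable_dilated_kernel_mult[OF _ _ b s(1)] a c) auto
    also have "\<dots> = (\<integral>y. (\<lambda>z. a z - c z) ((x - y) /\<^sub>R s) * b y \<partial>lborel)"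
      by (simp add: left_diff_distrib)
    also have "\<bar>\<dots>\<bar> \<le> B * s ^ DIM('a) * (\<integral>z. \<bar>a z - c z\<bar> \<partial>lborel)"
      using a c by (intro abs_integral_dilated_kernel_le[OF _ _ b s(1)]) auto
    also have "\<dots> \<le> (B + 1) * L ^ DIM('a) * \<delta>"
      using B s c(6) by (intro mult_mono power_mono) auto
    also have "\<dots> = r / 3"
    proof -
      have "(B + 1) * L ^ DIM('a) \<noteq> 0" using B L by auto
      from nonzero_eq_divide_eq[OF this, of \<delta> "r / 3", THEN iffD1, OF \<delta>_def]
      show ?thesis by (simp only: mult.commute[of _ \<delta>])
    qed
    finally show ?thesis .
  qed
  have "(\<lambda>i. \<integral>y. c ((x - y) /\<^sub>R X i) * b y \<partial>lborel) \<longlonglongrightarrow> (\<integral>y. c ((x - y) /\<^sub>R e) * b y \<partial>lborel)"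
  proof (rule integral_dominated_convergence[where w = "\<lambda>y. M * B * indicator (cball x (R * L)) y"])
    show "integrable lborel (\<lambda>y. M * B * indicator (cball x (R * L)) y)"
      by (simp add: integrable_indicator_cball)
    show "AE y in lborel. (\<lambda>i. c ((x - y) /\<^sub>R X i) * b y) \<longlonglongrightarrow> c ((x - y) /\<^sub>R e) * b y"
    proof (rule AE_I2)
      fix y
      have lim: "(\<lambda>i. (x - y) /\<^sub>R X i) \<longlonglongrightarrow> (x - y) /\<^sub>R e"
        using X(1) e by (intro tendsto_intros) auto
      have "isCont c ((x - y) /\<^sub>R e)"
        using c(1) by (simp add: continuous_on_eq_continuous_at)
      from isCont_tendsto_compose[OF this lim]
      show "(\<lambda>i. c ((x - y) /\<^sub>R X i) * b y) \<longlonglongrightarrow> c ((x - y) /\<^sub>R e) * b y"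
        by (rule tendsto_mult) (rule tendsto_const)
    qed
    show "AE y in lborel. norm (c ((x - y) /\<^sub>R X i) * b y) \<le> M * B * indicator (cball x (R * L)) y" for i
    proof (rule AE_I2)
      fix y
      show "norm (c ((x - y) /\<^sub>R X i) * b y) \<le> M * B * indicator (cball x (R * L)) y"
      proof (cases "y \<in> cball x (R * L)")
        case True
        then show ?thesis using c(4) b M by (simp add: abs_mult mult_mono)
      next
        case False
        then have "R * L < norm (x - y)" by (simp add: dist_norm)
        moreover have "R * X i \<le> R * L" using c(3) L(2) by (intro mult_left_mono) auto
        ultimately have "R * X i < norm (x - y)" by linarith
        moreover have "norm ((x - y) /\<^sub>R X i) = norm (x - y) / X i"
          using X(2)[of i] by (simp add: divide_inverse mult.commute)
        ultimately have "R < norm ((x - y) /\<^sub>R X i)"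
          using X(2)[of i] by (simp add: pos_less_divide_eq del: norm_scaleR)
        then show ?thesis using c(2) M B by simp
      qed
    qed
  qed measurable
  moreover have "0 < r / 3" using r by simp
  ultimately have "\<exists>i0. \<forall>i\<ge>i0. norm ((\<integral>y. c ((x - y) /\<^sub>R X i) * b y \<partial>lborel) - (\<integral>y. c ((x - y) /\<^sub>R e) * b y \<partial>lborel)) < r / 3"
    by (rule LIMSEQ_D)
  then obtain i0 where i0: "\<forall>i\<ge>i0. norm ((\<integral>y. c ((x - y) /\<^sub>R X i) * b y \<partial>lborel) - (\<integral>y. c ((x - y) /\<^sub>R e) * b y \<partial>lborel)) < r / 3" ..
  show "\<exists>i0. \<forall>i\<ge>i0. norm ((\<integral>y. a ((x - y) /\<^sub>R X i) * b y \<partial>lborel) - (\<integral>y. a ((x - y) /\<^sub>R e) * b y \<partial>lborel)) < r"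
  proof (intro exI allI impI)
    fix i assume "i0 \<le> i"
    from i0[rule_format, OF this] close[OF X(2) L(2), of i] close[OF e eL]
    show "norm ((\<integral>y. a ((x - y) /\<^sub>R X i) * b y \<partial>lborel) - (\<integral>y. a ((x - y) /\<^sub>R e) * b y \<partial>lborel)) < r"
      unfolding real_norm_def by linarith
  qed
qed

text \<open>The integrals of the excesses \<open>\<bar>f\<bar> - k\<close> tend to 0. For a fixed level \<open>s\<close> the exceptional sets of the
weak type bound can therefore be made arbitrarily small, and a point outside one of them has a suitable \<open>k\<close>.\<close>

lemma AE_excess_kernel_small:
  fixes a f :: "'a::euclidean_space \<Rightarrow> real"
  assumes \<psi>: "antimono_on {0<..} \<psi>" and [measurable]: "\<psi> \<in> borel_measurable borel"
    and P: "(\<integral>\<^sup>+z. ennreal (\<psi> (norm (z::'a))) \<partial>lborel) = ennreal P" "0 \<le> P"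
    and a: "AE z in lborel. \<bar>a z\<bar> \<le> \<psi> (norm z)"
    and [measurable]: "f \<in> borel_measurable borel"
    and fin: "(\<integral>\<^sup>+y. ennreal (\<bar>f y\<bar> - \<mu>) \<partial>lborel) < \<infinity>" and s: "0 < s"
  shows "AE x in lborel. \<exists>k::nat. \<forall>e>0.
    (\<integral>\<^sup>+y. ennreal \<bar>a ((x - y) /\<^sub>R e)\<bar> * ennreal (\<bar>f y\<bar> - real k) \<partial>lborel) \<le> ennreal (e ^ DIM('a) * (s * P))"
proof -
  define c where "c = (5::real) ^ DIM('a)"
  have c: "0 < c" by (simp add: c_def)
  obtain k0 :: nat where k0: "\<mu> \<le> real k0" using real_arch_simple by blast
  have "(\<lambda>i. \<integral>\<^sup>+y. ennreal (\<bar>f y\<bar> - real (k0 + i)) \<partial>lborel) \<longlonglongrightarrow> (\<integral>\<^sup>+y. 0 \<partial>(lborel :: 'a measure))"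
  proof (rule nn_integral_dominated_convergence[where w = "\<lambda>y. ennreal (\<bar>f y\<bar> - \<mu>)"])
    show "AE y in lborel. ennreal (\<bar>f y\<bar> - real (k0 + i)) \<le> ennreal (\<bar>f y\<bar> - \<mu>)" for i
      using k0 by (intro AE_I2 ennreal_leI) auto
    show "AE y in lborel. (\<lambda>i. ennreal (\<bar>f y\<bar> - real (k0 + i))) \<longlonglongrightarrow> 0"
    proof (rule AE_I2, rule tendsto_eventually)
      fix y
      obtain i0 :: nat where "\<bar>f y\<bar> \<le> real i0" using real_arch_simple by blast
      then show "\<forall>\<^sub>F i in sequentially. ennreal (\<bar>f y\<bar> - real (k0 + i)) = 0"
        by (intro eventually_sequentiallyI[of i0]) (simp add: ennreal_neg)
    qed
  qed (use fin in auto)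
  then have lim: "(\<lambda>i. \<integral>\<^sup>+y. ennreal (\<bar>f y\<bar> - real (k0 + i)) \<partial>lborel) \<longlonglongrightarrow> 0" by simp
  have "\<forall>j. \<exists>E. E \<in> sets borel \<and> emeasure lborel E \<le> ennreal (1 / real (Suc j)) \<and>
    (\<forall>x. x \<notin> E \<longrightarrow> (\<exists>k::nat. \<forall>e>0. (\<integral>\<^sup>+y. ennreal \<bar>a ((x - y) /\<^sub>R e)\<bar> * ennreal (\<bar>f y\<bar> - real k) \<partial>lborel) \<le> ennreal (e ^ DIM('a) * (s * P))))"
  proof
    fix j
    define G where "G = s / (c * real (Suc j))"
    have G: "0 < G" using s c by (simp add: G_def)
    have "\<forall>\<^sub>F i in sequentially. (\<integral>\<^sup>+y. ennreal (\<bar>f y\<bar> - real (k0 + i)) \<partial>lborel) < ennreal G"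
      using lim G by (intro order_tendstoD(2)) auto
    then obtain i where i: "(\<integral>\<^sup>+y. ennreal (\<bar>f y\<bar> - real (k0 + i)) \<partial>lborel) \<le> ennreal G"
      by (auto simp: eventually_sequentially intro: less_imp_le)
    obtain E where E: "E \<in> sets borel" "emeasure lborel E \<le> ennreal (c * G / s)"
      "\<And>x r. x \<notin> E \<Longrightarrow> 0 < r \<Longrightarrow>
        (\<integral>\<^sup>+y\<in>cball x r. ennreal (\<bar>f y\<bar> - real (k0 + i)) \<partial>lborel) \<le> ennreal s * emeasure lborel (cball x r)"
      using weak_type_ball_averages[of "\<lambda>y. ennreal (\<bar>f y\<bar> - real (k0 + i))" G s] i G s unfolding c_def by auto
    have "c * G / s = 1 / real (Suc j)" using s c by (simp add: G_def)
    moreover have "(\<integral>\<^sup>+y. ennreal \<bar>a ((x - y) /\<^sub>R e)\<bar> * ennreal (\<bar>f y\<bar> - real (k0 + i)) \<partial>lborel) \<le> ennreal (e ^ DIM('a) * (s * P))"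
      if "x \<notin> E" "0 < e" for x e
    proof -
      have "(\<integral>\<^sup>+y. ennreal \<bar>a ((x - y) /\<^sub>R e)\<bar> * ennreal (\<bar>f y\<bar> - real (k0 + i)) \<partial>lborel) \<le> ennreal (e ^ DIM('a) * s) * ennreal P"
        using dominated_kernel_le_ball_averages[OF \<psi> _ a _ s E(3)[OF that(1)] that(2)] by (simp add: P(1))
      also have "\<dots> = ennreal (e ^ DIM('a) * (s * P))"
        using that(2) s P(2) by (simp add: mult.assoc flip: ennreal_mult)
      finally show ?thesis .
    qed
    ultimately show "\<exists>E. E \<in> sets borel \<and> emeasure lborel E \<le> ennreal (1 / real (Suc j)) \<and>
      (\<forall>x. x \<notin> E \<longrightarrow> (\<exists>k::nat. \<forall>e>0. (\<integral>\<^sup>+y. ennreal \<bar>a ((x - y) /\<^sub>R e)\<bar> * ennreal (\<bar>f y\<bar> - real k) \<partial>lborel) \<le> ennreal (e ^ DIM('a) * (s * P))))"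
      using E(1,2) by (intro exI[of _ E] conjI allI impI exI[of _ "k0 + i"]) simp_all
  qed
  from choice[OF this] obtain E where E: "\<And>j. E j \<in> sets borel" "\<And>j. emeasure lborel (E j) \<le> ennreal (1 / real (Suc j))"
    "\<And>j x. x \<notin> E j \<Longrightarrow> \<exists>k::nat. \<forall>e>0. (\<integral>\<^sup>+y. ennreal \<bar>a ((x - y) /\<^sub>R e)\<bar> * ennreal (\<bar>f y\<bar> - real k) \<partial>lborel) \<le> ennreal (e ^ DIM('a) * (s * P))"
    by blast
  have [measurable]: "E j \<in> sets borel" for j by (rule E)
  have le: "emeasure lborel (\<Inter>j. E j) \<le> ennreal \<epsilon>" if \<epsilon>: "0 < \<epsilon>" for \<epsilon>
  proof -
    obtain j where "inverse (real (Suc j)) < \<epsilon>" using reals_Archimedean[OF \<epsilon>] by auto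
    then have "ennreal (1 / real (Suc j)) \<le> ennreal \<epsilon>" by (intro ennreal_leI) (simp add: inverse_eq_divide)
    moreover have "emeasure lborel (\<Inter>j. E j) \<le> emeasure lborel (E j)" by (intro emeasure_mono) auto
    ultimately show ?thesis using E(2)[of j] by (meson order_trans)
  qed
  have "emeasure lborel (\<Inter>j. E j) \<le> 0"
  proof (rule ennreal_le_epsilon)
    fix \<epsilon> :: real assume "0 < \<epsilon>"
    then show "emeasure lborel (\<Inter>j. E j) \<le> 0 + ennreal \<epsilon>" unfolding add_0 by (rule le)
  qed
  then have "emeasure lborel (\<Inter>j. E j) = 0" by (rule antisym) simp
  moreover have "(\<Inter>j. E j) \<in> sets lborel" using E(1) by simp
  ultimately have "(\<Inter>j. E j) \<in> null_sets lborel" by (rule null_setsI)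
  then have "AE x in lborel. x \<notin> (\<Inter>j. E j)" by (rule AE_not_in)
  then show ?thesis
    by eventually_elim (use E(3) in blast)
qed

text \<open>Replacing \<open>f\<close> by its truncation at height \<open>k\<close> changes the kernel integrals by little, uniformly for
bounded dilation parameters, so continuity is inherited from the bounded case.\<close>

lemma AE_kernel_integral_continuous:
  fixes a f :: "'a::euclidean_space \<Rightarrow> real"
  assumes \<psi>: "antimono_on {0<..} \<psi>" and \<psi>m: "\<psi> \<in> borel_measurable borel"
    and P: "(\<integral>\<^sup>+z. ennreal (\<psi> (norm (z::'a))) \<partial>lborel) = ennreal P" "0 \<le> P"
    and a: "AE z in lborel. \<bar>a z\<bar> \<le> \<psi> (norm z)" and ai: "integrable lborel a"
    and f [measurable]: "f \<in> borel_measurable borel"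
    and fin: "(\<integral>\<^sup>+y. ennreal (\<bar>f y\<bar> - \<mu>) \<partial>lborel) < \<infinity>"
  shows "AE x in lborel. (\<forall>e>0. integrable lborel (\<lambda>y. a ((x - y) /\<^sub>R e) * f y)) \<and>
    (\<forall>X e. X \<longlonglongrightarrow> e \<longrightarrow> 0 < e \<longrightarrow> (\<forall>i. 0 < X i) \<longrightarrow>
      (\<lambda>i. \<integral>y. a ((x - y) /\<^sub>R X i) * f y \<partial>lborel) \<longlonglongrightarrow> (\<integral>y. a ((x - y) /\<^sub>R e) * f y \<partial>lborel))"
proof -
  have [measurable]: "a \<in> borel_measurable borel"
    using borel_measurable_integrable[OF ai] by simp
  have "AE x in lborel. \<forall>j. \<exists>k::nat. \<forall>e>0.
    (\<integral>\<^sup>+y. ennreal \<bar>a ((x - y) /\<^sub>R e)\<bar> * ennreal (\<bar>f y\<bar> - real k) \<partial>lborel) \<le> ennreal (e ^ DIM('a) * (1 / real (Suc j) * P))"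
    unfolding AE_all_countable by (intro allI AE_excess_kernel_small[OF \<psi> \<psi>m P a f fin]) simp
  then show ?thesis
  proof eventually_elim
    fix x
    assume small: "\<forall>j. \<exists>k::nat. \<forall>e>0.
      (\<integral>\<^sup>+y. ennreal \<bar>a ((x - y) /\<^sub>R e)\<bar> * ennreal (\<bar>f y\<bar> - real k) \<partial>lborel) \<le> ennreal (e ^ DIM('a) * (1 / real (Suc j) * P))"
    define fk where "fk k y = max (- real k) (min (real k) (f y))" for k y
    have [measurable]: "fk k \<in> borel_measurable borel" for k unfolding fk_def by measurable
    have fk: "\<bar>fk k y\<bar> \<le> real k" for k y by (auto simp: fk_def)
    have diff: "ennreal \<bar>a ((x - y) /\<^sub>R e) * (f y - fk k y)\<bar> =
        ennreal \<bar>a ((x - y) /\<^sub>R e)\<bar> * ennreal (\<bar>f y\<bar> - real k)" for k y e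
    proof -
      have "ennreal \<bar>f y - fk k y\<bar> = ennreal (\<bar>f y\<bar> - real k)"
        by (cases "\<bar>f y\<bar> \<le> real k") (auto simp: fk_def ennreal_neg max_def min_def abs_if split: if_splits)
      then show ?thesis by (simp add: abs_mult ennreal_mult)
    qed
    have int_k: "integrable lborel (\<lambda>y. a ((x - y) /\<^sub>R e) * fk k y)" if "0 < e" for k e
      by (rule integrable_dilated_kernel_mult[OF ai _ fk that]) measurable
    have int_diff: "integrable lborel (\<lambda>y. a ((x - y) /\<^sub>R e) * (f y - fk k y))"
      if k: "\<And>e. 0 < e \<Longrightarrow> (\<integral>\<^sup>+y. ennreal \<bar>a ((x - y) /\<^sub>R e)\<bar> * ennreal (\<bar>f y\<bar> - real k) \<partial>lborel) \<le> ennreal (e ^ DIM('a) * (1 / real (Suc j) * P))"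
        and e: "0 < e" for k j e
      unfolding integrable_iff_bounded using k[OF e] by (auto simp: diff top_unique less_top[symmetric])
    have int: "integrable lborel (\<lambda>y. a ((x - y) /\<^sub>R e) * f y)" if e: "0 < e" for e
    proof -
      obtain k where "\<And>e. 0 < e \<Longrightarrow> (\<integral>\<^sup>+y. ennreal \<bar>a ((x - y) /\<^sub>R e)\<bar> * ennreal (\<bar>f y\<bar> - real k) \<partial>lborel) \<le> ennreal (e ^ DIM('a) * (1 / real (Suc 0) * P))"
        using small by blast
      from Bochner_Integration.integrable_add[OF int_diff[OF this e] int_k[OF e, of k]]
      show ?thesis by (simp add: algebra_simps)
    qed
    moreover have "(\<lambda>i. \<integral>y. a ((x - y) /\<^sub>R X i) * f y \<partial>lborel) \<longlonglongrightarrow> (\<integral>y. a ((x - y) /\<^sub>R e) * f y \<partial>lborel)"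
      if X: "X \<longlonglongrightarrow> e" and e: "0 < e" and X0: "\<And>i. 0 < X i" for X e
    proof (rule LIMSEQ_I)
      fix r :: real assume r: "0 < r"
      obtain L where L: "0 < L" "\<And>i. X i \<le> L"
      proof -
        have "Bseq X" using X by (intro convergent_imp_Bseq) (auto simp: convergent_def)
        then obtain L where "0 < L" "\<And>i. norm (X i) \<le> L" by (auto elim: BseqE)
        then show thesis using X0 by (intro that[of L]) (auto simp: abs_le_iff)
      qed
      have eL: "e \<le> L" using X L(2) by (intro LIMSEQ_le_const2) auto
      define \<delta> where "\<delta> = r / 3 / ((P + 1) * L ^ DIM('a))"
      have \<delta>: "0 < \<delta>" using r P(2) L by (simp add: \<delta>_def)
      obtain j where j: "inverse (real (Suc j)) < \<delta>" using reals_Archimedean[OF \<delta>] by auto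
      obtain k where k: "\<And>e. 0 < e \<Longrightarrow> (\<integral>\<^sup>+y. ennreal \<bar>a ((x - y) /\<^sub>R e)\<bar> * ennreal (\<bar>f y\<bar> - real k) \<partial>lborel) \<le> ennreal (e ^ DIM('a) * (1 / real (Suc j) * P))"
        using small by blast
      have close: "\<bar>(\<integral>y. a ((x - y) /\<^sub>R s) * f y \<partial>lborel) - (\<integral>y. a ((x - y) /\<^sub>R s) * fk k y \<partial>lborel)\<bar> \<le> r / 3"
        if s: "0 < s" "s \<le> L" for s
      proof -
        have eq: "(\<integral>y. a ((x - y) /\<^sub>R s) * f y \<partial>lborel) - (\<integral>y. a ((x - y) /\<^sub>R s) * fk k y \<partial>lborel) =
            (\<integral>y. a ((x - y) /\<^sub>R s) * (f y - fk k y) \<partial>lborel)"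
          by (subst Bochner_Integration.integral_diff[symmetric, OF int[OF s(1)] int_k[OF s(1)]])
            (simp add: right_diff_distrib)
        have "ennreal \<bar>\<integral>y. a ((x - y) /\<^sub>R s) * (f y - fk k y) \<partial>lborel\<bar> \<le> ennreal (s ^ DIM('a) * (1 / real (Suc j) * P))"
          using integral_norm_bound_ennreal[OF int_diff[OF k s(1)]] k[OF s(1)] by (simp add: diff)
        then have "\<bar>\<integral>y. a ((x - y) /\<^sub>R s) * (f y - fk k y) \<partial>lborel\<bar> \<le> s ^ DIM('a) * (1 / real (Suc j) * P)"
          using s P(2) by (subst (asm) ennreal_le_iff) auto
        also have "s ^ DIM('a) * (1 / real (Suc j) * P) \<le> L ^ DIM('a) * (\<delta> * (P + 1))"
          using s P(2) j \<delta> by (intro mult_mono power_mono) (auto simp: inverse_eq_divide)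
        also have "L ^ DIM('a) * (\<delta> * (P + 1)) = (P + 1) * L ^ DIM('a) * \<delta>" by (simp only: mult_ac)
        also have "(P + 1) * L ^ DIM('a) * \<delta> = r / 3"
        proof -
          have "(P + 1) * L ^ DIM('a) \<noteq> 0" using P(2) L by auto
      from nonzero_eq_divide_eq[OF this, of \<delta> "r / 3", THEN iffD1, OF \<delta>_def]
          show ?thesis by (simp only: mult.commute[of _ \<delta>])
        qed
        finally show ?thesis unfolding eq .
      qed
      have "(\<lambda>i. \<integral>y. a ((x - y) /\<^sub>R X i) * fk k y \<partial>lborel) \<longlonglongrightarrow> (\<integral>y. a ((x - y) /\<^sub>R e) * fk k y \<partial>lborel)"
        by (rule tendsto_dilated_kernel_integral_bounded[OF ai _ fk X X0 e]) measurable
      moreover have "0 < r / 3" using r by simp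
      ultimately have "\<exists>i0. \<forall>i\<ge>i0. norm ((\<integral>y. a ((x - y) /\<^sub>R X i) * fk k y \<partial>lborel) - (\<integral>y. a ((x - y) /\<^sub>R e) * fk k y \<partial>lborel)) < r / 3"
        by (rule LIMSEQ_D)
      then obtain i0 where i0: "\<forall>i\<ge>i0. norm ((\<integral>y. a ((x - y) /\<^sub>R X i) * fk k y \<partial>lborel) - (\<integral>y. a ((x - y) /\<^sub>R e) * fk k y \<partial>lborel)) < r / 3" ..
      show "\<exists>i0. \<forall>i\<ge>i0. norm ((\<integral>y. a ((x - y) /\<^sub>R X i) * f y \<partial>lborel) - (\<integral>y. a ((x - y) /\<^sub>R e) * f y \<partial>lborel)) < r"
      proof (intro exI allI impI)
        fix i assume "i0 \<le> i"
        from i0[rule_format, OF this] close[OF X0 L(2), of i] close[OF e eL]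
        show "norm ((\<integral>y. a ((x - y) /\<^sub>R X i) * f y \<partial>lborel) - (\<integral>y. a ((x - y) /\<^sub>R e) * f y \<partial>lborel)) < r"
          unfolding real_norm_def by linarith
      qed
    qed
    ultimately show "(\<forall>e>0. integrable lborel (\<lambda>y. a ((x - y) /\<^sub>R e) * f y)) \<and>
      (\<forall>X e. X \<longlonglongrightarrow> e \<longrightarrow> 0 < e \<longrightarrow> (\<forall>i. 0 < X i) \<longrightarrow>
        (\<lambda>i. \<integral>y. a ((x - y) /\<^sub>R X i) * f y \<partial>lborel) \<longlonglongrightarrow> (\<integral>y. a ((x - y) /\<^sub>R e) * f y \<partial>lborel))"
      by blast
  qed
qed

lemma measurable_lebesgue_AE_eq:
  fixes f g :: "'a::euclidean_space \<Rightarrow> 'b::topological_space"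
  assumes f: "f \<in> borel_measurable lebesgue" and ae: "AE x in lebesgue. f x = g x"
  shows "g \<in> borel_measurable lebesgue"
proof (rule measurableI)
  fix S :: "'b set" assume S: "S \<in> sets borel"
  show "g -` S \<inter> space lebesgue \<in> sets lebesgue"
  proof (rule completion.in_sets_AE)
    show "f -` S \<inter> space lebesgue \<in> sets lebesgue" using f S by (rule measurable_sets)
    show "AE x in lebesgue. x \<in> f -` S \<inter> space lebesgue \<longleftrightarrow> x \<in> g -` S \<inter> space lebesgue"
      using ae by eventually_elim auto
  qed auto
qed simp

lemma approx_avg_borel:
  fixes a f :: "'a::euclidean_space \<Rightarrow> real"
  assumes [measurable]: "a \<in> borel_measurable borel" "f \<in> borel_measurable borel"
  shows "approx_avg a e f x = 1 / e ^ DIM('a) * (\<integral>y. a ((x - y) /\<^sub>R e) * f y \<partial>lborel)"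
proof -
  have "(\<lambda>y. a ((x - y) /\<^sub>R e) * f y) \<in> borel_measurable lborel" by measurable
  from integral_completion[OF this] show ?thesis by (simp only: approx_avg_def)
qed

text \<open>Continuity in the dilation parameter turns the supremum into one over the positive rationals for almost every
\<open>x\<close>; completeness of Lebesgue measure absorbs the exceptional null set.\<close>

lemma measurable_approx_max:
  fixes a f :: "'a::euclidean_space \<Rightarrow> real"
  assumes \<psi>: "antimono_on {0<..} \<psi>" and \<psi>m: "\<psi> \<in> borel_measurable borel"
    and P: "(\<integral>\<^sup>+z. ennreal (\<psi> (norm (z::'a))) \<partial>lborel) = ennreal P" "0 \<le> P"
    and a: "AE z in lborel. \<bar>a z\<bar> \<le> \<psi> (norm z)" and ai: "integrable lborel a"
    and f [measurable]: "f \<in> borel_measurable borel"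
    and fin: "(\<integral>\<^sup>+y. ennreal (\<bar>f y\<bar> - \<mu>) \<partial>lborel) < \<infinity>"
  shows "approx_max a f \<in> borel_measurable lebesgue"
proof -
  have [measurable]: "a \<in> borel_measurable borel"
    using borel_measurable_integrable[OF ai] by simp
  define D where "D = {0<..} \<inter> (\<rat> :: real set)"
  have D: "countable D" unfolding D_def by (intro countable_Int2 countable_rat)
  have [measurable]: "(\<lambda>x. approx_avg a e f x) \<in> borel_measurable borel" for e
    unfolding approx_avg_borel[OF \<open>a \<in> _\<close> f] by measurable
  have meas: "(\<lambda>x. SUP e\<in>D. ereal \<bar>approx_avg a e f x\<bar>) \<in> borel_measurable lebesgue"
    using D by (intro measurable_completion borel_measurable_SUP) auto
  have "AE x in lebesgue. (SUP e\<in>D. ereal \<bar>approx_avg a e f x\<bar>) = approx_max a f x"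
    unfolding AE_completion_iff
    using AE_kernel_integral_continuous[OF \<psi> \<psi>m P a ai f fin]
  proof eventually_elim
    fix x
    assume *: "(\<forall>e>0. integrable lborel (\<lambda>y. a ((x - y) /\<^sub>R e) * f y)) \<and>
      (\<forall>X e. X \<longlonglongrightarrow> e \<longrightarrow> 0 < e \<longrightarrow> (\<forall>i. 0 < X i) \<longrightarrow>
        (\<lambda>i. \<integral>y. a ((x - y) /\<^sub>R X i) * f y \<partial>lborel) \<longlonglongrightarrow> (\<integral>y. a ((x - y) /\<^sub>R e) * f y \<partial>lborel))"
    show "(SUP e\<in>D. ereal \<bar>approx_avg a e f x\<bar>) = approx_max a f x"
      unfolding approx_max_def
    proof (rule antisym)
      show "(SUP e\<in>D. ereal \<bar>approx_avg a e f x\<bar>) \<le> (SUP e\<in>{0<..}. ereal \<bar>approx_avg a e f x\<bar>)"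
        by (rule SUP_subset_mono) (auto simp: D_def)
      show "(SUP e\<in>{0<..}. ereal \<bar>approx_avg a e f x\<bar>) \<le> (SUP e\<in>D. ereal \<bar>approx_avg a e f x\<bar>)"
      proof (rule SUP_least)
        fix e :: real assume "e \<in> {0<..}"
        then have e: "0 < e" by simp
        have "\<exists>q\<in>\<rat>. e < q \<and> q < e + 1 / real (Suc i)" for i
          by (rule Rats_dense_in_real) simp
        then obtain X where X: "\<And>i. X i \<in> \<rat>" "\<And>i. e < X i" "\<And>i. X i < e + 1 / real (Suc i)"
          by metis
        have "(\<lambda>i. e + 1 / real (Suc i)) \<longlonglongrightarrow> e + 0"
          by (intro tendsto_intros LIMSEQ_Suc[OF lim_1_over_n])
        then have "(\<lambda>i. e + 1 / real (Suc i)) \<longlonglongrightarrow> e" by simp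
        then have lim: "X \<longlonglongrightarrow> e"
          by (rule tendsto_sandwich[rotated 2, OF tendsto_const])
            (use X in \<open>auto intro!: always_eventually less_imp_le\<close>)
        have X0: "0 < X i" for i using X(2)[of i] e by linarith
        have "(\<lambda>i. approx_avg a (X i) f x) \<longlonglongrightarrow> approx_avg a e f x"
          unfolding approx_avg_borel[OF \<open>a \<in> _\<close> f]
          using * lim e X0 by (intro tendsto_intros) auto
        then have "(\<lambda>i. ereal \<bar>approx_avg a (X i) f x\<bar>) \<longlonglongrightarrow> ereal \<bar>approx_avg a e f x\<bar>"
          by (intro tendsto_intros)
        then show "ereal \<bar>approx_avg a e f x\<bar> \<le> (SUP e\<in>D. ereal \<bar>approx_avg a e f x\<bar>)"
          by (rule LIMSEQ_le_const2) (use X X0 in \<open>auto simp: D_def intro!: SUP_upper\<close>)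
      qed
    qed
  qed
  with meas show ?thesis by (rule measurable_lebesgue_AE_eq)
qed

section \<open>Log-decaying exponents and the local Morrey-Lorentz norm\<close>

lemma AE_lborel_meets_interval:
  fixes u v :: real
  assumes "AE t in lborel. Q t" and "u < v"
  shows "\<exists>t. u < t \<and> t < v \<and> Q t"
proof (rule ccontr)
  assume *: "\<not> ?thesis"
  obtain N where N: "{t \<in> space lborel. \<not> Q t} \<subseteq> N" "emeasure lborel N = 0" "N \<in> sets lborel"
    by (rule AE_E[OF assms(1)])
  have "{u<..<v} \<subseteq> N" using * N(1) by auto
  then have "emeasure lborel {u<..<v} \<le> emeasure lborel N" using N(3) by (rule emeasure_mono)
  then show False using N(2) assms(2) by simp
qed

text \<open>The two decay conditions and boundedness combine into one estimate on the whole half-line, with the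
reference exponent jumping at 1. A limit at 0 or infinity cannot be smaller than the essential lower
bound, since near the end point \<open>p\<close> would be too small on a whole interval.\<close>

lemma exponents_decay:
  assumes p: "p \<in> exponents" and lower: "1 < ess_lower p"
  obtains l0 l1 A where "1 < l0" "1 < l1" "0 \<le> A" "AE t in lborel. 0 < t \<longrightarrow> 1 \<le> p t"
    "\<And>t. 0 < t \<Longrightarrow> \<bar>p t - split_at_one l0 l1 t\<bar> * (1 + \<bar>ln t\<bar>) \<le> A"
proof -
  obtain c where c: "1 < c" "ereal c < ess_lower p"
    using ereal_dense2[OF lower] by auto
  have "AE t in lebesgue_on {0<..}. - ereal (p t) \<le> - ess_lower p"
    using esssup_AE[of "\<lambda>t. - ereal (p t)" "lebesgue_on {0<..}"] by (simp add: ess_lower_def)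
  then have "AE t in lborel. 0 < t \<longrightarrow> - ereal (p t) \<le> - ess_lower p"
    by (subst (asm) AE_restrict_space_iff) (auto simp: AE_completion_iff)
  then have AEc: "AE t in lborel. 0 < t \<longrightarrow> c \<le> p t"
  proof eventually_elim
    fix t assume *: "0 < t \<longrightarrow> - ereal (p t) \<le> - ess_lower p"
    show "0 < t \<longrightarrow> c \<le> p t"
    proof
      assume "0 < t"
      with * have "- ereal (p t) \<le> - ess_lower p" by blast
      then have "ess_lower p \<le> ereal (p t)" by (simp only: ereal_minus_le_minus)
      with c(2) have "ereal c < ereal (p t)" by (rule order.strict_trans2)
      then show "c \<le> p t" by simp
    qed
  qed
  obtain l0 l1 where l: "log_decay_zero p l0" "log_decay_infty p l1"
    using p by (auto simp: exponents_def)
  obtain A0 where A0: "0 < A0" "\<And>t. 0 < t \<Longrightarrow> t \<le> 1/2 \<Longrightarrow> \<bar>p t - l0\<bar> \<le> A0 / \<bar>ln t\<bar>"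
    using l(1) by (auto simp: log_decay_zero_def)
  obtain A1 where A1: "0 < A1" "\<And>t. 2 \<le> t \<Longrightarrow> \<bar>p t - l1\<bar> \<le> A1 / ln t"
    using l(2) by (auto simp: log_decay_infty_def)
  obtain M where M: "\<And>t. 0 < t \<Longrightarrow> \<bar>p t\<bar> \<le> M"
    using p by (auto simp: exponents_def bounded_iff)
  have "c \<le> l0"
  proof (rule ccontr)
    assume "\<not> c \<le> l0"
    then have "\<forall>\<^sub>F t in at_right 0. p t < c"
      using order_tendstoD(2)[OF log_decay_zero_tendsto[OF l(1)]] by simp
    then obtain b where b: "0 < b" "\<And>t. 0 < t \<Longrightarrow> t < b \<Longrightarrow> p t < c"
      by (auto simp: eventually_at_right_field)
    from AE_lborel_meets_interval[OF AEc b(1)] b(2) show False by force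
  qed
  have "c \<le> l1"
  proof (rule ccontr)
    assume "\<not> c \<le> l1"
    then have "\<forall>\<^sub>F t in at_top. p t < c"
      using order_tendstoD(2)[OF log_decay_infty_tendsto[OF l(2)]] by simp
    then obtain b where b: "\<And>t. b \<le> t \<Longrightarrow> p t < c"
      by (auto simp: eventually_at_top_linorder)
    have "max b 1 < max b 1 + 1" by simp
    from AE_lborel_meets_interval[OF AEc this]
    obtain t where "max b 1 < t" "0 < t \<longrightarrow> c \<le> p t" by blast
    then show False using b[of t] by simp
  qed
  define D where "D = 2 * (M + \<bar>l0\<bar> + \<bar>l1\<bar>)"
  have D: "0 \<le> D" using M[of 1] by (simp add: D_def)
  have decay: "x * (1 + s) \<le> K / ln 2 + K" if "0 \<le> x" "x \<le> K / s" "ln 2 \<le> s" "0 < K" for x s K :: real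
  proof -
    have s: "0 < s" using that(3) by (rule order.strict_trans2[rotated]) simp
    have "x * (1 + s) \<le> K / s * (1 + s)" using that s by (intro mult_right_mono) auto
    also have "\<dots> = K / s + K" using s by (simp add: field_simps)
    also have "\<dots> \<le> K / ln 2 + K" using that s by (intro add_mono divide_left_mono) auto
    finally show ?thesis .
  qed
  show thesis
  proof (rule that[of l0 l1 "(A0 / ln 2 + A0) + (A1 / ln 2 + A1) + D"])
    show "1 < l0" "1 < l1" using c \<open>c \<le> l0\<close> \<open>c \<le> l1\<close> by auto
    show "0 \<le> (A0 / ln 2 + A0) + (A1 / ln 2 + A1) + D" using A0 A1 D by simp
    show "AE t in lborel. 0 < t \<longrightarrow> 1 \<le> p t" using AEc by eventually_elim (use c in auto)
    fix t :: real assume t: "0 < t"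
    have nn: "0 \<le> A0 / ln 2 + A0" "0 \<le> A1 / ln 2 + A1" using A0 A1 by auto
    consider "t \<le> 1/2" | "1/2 < t" "t < 2" | "2 \<le> t" by linarith
    then show "\<bar>p t - split_at_one l0 l1 t\<bar> * (1 + \<bar>ln t\<bar>) \<le> (A0 / ln 2 + A0) + (A1 / ln 2 + A1) + D"
    proof cases
      case 1
      have "ln t \<le> ln (1/2)" using t 1 by simp
      then have "ln 2 \<le> \<bar>ln t\<bar>" by (simp add: ln_div)
      then have "\<bar>p t - l0\<bar> * (1 + \<bar>ln t\<bar>) \<le> A0 / ln 2 + A0"
        using A0 t 1 by (intro decay) auto
      then show ?thesis using nn D 1 by (simp add: split_at_one_def)
    next
      case 2
      have "ln (1/2) < ln t" "ln t < ln 2" using t 2 by (simp_all only: ln_less_cancel_iff)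
      then have "\<bar>ln t\<bar> \<le> 1" using ln_2_less_1 by (simp add: ln_div abs_le_iff)
      moreover have "\<bar>p t - split_at_one l0 l1 t\<bar> \<le> M + \<bar>l0\<bar> + \<bar>l1\<bar>"
        using M[OF t] by (auto simp: split_at_one_def)
      ultimately have "\<bar>p t - split_at_one l0 l1 t\<bar> * (1 + \<bar>ln t\<bar>) \<le> (M + \<bar>l0\<bar> + \<bar>l1\<bar>) * 2"
        using M[of 1] by (intro mult_mono) auto
      then show ?thesis using nn by (simp add: D_def)
    next
      case 3
      have "ln 2 \<le> ln t" using 3 by simp
      moreover have "0 < ln t" using 3 by simp
      ultimately have "\<bar>p t - l1\<bar> * (1 + \<bar>ln t\<bar>) \<le> A1 / ln 2 + A1"
        using A1(1) A1(2)[OF 3] by (intro decay) auto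
      then show ?thesis using nn D 3 by (simp add: split_at_one_def)
    qed
  qed
qed

lemma exponents_borel_version:
  assumes "p \<in> exponents"
  obtains p' where "p' \<in> borel_measurable borel" "AE t in lborel. 0 < t \<longrightarrow> p t = p' t"
proof -
  have "p \<in> borel_measurable (lebesgue_on {0<..})" using assms by (simp add: exponents_def)
  then have "(\<lambda>t. if t \<in> {0<..} then p t else 0) \<in> borel_measurable lebesgue"
    by (rule borel_measurable_if_I) simp
  from completion_ex_borel_measurable_real[OF this]
  obtain p' where "p' \<in> borel_measurable lborel" "AE t in lborel. (if t \<in> {0<..} then p t else 0) = p' t"
    by blast
  then show thesis by (intro that[of p']) (auto elim: eventually_mono)
qed

text \<open>The exponent \<open>1 / p - 1 / q\<close> of the weight inherits the decay of \<open>p\<close> and \<open>q\<close> because \<open>1 / u\<close> is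
1-Lipschitz for \<open>u \<ge> 1\<close>. The conditions of the Hardy inequality become \<open>0 < 1 / p0\<close> and \<open>1 / p0 < 1\<close>
at 0, and likewise at infinity.\<close>

lemma hardy_inequality_exponents:
  assumes p: "p \<in> exponents" "1 < ess_lower p" and q: "q \<in> exponents" "1 < ess_lower q"
  obtains q' w K where "q' \<in> borel_measurable borel" "w \<in> borel_measurable borel"
    "AE t in lborel. 0 < t \<longrightarrow> q t = q' t \<and> beta p q t = w t \<and> 1 \<le> q' t" "1 \<le> K"
    "\<And>g. g \<in> borel_measurable borel \<Longrightarrow> antimono_on {0<..} g \<Longrightarrow>
      modular q' (\<lambda>t. ennreal (t powr w t) * g t) \<le> 1 \<Longrightarrow>
      modular q' (\<lambda>t. ennreal (t powr w t) * hardy g t) \<le> ennreal K"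
proof -
  obtain p0 p1 Ap where P: "1 < p0" "1 < p1" "0 \<le> Ap" "AE t in lborel. 0 < t \<longrightarrow> 1 \<le> p t"
    "\<And>t. 0 < t \<Longrightarrow> \<bar>p t - split_at_one p0 p1 t\<bar> * (1 + \<bar>ln t\<bar>) \<le> Ap"
    using exponents_decay[OF p] by blast
  obtain q0 q1 Aq where Q: "1 < q0" "1 < q1" "0 \<le> Aq" "AE t in lborel. 0 < t \<longrightarrow> 1 \<le> q t"
    "\<And>t. 0 < t \<Longrightarrow> \<bar>q t - split_at_one q0 q1 t\<bar> * (1 + \<bar>ln t\<bar>) \<le> Aq"
    using exponents_decay[OF q] by blast
  obtain p' where p' [measurable]: "p' \<in> borel_measurable borel" and pp': "AE t in lborel. 0 < t \<longrightarrow> p t = p' t"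
    using exponents_borel_version[OF p(1)] by blast
  obtain q' where q' [measurable]: "q' \<in> borel_measurable borel" and qq': "AE t in lborel. 0 < t \<longrightarrow> q t = q' t"
    using exponents_borel_version[OF q(1)] by blast
  define w where "w t = 1 / p' t - 1 / q' t" for t
  have [measurable]: "w \<in> borel_measurable borel" unfolding w_def by measurable
  have recip: "\<bar>1 / u - 1 / v\<bar> \<le> \<bar>u - v\<bar>" if "1 \<le> u" "1 \<le> v" for u v :: real
  proof -
    have "1 / u - 1 / v = (v - u) / (u * v)" using that by (simp add: field_simps)
    then have "\<bar>1 / u - 1 / v\<bar> = \<bar>u - v\<bar> / (u * v)" using that by (simp add: abs_minus_commute abs_mult)
    also have "\<dots> \<le> \<bar>u - v\<bar> / 1"
      using that mult_mono[of 1 u 1 v] by (intro divide_left_mono) auto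
    finally show ?thesis by simp
  qed
  have q'1: "AE t in lborel. 0 < t \<longrightarrow> 1 \<le> q' t \<and> \<bar>q' t - split_at_one q0 q1 t\<bar> * (1 + \<bar>ln t\<bar>) \<le> Ap + Aq"
    using Q(4) qq'
  proof eventually_elim
    fix t assume *: "0 < t \<longrightarrow> 1 \<le> q t" "0 < t \<longrightarrow> q t = q' t"
    show "0 < t \<longrightarrow> 1 \<le> q' t \<and> \<bar>q' t - split_at_one q0 q1 t\<bar> * (1 + \<bar>ln t\<bar>) \<le> Ap + Aq"
      using * Q(5)[of t] P(3) by auto
  qed
  have w1: "AE t in lborel. 0 < t \<longrightarrow>
      \<bar>w t - split_at_one (1 / p0 - 1 / q0) (1 / p1 - 1 / q1) t\<bar> * \<bar>ln t\<bar> \<le> Ap + Aq"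
    using P(4) Q(4) pp' qq'
  proof eventually_elim
    fix t assume *: "0 < t \<longrightarrow> 1 \<le> p t" "0 < t \<longrightarrow> 1 \<le> q t" "0 < t \<longrightarrow> p t = p' t" "0 < t \<longrightarrow> q t = q' t"
    show "0 < t \<longrightarrow> \<bar>w t - split_at_one (1 / p0 - 1 / q0) (1 / p1 - 1 / q1) t\<bar> * \<bar>ln t\<bar> \<le> Ap + Aq"
    proof
      assume t: "0 < t"
      define u where "u = split_at_one p0 p1 t"
      define v where "v = split_at_one q0 q1 t"
      have uv: "1 \<le> u" "1 \<le> v" using P Q by (auto simp: u_def v_def split_at_one_def)
      have "w t - split_at_one (1 / p0 - 1 / q0) (1 / p1 - 1 / q1) t = (1 / p t - 1 / u) - (1 / q t - 1 / v)"
        using * t by (simp add: w_def u_def v_def split_at_one_def)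
      also have "\<bar>\<dots>\<bar> \<le> \<bar>1 / p t - 1 / u\<bar> + \<bar>1 / q t - 1 / v\<bar>" by linarith
      also have "\<dots> \<le> \<bar>p t - u\<bar> + \<bar>q t - v\<bar>" using * t uv by (intro add_mono recip) auto
      finally have "\<bar>w t - split_at_one (1 / p0 - 1 / q0) (1 / p1 - 1 / q1) t\<bar> * \<bar>ln t\<bar> \<le>
          (\<bar>p t - u\<bar> + \<bar>q t - v\<bar>) * (1 + \<bar>ln t\<bar>)"
        by (intro mult_mono) auto
      also have "\<dots> \<le> Ap + Aq" using P(5)[OF t] Q(5)[OF t] by (simp add: distrib_right u_def v_def)
      finally show "\<bar>w t - split_at_one (1 / p0 - 1 / q0) (1 / p1 - 1 / q1) t\<bar> * \<bar>ln t\<bar> \<le> Ap + Aq" .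
    qed
  qed
  have "\<exists>K\<ge>1. \<forall>g. g \<in> borel_measurable borel \<longrightarrow> antimono_on {0<..} g \<longrightarrow>
    modular q' (\<lambda>t. ennreal (t powr w t) * g t) \<le> 1 \<longrightarrow>
    modular q' (\<lambda>t. ennreal (t powr w t) * hardy g t) \<le> ennreal K"
    by (rule hardy_inequality_variable_exponent[OF _ _ _ _ _ _ _ _ _ q'1 w1]) (use P Q in auto)
  then obtain K where K: "1 \<le> K" "\<And>g. g \<in> borel_measurable borel \<Longrightarrow> antimono_on {0<..} g \<Longrightarrow>
      modular q' (\<lambda>t. ennreal (t powr w t) * g t) \<le> 1 \<Longrightarrow>
      modular q' (\<lambda>t. ennreal (t powr w t) * hardy g t) \<le> ennreal K" by blast
  have "AE t in lborel. 0 < t \<longrightarrow> q t = q' t \<and> beta p q t = w t \<and> 1 \<le> q' t"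
    using q'1 pp' qq' by eventually_elim (auto simp: w_def beta_def)
  then show thesis by (intro that[of q' w K] K) auto
qed

lemma ennreal_powr_divide_le:
  assumes "1 \<le> K" "1 \<le> a"
  shows "ennreal_powr (x / ennreal K) a \<le> ennreal_powr x a / ennreal K"
proof (cases x)
  case (real u)
  have "K powr 1 \<le> K powr a" using assms by (intro powr_mono) auto
  then have "u powr a / K powr a \<le> u powr a / K" using assms by (intro divide_left_mono) auto
  then show ?thesis using real assms
    by (simp add: divide_ennreal ennreal_powr_ennreal powr_divide ennreal_leI)
next
  case top
  then show ?thesis using assms by (simp add: ennreal_top_divide)
qed

text \<open>Cutting \<open>F\<close> off at \<open>r\<close> keeps it non-increasing and does not change its averages on \<open>(0, r)\<close>, so the
inequality on the half-line localises with the same constant. Dividing by \<open>K \<ge> 1\<close> brings the modular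
below 1 since the exponent is at least 1. The second conclusion is what makes the rearrangement of a function in the
Morrey-Lorentz space integrable near 0.\<close>

lemma luxemburg_unit_ball_hardy:
  assumes [measurable]: "q' \<in> borel_measurable borel" "w \<in> borel_measurable borel"
    and ae: "AE t in lborel. 0 < t \<longrightarrow> q t = q' t \<and> b t = w t \<and> 1 \<le> q' t" and K: "1 \<le> K"
    and hardy: "\<And>g. g \<in> borel_measurable borel \<Longrightarrow> antimono_on {0<..} g \<Longrightarrow>
      modular q' (\<lambda>t. ennreal (t powr w t) * g t) \<le> 1 \<Longrightarrow>
      modular q' (\<lambda>t. ennreal (t powr w t) * hardy g t) \<le> ennreal K"
    and F [measurable]: "F \<in> borel_measurable borel" and anti: "antimono F"
    and \<eta>: "0 < \<eta>" and r: "0 < r"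
    and le: "(\<integral>\<^sup>+s\<in>{0<..<r}. ennreal_powr (ennreal (s powr b s) * F s / ennreal \<eta>) (q s) \<partial>lebesgue) \<le> 1"
  shows "(\<integral>\<^sup>+s\<in>{0<..<r}. ennreal_powr (ennreal (s powr b s) * hardy F s / ennreal (K * \<eta>)) (q s) \<partial>lebesgue) \<le> 1"
    and "\<exists>t. 0 < t \<and> t < r \<and> hardy F t \<noteq> top"
proof -
  define g where "g s = F s / ennreal \<eta> * indicator {0<..<r} s" for s
  have [measurable]: "g \<in> borel_measurable borel" unfolding g_def by measurable
  have g: "antimono_on {0<..} g"
    by (rule monotone_onI) (auto simp: g_def split: split_indicator intro!: divide_right_mono_ennreal antimonoD[OF anti])
  have hg: "hardy g s = hardy F s / ennreal \<eta>" if "s \<le> r" for s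
  proof -
    have "(\<integral>\<^sup>+u\<in>{0<..<s}. g u \<partial>lborel) = (\<integral>\<^sup>+u. F u * indicator {0<..<s} u / ennreal \<eta> \<partial>lborel)"
      using that by (intro nn_integral_cong) (auto simp: g_def split: split_indicator)
    also have "\<dots> = (\<integral>\<^sup>+u\<in>{0<..<s}. F u \<partial>lborel) / ennreal \<eta>"
      by (rule nn_integral_divide) measurable
    finally show ?thesis
      by (simp add: hardy_def divide_ennreal_def mult_ac)
  qed
  have "modular q' (\<lambda>t. ennreal (t powr w t) * g t) \<le>
      (\<integral>\<^sup>+s\<in>{0<..<r}. ennreal_powr (ennreal (s powr b s) * F s / ennreal \<eta>) (q s) \<partial>lborel)"
    by (rule nn_integral_mono_AE, use ae in eventually_elim)
      (auto simp: g_def ennreal_times_divide split: split_indicator)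
  also have "\<dots> \<le> 1" using le by (simp add: nn_integral_completion)
  finally have H: "modular q' (\<lambda>t. ennreal (t powr w t) * hardy g t) \<le> ennreal K"
    by (intro hardy g) auto
  have "(\<integral>\<^sup>+s\<in>{0<..<r}. ennreal_powr (ennreal (s powr b s) * hardy F s / ennreal (K * \<eta>)) (q s) \<partial>lborel) \<le>
      (\<integral>\<^sup>+s. ennreal_powr (ennreal (s powr w s) * hardy g s) (q' s) * indicator {0<..} s / ennreal K \<partial>lborel)"
  proof (rule nn_integral_mono_AE, use ae in eventually_elim)
    fix s assume *: "0 < s \<longrightarrow> q s = q' s \<and> b s = w s \<and> 1 \<le> q' s"
    show "ennreal_powr (ennreal (s powr b s) * hardy F s / ennreal (K * \<eta>)) (q s) * indicator {0<..<r} s \<le>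
        ennreal_powr (ennreal (s powr w s) * hardy g s) (q' s) * indicator {0<..} s / ennreal K"
    proof (cases "s \<in> {0<..<r}")
      case True
      have "ennreal (s powr b s) * hardy F s / ennreal (K * \<eta>) = ennreal (s powr w s) * hardy g s / ennreal K"
        using True * K \<eta> by (simp add: hg divide_ennreal_def ennreal_mult ennreal_inverse_mult mult_ac)
      then show ?thesis
        using True * ennreal_powr_divide_le[OF K, of "q' s" "ennreal (s powr w s) * hardy g s"] by simp
    qed simp
  qed
  also have "\<dots> = modular q' (\<lambda>t. ennreal (t powr w t) * hardy g t) / ennreal K"
    by (rule nn_integral_divide) measurable
  also have "\<dots> \<le> ennreal K / ennreal K" using H by (rule divide_right_mono_ennreal)
  also have "\<dots> = 1" using K by (simp add: divide_ennreal)
  finally show "(\<integral>\<^sup>+s\<in>{0<..<r}. ennreal_powr (ennreal (s powr b s) * hardy F s / ennreal (K * \<eta>)) (q s) \<partial>lebesgue) \<le> 1"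
    by (simp add: nn_integral_completion)
  have "AE t in lborel. ennreal_powr (ennreal (t powr w t) * hardy g t) (q' t) * indicator {0<..} t \<noteq> \<infinity>"
    by (rule nn_integral_noteq_infinite) (use H in \<open>auto simp: top_unique\<close>)
  from AE_lborel_meets_interval[OF this r] obtain t where t: "0 < t" "t < r"
    "ennreal_powr (ennreal (t powr w t) * hardy g t) (q' t) \<noteq> top"
    by auto
  then have "hardy g t \<noteq> top" using t by (auto simp: ennreal_mult_top)
  then have "hardy F t \<noteq> top" using t \<eta> by (auto simp: hg ennreal_top_divide)
  then show "\<exists>t. 0 < t \<and> t < r \<and> hardy F t \<noteq> top" using t by blast
qed

lemma rearrangement_cong_AE:
  fixes f f' :: "'a::euclidean_space \<Rightarrow> real"
  assumes f: "f \<in> borel_measurable lebesgue" and f': "f' \<in> borel_measurable lebesgue"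
    and ae: "AE x in lebesgue. f x = f' x"
  shows "rearrangement (\<lambda>x. ereal (f x)) = rearrangement (\<lambda>x. ereal (f' x))"
proof -
  have "emeasure lebesgue {y. ereal \<mu> < \<bar>ereal (f y)\<bar>} = emeasure lebesgue {y. ereal \<mu> < \<bar>ereal (f' y)\<bar>}" for \<mu>
  proof (rule emeasure_eq_AE)
    show "AE x in lebesgue. x \<in> {y. ereal \<mu> < \<bar>ereal (f y)\<bar>} \<longleftrightarrow> x \<in> {y. ereal \<mu> < \<bar>ereal (f' y)\<bar>}"
      using ae by eventually_elim simp
    have "{y \<in> space lebesgue. \<mu> < \<bar>f y\<bar>} \<in> sets lebesgue" "{y \<in> space lebesgue. \<mu> < \<bar>f' y\<bar>} \<in> sets lebesgue"
      using f f' by measurable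
    then show "{y. ereal \<mu> < \<bar>ereal (f y)\<bar>} \<in> sets lebesgue" "{y. ereal \<mu> < \<bar>ereal (f' y)\<bar>} \<in> sets lebesgue"
      by simp_all
  qed
  then show ?thesis by (simp add: rearrangement_def fun_eq_iff)
qed

lemma
  fixes a f :: "'a::euclidean_space \<Rightarrow> real"
  assumes [measurable]: "a' \<in> borel_measurable borel" "f' \<in> borel_measurable borel"
    and a: "AE z in lborel. a z = a' z" and f: "AE y in lborel. f y = f' y" and e: "0 < e"
  shows approx_avg_cong_AE: "approx_avg a e f x = approx_avg a' e f' x"
    and integrable_kernel_cong_AE: "integrable lborel (\<lambda>y. a' ((x - y) /\<^sub>R e) * f' y) \<Longrightarrow>
      integrable lebesgue (\<lambda>y. a ((x - y) /\<^sub>R e) * f y)"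
proof -
  have ae: "AE y in lebesgue. a' ((x - y) /\<^sub>R e) * f' y = a ((x - y) /\<^sub>R e) * f y"
    unfolding AE_completion_iff
    using AE_lborel_reflected_dilation[OF a e, of x] f by eventually_elim simp
  have m': "(\<lambda>y. a' ((x - y) /\<^sub>R e) * f' y) \<in> borel_measurable lborel" by measurable
  then have m'': "(\<lambda>y. a' ((x - y) /\<^sub>R e) * f' y) \<in> borel_measurable lebesgue"
    by (rule measurable_completion)
  have m: "(\<lambda>y. a ((x - y) /\<^sub>R e) * f y) \<in> borel_measurable lebesgue"
    using m'' ae by (rule measurable_lebesgue_AE_eq)
  show "approx_avg a e f x = approx_avg a' e f' x"
    unfolding approx_avg_def using integral_cong_AE[OF m'' m ae] by simp
  show "integrable lebesgue (\<lambda>y. a ((x - y) /\<^sub>R e) * f y)"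
    if "integrable lborel (\<lambda>y. a' ((x - y) /\<^sub>R e) * f' y)"
    using that integrable_cong_AE[OF m'' m ae] integrable_completion[OF m'] by simp
qed

theorem corollary2:
  fixes p q :: "real \<Rightarrow> real" and lam :: real and a :: "real ^ 'n \<Rightarrow> real"
  assumes "p \<in> exponents" and "q \<in> exponents"
    and "1 < ess_lower p" and "ess_lower p \<le> ess_upper p" and "ess_upper p < \<infinity>"
    and "1 < ess_lower q" and "ess_lower q \<le> ess_upper q" and "ess_upper q < \<infinity>"
    and "0 \<le> lam" and "lam < 1"
    and "bdd_above ((\<lambda>r. min 1 r powr (1 / at_zero q) * r powr (- (lam / q_star q r))) ` {0<..})"
    and "\<exists>L. ((\<lambda>t. t powr beta p q t) \<longlongrightarrow> L) (at_right 0)"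
    and "\<exists>\<alpha>. almost_decreasing (\<lambda>t. t powr (beta p q t - \<alpha>)) \<and>
             almost_decreasing (\<lambda>t. t powr (lam / q_star q t - beta p q t - \<alpha>))"
    and "\<forall>t>0. beta p q t < lam / q_star q t + (1 - 1 / at_zero q)"
    and "integrable lebesgue a" and "(\<integral>y. a y \<partial>lebesgue) = 1"
    and "has_radial_decreasing_integrable_majorant a"
  shows "\<exists>C::real. C > 0 \<and>
    (\<forall>f :: real ^ 'n \<Rightarrow> real. (\<lambda>x. ereal (f x)) \<in> morrey_lorentz p q lam \<longrightarrow>
       (AE x in lebesgue. \<forall>\<epsilon>>0. integrable lebesgue (\<lambda>y. a ((x - y) /\<^sub>R \<epsilon>) * f y)) \<and>
       approx_max a f \<in> morrey_lorentz p q lam \<and>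
       morrey_lorentz_norm p q lam (approx_max a f)
         \<le> ennreal C * morrey_lorentz_norm p q lam (\<lambda>x. ereal (f x)))"
proof -
  obtain q' w K where [measurable]: "q' \<in> borel_measurable borel" "w \<in> borel_measurable borel"
    and ae: "AE t in lborel. 0 < t \<longrightarrow> q t = q' t \<and> beta p q t = w t \<and> 1 \<le> q' t" and K: "1 \<le> K"
    and H: "\<And>g. g \<in> borel_measurable borel \<Longrightarrow> antimono_on {0<..} g \<Longrightarrow>
      modular q' (\<lambda>t. ennreal (t powr w t) * g t) \<le> 1 \<Longrightarrow>
      modular q' (\<lambda>t. ennreal (t powr w t) * hardy g t) \<le> ennreal K"
    using hardy_inequality_exponents[OF assms(1,3,2,6)] by blast
  note hardy_lux = luxemburg_unit_ball_hardy[OF \<open>q' \<in> _\<close> \<open>w \<in> _\<close> ae K H]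
  obtain a' where a' [measurable]: "a' \<in> borel_measurable borel" and aa': "AE z in lborel. a z = a' z"
    using completion_ex_borel_measurable_real[OF borel_measurable_integrable[OF assms(15)]] by auto
  have aa'_leb: "AE z in lebesgue. a z = a' z" using aa' by (simp add: AE_completion_iff)
  have a'_leb: "a' \<in> borel_measurable lebesgue" by (rule measurable_completion) simp
  have a'_int: "integrable lborel a'" and a'_one: "(\<integral>z. a' z \<partial>lborel) = 1"
    using integrable_cong_AE[OF borel_measurable_integrable[OF assms(15)] a'_leb aa'_leb]
      integral_cong_AE[OF borel_measurable_integrable[OF assms(15)] a'_leb aa'_leb] assms(15,16)
      integrable_completion[of a' lborel] integral_completion[of a' lborel] by auto
  obtain \<psi>0 where \<psi>0: "antimono_on {0<..} \<psi>0" "integrable lebesgue (\<lambda>x::real^'n. \<psi>0 (norm x))"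
    "\<And>x::real^'n. x \<noteq> 0 \<Longrightarrow> \<bar>a x\<bar> \<le> \<psi>0 (norm x)"
    using assms(17) by (auto simp: has_radial_decreasing_integrable_majorant_def)
  define \<psi> where "\<psi> t = (if t \<in> {0<..} then \<psi>0 t else 0)" for t
  have \<psi>: "antimono_on {0<..} \<psi>"
    using \<psi>0(1) by (auto simp: monotone_on_def \<psi>_def)
  have \<psi>m [measurable]: "\<psi> \<in> borel_measurable borel"
    unfolding \<psi>_def using borel_measurable_antimono_on_halfline[OF \<psi>0(1)]
    by (subst measurable_If_restrict_space_iff) (auto simp: greaterThan_def)
  have AE0: "AE z in lborel. z \<noteq> (0 :: real^'n)" by (rule AE_lborel_singleton)
  have a\<psi>: "AE z in lborel. \<bar>a' z\<bar> \<le> \<psi> (norm z)"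
    using AE0 aa' by eventually_elim (use \<psi>0(3) in \<open>force simp: \<psi>_def\<close>)
  have "(\<integral>\<^sup>+z. ennreal (\<psi> (norm (z :: real^'n))) \<partial>lborel) \<le> (\<integral>\<^sup>+z. ennreal (norm (\<psi>0 (norm (z :: real^'n)))) \<partial>lebesgue)"
    by (subst nn_integral_completion) (auto intro!: nn_integral_mono ennreal_leI simp: \<psi>_def)
  also have "\<dots> < \<infinity>" using \<psi>0(2) by (simp add: integrable_iff_bounded)
  finally obtain P where P: "(\<integral>\<^sup>+z. ennreal (\<psi> (norm (z :: real^'n))) \<partial>lborel) = ennreal P" "0 \<le> P"
    by (cases "\<integral>\<^sup>+z. ennreal (\<psi> (norm (z :: real^'n))) \<partial>lborel") auto
  \<comment> \<open>The normalisation \<open>\<integral>a = 1\<close> keeps the majorant from vanishing.\<close>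
  have "ennreal 1 \<le> (\<integral>\<^sup>+z. ennreal (norm (a' z)) \<partial>lborel)"
    using integral_norm_bound_ennreal[OF a'_int] a'_one by simp
  also have "\<dots> \<le> ennreal P"
    unfolding P(1)[symmetric] by (rule nn_integral_mono_AE, use a\<psi> in eventually_elim) (simp add: ennreal_leI)
  finally have P1: "1 \<le> P" using P(2) by (simp only: ennreal_le_iff)
  define c where "c = P * (5 ^ DIM(real^'n) + 1)"
  have c: "0 < c" using P1 by (simp add: c_def add_pos_pos)
  have cK: "0 < c * K" using c K by simp
  show ?thesis
  proof (intro exI[of _ "c * K"] conjI allI impI)
    show "0 < c * K" by (rule cK)
  next
    fix f :: "real^'n \<Rightarrow> real"
    assume fM: "(\<lambda>x. ereal (f x)) \<in> morrey_lorentz p q lam"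
    then have f: "f \<in> borel_measurable lebesgue" and fin: "morrey_lorentz_norm p q lam (\<lambda>x. ereal (f x)) < \<infinity>"
      by (auto simp: morrey_lorentz_def borel_measurable_ereal_iff)
    obtain f' where f' [measurable]: "f' \<in> borel_measurable borel" and ff': "AE y in lborel. f y = f' y"
      using completion_ex_borel_measurable_real[OF f] by auto
    define F where "F = rearrangement (\<lambda>x. ereal (f x))"
    have FF': "F = rearrangement (\<lambda>x. ereal (f' x))"
      unfolding F_def by (rule rearrangement_cong_AE[OF f measurable_completion]) (use ff' in \<open>auto simp: AE_completion_iff\<close>)
    have F [measurable]: "F \<in> borel_measurable borel" and F_anti: "antimono F"
      by (simp_all add: F_def antimono_rearrangement)
    have max_eq: "approx_max a f = approx_max a' f'"
      unfolding approx_max_def fun_eq_iff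
      by (intro allI SUP_cong refl) (simp add: approx_avg_cong_AE[OF a' f' aa' ff'])
    have T: "rearrangement (approx_max a f) t \<le> ennreal c * hardy F t" if "0 < t" for t
      unfolding max_eq FF' c_def
      by (rule rearrangement_approx_max_le_hardy[OF \<psi> \<psi>m P(1) _ a' a\<psi> f' that]) (use P1 in simp)
    let ?A = "\<lambda>r. {\<eta>::real. 0 < \<eta> \<and>
      (\<integral>\<^sup>+s\<in>{0<..<r}. ennreal_powr (ennreal (s powr beta p q s) * F s / ennreal \<eta>) (q s) \<partial>lebesgue) \<le> 1}"

    \<comment> \<open>Finiteness of the norm at \<open>r = 1\<close>, where the Morrey factor is 1, makes the excess of \<open>f\<close> over some height integrable.\<close>
    have "lux_norm q {0<..<1} (\<lambda>t. ennreal (t powr beta p q t) * F t) \<le> morrey_lorentz_norm p q lam (\<lambda>x. ereal (f x))"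
      using SUP_upper[of 1 "{0<..}" "\<lambda>r. ennreal (r powr (- (lam / q_star q r))) *
        lux_norm q {0<..<r} (\<lambda>t. ennreal (t powr beta p q t) * F t)"]
      by (simp add: morrey_lorentz_norm_def F_def)
    with fin have "lux_norm q {0<..<1} (\<lambda>t. ennreal (t powr beta p q t) * F t) \<noteq> top" by auto
    then have "?A 1 \<noteq> {}" unfolding lux_norm_def by (metis (no_types, lifting) INF_empty)
    then obtain \<eta> where "0 < \<eta>"
      "(\<integral>\<^sup>+s\<in>{0<..<1}. ennreal_powr (ennreal (s powr beta p q s) * F s / ennreal \<eta>) (q s) \<partial>lebesgue) \<le> 1"
      by blast
    from hardy_lux(2)[OF _ _ _ F F_anti this(1) _ this(2)]
    obtain t where t: "0 < t" "t < 1" "hardy F t \<noteq> top" by auto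
    have "F t \<le> hardy F t"
      using F_anti t by (intro le_hardy) (auto simp: monotone_on_def)
    then have "F t < top" using t(3) by (simp add: less_top order.strict_trans1)
    then obtain \<mu> where \<mu>: "0 < \<mu>" "emeasure lborel {y. \<mu> < \<bar>f' y\<bar>} \<le> ennreal t"
      unfolding FF' rearrangement_borel[OF f'] INF_less_iff by auto
    have "(\<integral>\<^sup>+s\<in>{0<..<t}. F s \<partial>lborel) \<noteq> top"
      using t by (auto simp: hardy_def ennreal_top_divide)
    with excess_integral_le_rearrangement[OF f' \<mu>]
    have fin': "(\<integral>\<^sup>+y. ennreal (\<bar>f' y\<bar> - \<mu>) \<partial>lborel) < \<infinity>"
      by (auto simp: FF' less_top[symmetric] top_unique)

    show "AE x in lebesgue. \<forall>\<epsilon>>0. integrable lebesgue (\<lambda>y. a ((x - y) /\<^sub>R \<epsilon>) * f y)"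
      unfolding AE_completion_iff
      using AE_kernel_integral_continuous[OF \<psi> \<psi>m P a\<psi> a'_int f' fin']
      by eventually_elim (auto intro: integrable_kernel_cong_AE[OF a' f' aa' ff'])

    have lux: "lux_norm q {0<..<r} (\<lambda>t. ennreal (t powr beta p q t) * rearrangement (approx_max a f) t) \<le>
        ennreal (c * K) * lux_norm q {0<..<r} (\<lambda>t. ennreal (t powr beta p q t) * F t)" (is "?L \<le> _") if r: "0 < r" for r
    proof -
      have "?L / ennreal (c * K) \<le> lux_norm q {0<..<r} (\<lambda>t. ennreal (t powr beta p q t) * F t)"
        unfolding lux_norm_def[of q _ "\<lambda>t. ennreal (t powr beta p q t) * F t"]
      proof (rule INF_greatest)
        fix \<eta> assume "\<eta> \<in> ?A r"
        then have \<eta>: "0 < \<eta>" and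
          le: "(\<integral>\<^sup>+s\<in>{0<..<r}. ennreal_powr (ennreal (s powr beta p q s) * F s / ennreal \<eta>) (q s) \<partial>lebesgue) \<le> 1"
          by auto
        have q1: "AE s in lebesgue. 0 < s \<longrightarrow> 0 \<le> q s"
          unfolding AE_completion_iff using ae by eventually_elim auto
        have "(\<integral>\<^sup>+s\<in>{0<..<r}. ennreal_powr (ennreal (s powr beta p q s) * rearrangement (approx_max a f) s /
             ennreal (c * K * \<eta>)) (q s) \<partial>lebesgue) \<le>
          (\<integral>\<^sup>+s\<in>{0<..<r}. ennreal_powr (ennreal (s powr beta p q s) * hardy F s / ennreal (K * \<eta>)) (q s) \<partial>lebesgue)"
        proof (rule nn_integral_mono_AE, use q1 in eventually_elim)
          fix s assume qs: "0 < s \<longrightarrow> 0 \<le> q s"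
          have "ennreal (s powr beta p q s) * rearrangement (approx_max a f) s / ennreal (c * K * \<eta>) \<le>
              ennreal (s powr beta p q s) * hardy F s / ennreal (K * \<eta>)" if s: "0 < s"
          proof -
            have "ennreal (s powr beta p q s) * rearrangement (approx_max a f) s / ennreal (c * K * \<eta>) \<le>
                (ennreal (s powr beta p q s) * (ennreal c * hardy F s)) / ennreal (c * K * \<eta>)"
              by (intro divide_right_mono_ennreal mult_left_mono T s) simp
            also have "\<dots> = (ennreal (s powr beta p q s) * hardy F s * ennreal c / ennreal c) / ennreal (K * \<eta>)"
            proof -
              have "inverse (ennreal (c * K * \<eta>)) = inverse (ennreal c) * inverse (ennreal (K * \<eta>))"
                using c K \<eta> by (simp add: inverse_ennreal mult_ac flip: ennreal_mult)
              then show ?thesis by (simp only: divide_ennreal_def mult_ac)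
            qed
            also have "\<dots> = ennreal (s powr beta p q s) * hardy F s / ennreal (K * \<eta>)"
              using c by (subst mult_divide_eq_ennreal) auto
            finally show ?thesis .
          qed
          then show "ennreal_powr (ennreal (s powr beta p q s) * rearrangement (approx_max a f) s /
               ennreal (c * K * \<eta>)) (q s) * indicator {0<..<r} s \<le>
            ennreal_powr (ennreal (s powr beta p q s) * hardy F s / ennreal (K * \<eta>)) (q s) * indicator {0<..<r} s"
            using qs by (auto split: split_indicator intro!: ennreal_powr_mono)
        qed
        also have "\<dots> \<le> 1" by (rule hardy_lux(1)[OF _ _ _ F F_anti \<eta> r le]) auto
        finally have "?L \<le> ennreal (c * K * \<eta>)"
          unfolding lux_norm_def using cK \<eta> by (intro INF_lower) auto
        also have "\<dots> = ennreal (c * K) * ennreal \<eta>" using cK \<eta> by (simp flip: ennreal_mult)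
        finally show "?L / ennreal (c * K) \<le> ennreal \<eta>"
          using cK by (intro divide_le_posI_ennreal) auto
      qed
      then have "ennreal (c * K) * (?L / ennreal (c * K)) \<le>
          ennreal (c * K) * lux_norm q {0<..<r} (\<lambda>t. ennreal (t powr beta p q t) * F t)"
        by (rule mult_left_mono) simp
      moreover have "ennreal (c * K) \<noteq> 0" using cK by (simp only: ennreal_eq_0_iff not_le)
      then have "?L * ennreal (c * K) / ennreal (c * K) = ?L" by (rule mult_divide_eq_ennreal) simp
      then have "ennreal (c * K) * (?L / ennreal (c * K)) = ?L"
        by (simp only: ennreal_times_divide mult.commute[of "ennreal (c * K)"])
      ultimately show ?thesis by simp
    qed
    show bound: "morrey_lorentz_norm p q lam (approx_max a f) \<le> ennreal (c * K) * morrey_lorentz_norm p q lam (\<lambda>x. ereal (f x))"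
      unfolding morrey_lorentz_norm_def[of p q lam "approx_max a f"]
    proof (rule SUP_least)
      fix r :: real assume "r \<in> {0<..}"
      then have r: "0 < r" by simp
      have "ennreal (r powr (- (lam / q_star q r))) *
          lux_norm q {0<..<r} (\<lambda>t. ennreal (t powr beta p q t) * rearrangement (approx_max a f) t) \<le>
        ennreal (r powr (- (lam / q_star q r))) *
          (ennreal (c * K) * lux_norm q {0<..<r} (\<lambda>t. ennreal (t powr beta p q t) * F t))"
        by (intro mult_left_mono lux r) simp
      also have "\<dots> = ennreal (c * K) * (ennreal (r powr (- (lam / q_star q r))) *
          lux_norm q {0<..<r} (\<lambda>t. ennreal (t powr beta p q t) * F t))"
        by (simp only: mult_ac)
      also have "\<dots> \<le> ennreal (c * K) * morrey_lorentz_norm p q lam (\<lambda>x. ereal (f x))"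
        unfolding morrey_lorentz_norm_def F_def using r by (intro mult_left_mono SUP_upper) auto
      finally show "ennreal (r powr (- (lam / q_star q r))) *
          lux_norm q {0<..<r} (\<lambda>t. ennreal (t powr beta p q t) * rearrangement (approx_max a f) t) \<le>
        ennreal (c * K) * morrey_lorentz_norm p q lam (\<lambda>x. ereal (f x))" .
    qed
    have "morrey_lorentz_norm p q lam (approx_max a f) < \<infinity>"
      using bound by (rule order.strict_trans1) (use fin in \<open>simp add: ennreal_mult_less_top\<close>)
    moreover have "approx_max a f \<in> borel_measurable lebesgue"
      unfolding max_eq by (rule measurable_approx_max[OF \<psi> \<psi>m P a\<psi> a'_int f' fin'])
    ultimately show "approx_max a f \<in> morrey_lorentz p q lam"
      by (simp add: morrey_lorentz_def)
  qed
qed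

end
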